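(* (1) Let $\alpha$ be a Brjuno number and $H>0$, and let $W_H=\{w\in\mathbb H^+:\mathrm{Im}\,w\ge|\mathrm{Re}\,w|^H\}$. Then $\lim_{w\to0,\,w\in W_H}\mathrm{Im}\,\mathcal B(w+\alpha)=B(\alpha)$. (2) Let $\alpha$ be irrational and $0<h<1/2$ such that $\liminf_{q\to\infty}\|q\alpha\|_{\mathbb Z}\,q^{1/h-1}=+\infty$ ($q$ ranging over positive integers, $\|\cdot\|_{\mathbb Z}$ the distance to the nearest integer). Let $\tilde W_h=\{w\in\mathbb H^+:\mathrm{Im}\,w\ge\exp(-|\mathrm{Re}\,w|^{-h})\}$. Then $\lim_{w\to0,\,w\in\tilde W_h}\mathrm{Im}\,\mathcal B(w+\alpha)=B(\alpha)$.
   Context: $\mathbb H^+=\{\mathrm{Im}\,w>0\}$. Real Brjuno function: for irrational $\alpha$, let $x_0=\alpha-[\alpha]$, $x_{n+1}=1/x_n-[1/x_n]$, $\beta_{-1}=1$, $\beta_n=x_0x_1\cdots x_n$; $B(\alpha)=\sum_{n\ge0}\beta_{n-1}\log(1/x_n)\in(0,+\infty]$; $\alpha$ is a Brjuno number if $B(\alpha)<\infty$. Complex Brjuno function: $\mathcal B(z)=\lim_{N\to\infty}\sum_{n=-N}^{N}\big(\sum_{g\in\mathcal M}L_g\varphi_0\big)(z-n)$ for $z\in\mathbb C\setminus\mathbb R$, where $\varphi_0(z)=-\frac1\pi\mathrm{Li}_2(1/z)$ ($\mathrm{Li}_2(w)=-\int_0^w\frac{\log(1-t)}tdt$, principal branch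 on $\mathbb C\setminus[1,\infty)$), $\mathcal M$ is the monoid of matrices $\begin{pmatrix}a&b\\c&d\end{pmatrix}\in GL(2,\mathbb Z)$ with $d\ge b\ge a\ge0$, $d\ge c\ge a$, together with the identity, $L_g\varphi(z)=(a-cz)[\varphi(\frac{dz-b}{a-cz})-\varphi(-\frac dc)]-(ad-bc)c^{-1}\varphi'(-\frac dc)$ for $g\ne\mathrm{id}$, and $L_{\mathrm{id}}=\mathrm{id}$ (the family is locally uniformly summable on $\overline{\mathbb C}\setminus[0,1]$). *)

theory Defs
  imports "HOL-Complex_Analysis.Complex_Analysis"
begin

fun brj_x :: "real \<Rightarrow> nat \<Rightarrow> real" where
  "brj_x \<alpha> 0 = frac \<alpha>"
| "brj_x \<alpha> (Suc n) = frac (1 / brj_x \<alpha> n)"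

text \<open>beta_(n-1) = x_0 x_1 ... x_(n-1) (empty product 1 for n = 0).\<close>
definition brj_beta_prev :: "real \<Rightarrow> nat \<Rightarrow> real" where
  "brj_beta_prev \<alpha> n = (\<Prod>k<n. brj_x \<alpha> k)"

definition brjuno_B :: "real \<Rightarrow> ereal" where
  "brjuno_B \<alpha> = (\<Sum>n. ereal (brj_beta_prev \<alpha> n * ln (1 / brj_x \<alpha> n)))"

definition brjuno_number :: "real \<Rightarrow> bool" where
  "brjuno_number \<alpha> \<longleftrightarrow> \<alpha> \<notin> \<rat> \<and> brjuno_B \<alpha> < \<infinity>"

definition dist_Z :: "real \<Rightarrow> real" where
  "dist_Z x = min (frac x) (1 - frac x)"

definition Li2 :: "complex \<Rightarrow> complex" where
  "Li2 w = - contour_integral (linepath 0 w) (\<lambda>t. Ln (1 - t) / t)"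

definition phi0 :: "complex \<Rightarrow> complex" where
  "phi0 z = - (1 / of_real pi) * Li2 (1 / z)"

text \<open>Matrices (a,b,c,d) as quadruples of integers.\<close>
definition brjuno_monoid :: "(int \<times> int \<times> int \<times> int) set" where
  "brjuno_monoid =
     insert (1, 0, 0, 1)
       {(a, b, c, d). \<bar>a * d - b * c\<bar> = 1 \<and> d \<ge> b \<and> b \<ge> a \<and> a \<ge> 0 \<and> d \<ge> c \<and> c \<ge> a}"

definition L_op :: "(int \<times> int \<times> int \<times> int) \<Rightarrow> (complex \<Rightarrow> complex) \<Rightarrow> complex \<Rightarrow> complex" where
  "L_op g \<phi> z =
     (if g = (1, 0, 0, 1) then \<phi> z
      else (case g of (a, b, c, d) \<Rightarrow>
        (of_int a - of_int c * z) *
          (\<phi> ((of_int d * z - of_int b) / (of_int a - of_int c * z)) - \<phi> (- of_int d / of_int c))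
        - of_int (a * d - b * c) / of_int c * deriv \<phi> (- of_int d / of_int c)))"

definition brjuno_F :: "complex \<Rightarrow> complex" where
  "brjuno_F z = (\<Sum>\<^sub>\<infinity>g\<in>brjuno_monoid. L_op g phi0 z)"

definition complex_brjuno :: "complex \<Rightarrow> complex" where
  "complex_brjuno z = lim (\<lambda>N::nat. \<Sum>n\<in>{- int N..int N}. brjuno_F (z - of_int n))"

end

theory Submission
  imports Defs
begin

text \<open>Every \<^term>\<open>L_op g phi0\<close> is \<open>1 / pi\<close> times the Cauchy transform of a nonnegative density: that of
  \<open>ln (1 / s) ds\<close> on \<open>(0, 1)\<close>, transported by \<open>g\<close> and weighted by \<open>1 / (c s + d) ^ 3\<close>. Hence
  \<open>Im \<B>\<close> is a sum of Poisson integrals of nonnegative functions \<open>f\<^sub>g\<close>, and at an irrational \<open>\<alpha>\<close> the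
  \<open>f\<^sub>g\<close> that do not vanish are those of the continued fraction matrices, with values
  \<open>\<beta>\<^bsub>n-1\<^esub> log (1 / x\<^sub>n)\<close>. The lower bound for the limit follows by continuity of each \<open>f\<^sub>g\<close> at \<open>\<alpha>\<close>.

  For the upper bound let \<open>R\<close> be the larger of \<open>2 \<bar>Re w\<bar>\<close> and \<open>sqrt (Im w)\<close>, and let \<open>N + 1\<close> be the first index
  whose convergent is \<open>2 R\<close>-close to \<open>\<alpha>\<close>. The contribution of the points at distance at least \<open>R\<close> tends to \<open>0\<close>.
  Within distance \<open>R\<close>, a fixed number of continued fraction matrices contribute their values at \<open>\<alpha>\<close>, the
  others of index \<open>n \<le> N\<close> at most twice these values plus \<open>O(\<beta>\<^bsub>n-1\<^esub>)\<close>, which is the tail of a convergent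
  series, and every other matrix has \<open>d \<ge> q\<^bsub>N+1\<^esub> / 3\<close>. Comparing \<open>ln (1 / s)\<close> with \<open>ln (1 / Im w)\<close> and using that
  \<open>\<Sum> 1 / d\<close> over the intervals through a point is at most \<open>4\<close> divided by the smallest \<open>d\<close>,
  the latter contribute \<open>O(ln (1 / Im w) / q\<^bsub>N+1\<^esub>)\<close>, which the shape of the approach region makes small.\<close>

section \<open>Continued fraction matrices\<close>

text \<open>The exponent 3 in the weight splits as 2 + 1: the substitution
  \<open>t = mob g s\<close> consumes \<open>1 / den ^ 2\<close> and leaves the density
  \<open>ln (1 / s) / den g s\<close>. The obstacle is that each density has a logarithmic pole at
  the rational \<open>mob g 0 = b / d\<close>. These poles are dense, so the sum of the densities is
  unbounded on every interval around \<alpha>. A Poisson kernel of height \<open>y\<close> sees a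
  pole only as about \<open>ln (1 / y)\<close>, weighted by \<open>1 / d\<close>. How large
  \<open>d\<close> must be near \<alpha> depends on how well the convergents approximate \<alpha>.
  The approach region bounds \<open>ln (1 / y)\<close> in terms of \<open>R\<close>; the Brjuno
  series, or the Diophantine condition, bounds the result in terms of \<open>q_(N+1)\<close>. The
  far mass of the kernel of height \<open>y\<close> is compared with the kernel of height
  \<open>R\<close>, which gains the factor \<open>5 y / R\<close>; since
  \<open>R \<ge> sqrt y\<close>, this factor tends to \<open>0\<close>.\<close>

fun mob :: "int \<times> int \<times> int \<times> int \<Rightarrow> real \<Rightarrow> real" where
  "mob (a, b, c, d) s = (of_int a * s + of_int b) / (of_int c * s + of_int d)"

fun den :: "int \<times> int \<times> int \<times> int \<Rightarrow> real \<Rightarrow> real" where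
  "den (a, b, c, d) s = of_int c * s + of_int d"

fun mat_d :: "int \<times> int \<times> int \<times> int \<Rightarrow> int" where
  "mat_d (a, b, c, d) = d"

fun mat_det :: "int \<times> int \<times> int \<times> int \<Rightarrow> int" where
  "mat_det (a, b, c, d) = a * d - b * c"

text \<open>Right multiplication by the matrix \<open>(0, 1, 1, m)\<close>, whose Moebius action
  \<open>s -> 1 / (m + s)\<close> is an inverse branch of the Gauss map.\<close>

fun mat_step :: "int \<times> int \<times> int \<times> int \<Rightarrow> int \<Rightarrow> int \<times> int \<times> int \<times> int" where
  "mat_step (a, b, c, d) m = (b, a + m * b, d, c + m * d)"

text \<open>In terms of the convergents \<open>p\<^sub>n / q\<^sub>n\<close> of \<open>x\<close>, \<open>cf_mat x n\<close> is
  \<open>(p\<^bsub>n-1\<^esub>, p\<^sub>n, q\<^bsub>n-1\<^esub>, q\<^sub>n)\<close> with \<open>p\<^sub>0 / q\<^sub>0 = 0 / 1\<close>.\<close>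
fun cf_mat :: "real \<Rightarrow> nat \<Rightarrow> int \<times> int \<times> int \<times> int" where
  "cf_mat x 0 = (1, 0, 0, 1)"
| "cf_mat x (Suc n) = mat_step (cf_mat x n) \<lfloor>1 / brj_x x n\<rfloor>"

definition cf_q :: "real \<Rightarrow> nat \<Rightarrow> real" where
  "cf_q x n = of_int (mat_d (cf_mat x n))"

definition cf_dist :: "real \<Rightarrow> nat \<Rightarrow> real" where
  "cf_dist x n = \<bar>x - mob (cf_mat x n) 0\<bar>"

section \<open>Generation of the monoid by continued fraction steps\<close>

lemma monoid_cases:
  assumes "g \<in> brjuno_monoid"
  obtains "g = (1, 0, 0, 1)"
  | a b c d where "g = (a, b, c, d)" "\<bar>a * d - b * c\<bar> = 1" "d \<ge> b" "b \<ge> a" "a \<ge> 0" "d \<ge> c" "c \<ge> a"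
      "c \<ge> 1"
proof (cases "g = (1, 0, 0, 1)")
  case False
  with assms obtain a b c d where g: "g = (a, b, c, d)" "\<bar>a * d - b * c\<bar> = 1" "d \<ge> b" "b \<ge> a" "a \<ge> 0" "d \<ge> c" "c \<ge> a"
    unfolding brjuno_monoid_def by blast
  have "c \<noteq> 0" using g by (auto simp: abs_if split: if_splits)
  then have "c \<ge> 1" using g by linarith
  then show ?thesis using that(2) g by blast
qed (use that in blast)

text \<open>The identity violates \<open>b \<ge> a\<close> and \<open>c \<ge> a\<close>; these are
  consequences it shares with the other matrices, which saves later case distinctions. The
  inequality between \<open>c + d\<close> and \<open>a + b\<close> says that
  \<open>mob g 1 \<le> 1\<close>.\<close>

lemma monoid_bounds:
  assumes "(a, b, c, d) \<in> brjuno_monoid"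
  shows "d \<ge> 1" "c \<ge> 0" "d \<ge> c" "a \<ge> 0" "b \<ge> 0" "d \<ge> b" "c + d \<ge> a + b" "\<bar>a * d - b * c\<bar> = 1"
proof -
  have "d \<ge> 1 \<and> c \<ge> 0 \<and> d \<ge> c \<and> a \<ge> 0 \<and> b \<ge> 0 \<and> d \<ge> b \<and> c + d \<ge> a + b \<and> \<bar>a * d - b * c\<bar> = 1"
    using assms by (cases rule: monoid_cases) auto
  then show "d \<ge> 1" "c \<ge> 0" "d \<ge> c" "a \<ge> 0" "b \<ge> 0" "d \<ge> b" "c + d \<ge> a + b" "\<bar>a * d - b * c\<bar> = 1"
    by auto
qed

lemma mat_d_ge1: "g \<in> brjuno_monoid \<Longrightarrow> mat_d g \<ge> 1"
  by (cases g) (use monoid_bounds in auto)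

lemma mat_det_cases:
  assumes "g \<in> brjuno_monoid"
  obtains "mat_det g = 1" | "mat_det g = -1"
proof -
  obtain a b c d where g: "g = (a, b, c, d)" by (cases g)
  have "\<bar>a * d - b * c\<bar> = 1" using monoid_bounds(8) assms g by blast
  then have "mat_det g = 1 \<or> mat_det g = -1" unfolding g mat_det.simps by linarith
  then show ?thesis using that by blast
qed

lemma den_bounds:
  assumes "g \<in> brjuno_monoid" "0 \<le> s" "s \<le> 1"
  shows "den g s \<ge> of_int (mat_d g)" "den g s \<le> 2 * of_int (mat_d g)" "den g s \<ge> 1"
proof -
  obtain a b c d where g: "g = (a, b, c, d)" by (cases g)
  note bd = monoid_bounds[OF assms(1)[unfolded g]]
  have "0 \<le> of_int c * s" "of_int c * s \<le> of_int c * (1::real)"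
    using bd assms by (simp, intro mult_left_mono) auto
  moreover have "real_of_int c \<le> of_int d" "real_of_int d \<ge> 1" using bd by auto
  ultimately show "den g s \<ge> of_int (mat_d g)" "den g s \<le> 2 * of_int (mat_d g)" "den g s \<ge> 1"
    using g by simp_all
qed

lemma den_0 [simp]: "den g 0 = of_int (mat_d g)"
  by (cases g) simp

lemma mob_diff:
  assumes "den g s \<noteq> 0" "den g t \<noteq> 0"
  shows "mob g s - mob g t = of_int (mat_det g) * (s - t) / (den g s * den g t)"
proof -
  obtain a b c d where g: "g = (a, b, c, d)" by (cases g)
  show ?thesis using assms unfolding g mob.simps den.simps mat_det.simps
    by (simp add: diff_frac_eq) (simp add: algebra_simps)
qed

lemma mob_range:
  assumes "g \<in> brjuno_monoid" "0 \<le> s" "s \<le> 1"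
  shows "0 \<le> mob g s" "mob g s \<le> 1"
proof -
  obtain a b c d where g: "g = (a, b, c, d)" by (cases g)
  note bd = monoid_bounds[OF assms(1)[unfolded g]]
  have pos: "of_int c * s + of_int d > 0"
    using den_bounds(3)[OF assms] g by simp
  show "0 \<le> mob g s"
    using bd assms pos by (simp add: g)
  have "(of_int a + of_int b) * s \<le> (of_int c + of_int d) * s"
    using bd(7) assms by (intro mult_right_mono) (simp_all flip: of_int_add)
  moreover have "of_int b * (1 - s) \<le> of_int d * (1 - s)"
    using bd(6) assms by (intro mult_right_mono) (simp_all flip: of_int_add)
  ultimately have "of_int a * s + of_int b \<le> of_int c * s + of_int d"
    by (simp add: algebra_simps)
  then show "mob g s \<le> 1" using pos by (simp add: g)
qed

lemma mat_step_monoid: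
  assumes "g \<in> brjuno_monoid" "m \<ge> 1"
  shows "mat_step g m \<in> brjuno_monoid"
  using assms(1)
proof (cases rule: monoid_cases)
  case 1
  then show ?thesis using assms(2) by (auto simp: brjuno_monoid_def)
next
  case (2 a b c d)
  have "1 * b \<le> m * b" "1 * d \<le> m * d"
    using 2 assms(2) by (auto intro!: mult_right_mono simp del: mult_1)
  moreover have "m * b \<le> m * d" using 2 assms(2) by (intro mult_left_mono) auto
  moreover have "b * (c + m * d) - (a + m * b) * d = - (a * d - b * c)" by (simp add: algebra_simps)
  then have "\<bar>b * (c + m * d) - (a + m * b) * d\<bar> = 1" using 2 by (simp only: abs_minus_cancel)
  moreover from calculation have "a + m * b \<le> c + m * d" "d \<le> c + m * d" using 2 by linarith+
  ultimately show ?thesis using 2 by (simp add: brjuno_monoid_def)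
qed

text \<open>Euclidean division of \<open>d\<close> by \<open>c\<close> recovers the last partial
  quotient. Its outcome satisfies \<open>a r - k c = 1\<close> or \<open>a r - k c = -1\<close>, and
  this equation forces the inequalities that define the monoid.\<close>

lemma mat_step_surj:
  assumes "g \<in> brjuno_monoid" "g \<noteq> (1, 0, 0, 1)"
  obtains g' m where "g' \<in> brjuno_monoid" "m \<ge> 1" "g = mat_step g' m"
  using assms(1)
proof (cases rule: monoid_cases)
  case (2 a b c d)
  have det: "a * d - b * c = 1 \<or> a * d - b * c = - 1" using 2(2) by linarith
  \<comment> \<open>The quotient \<open>d div c\<close> fails when \<open>a = c = 1\<close>: there
    the division is exact, and the right quotient is \<open>d - 1 = b\<close>, leaving the matrix
    \<open>(0, 1, 1, 1)\<close>.\<close>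
  consider "a = 0" | "a = 1" "c = 1" | "a \<ge> 1" "c \<ge> 2" using 2 by linarith
  then show ?thesis
  proof cases
    case 1
    then have "b * c = 1" using 2 det by auto
    then have "b = 1" "c = 1" using 2 by (auto simp: zmult_eq_1_iff)
    then show ?thesis using 1 2 that[of "(1,0,0,1)" d] by (auto simp: brjuno_monoid_def)
  next
    case 2
    then have "d - b = 1 \<or> d - b = -1" using det by simp
    then have "d = b + 1" using \<open>d \<ge> b\<close> by linarith
    then show ?thesis using 2 \<open>g = _\<close> \<open>b \<ge> a\<close> that[of "(0,1,1,1)" b] by (auto simp: brjuno_monoid_def)
  next
    case 3
    define m where "m = d div c"
    define r where "r = d mod c"
    define k where "k = b - m * a"
    have d: "d = m * c + r" by (simp add: m_def r_def)
    have r: "0 \<le> r" "r < c" using 3 by (auto simp: r_def)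
    have m: "m \<ge> 1" using 2 3 by (auto simp: m_def int_one_le_iff_zero_less pos_imp_zdiv_pos_iff)
    have e: "a * r - k * c = a * d - b * c" by (simp add: k_def d algebra_simps)
    have ca: "c \<noteq> a"
    proof
      assume "c = a"
      then have "c * (d - b) = 1 \<or> c * (d - b) = -1" using det by (simp add: algebra_simps)
      then have "c dvd 1" by (metis dvd_minus_iff dvd_triv_left)
      with 3 show False by auto
    qed
    have "r \<noteq> 0"
    proof
      assume "r = 0"
      then have "c dvd a * d - b * c" by (simp add: d)
      then have "c dvd 1" using det by (metis dvd_minus_iff)
      with 3 show False by auto
    qed
    then have r1: "r \<ge> 1" using r by linarith
    have ar: "a * r \<ge> a" "r * a \<le> (c - 1) * a" using r r1 3 by (auto intro!: mult_right_mono)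
    have "k * c \<ge> 0" using e det ar 3 by linarith
    then have k0: "k \<ge> 0" using 3 by (auto simp: zero_le_mult_iff)
    have "k * c + a \<le> a * c + 1" using e det ar 
      by (simp add: left_diff_distrib mult.commute[of r] mult.commute[of c]) linarith
    then have "k * c \<le> a * c" using 3 by linarith
    then have ka: "k \<le> a" using 3 by auto
    have "(c - a) * r \<ge> 1 * 1" using ca 2 r1 by (intro mult_mono) auto
    then have "1 + a * r \<le> c * r" by (simp add: left_diff_distrib)
    then have "k * c \<le> r * c" using e det unfolding mult.commute[of r c] by linarith
    then have kr: "k \<le> r" using 3 by auto
    have "\<bar>k * c - a * r\<bar> = 1" using e 2 by (simp add: abs_minus_commute)
    then have "(k, a, r, c) \<in> brjuno_monoid" using k0 ka kr r 2 by (auto simp: brjuno_monoid_def)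
    moreover have "g = mat_step (k, a, r, c) m" using 2 by (simp add: k_def d algebra_simps)
    ultimately show ?thesis using m that by blast
  qed
qed (use assms in simp)

lemma brj_x_irrational:
  assumes "x \<notin> \<rat>"
  shows "brj_x x n \<notin> \<rat>" "0 < brj_x x n" "brj_x x n < 1"
proof -
  have *: "frac y \<notin> \<rat>" if "y \<notin> \<rat>" for y :: real
  proof
    assume "frac y \<in> \<rat>"
    then have "frac y + of_int \<lfloor>y\<rfloor> \<in> \<rat>" by (intro Rats_add) auto
    then show False using that by (simp add: frac_def)
  qed
  show 1: "brj_x x n \<notin> \<rat>"
  proof (induction n)
    case (Suc n)
    have "1 / brj_x x n \<notin> \<rat>"
    proof
      assume "1 / brj_x x n \<in> \<rat>"
      then have "inverse (1 / brj_x x n) \<in> \<rat>" by (rule Rats_inverse)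
      then show False using Suc by simp
    qed
    then show ?case using * by simp
  qed (use * assms in simp)
  have ex: "\<exists>y. brj_x x n = frac y" by (cases n) auto
  then have "brj_x x n \<ge> 0" "brj_x x n < 1" by (auto simp: frac_lt_1)
  moreover have "brj_x x n \<noteq> 0" using 1 by auto
  ultimately show "0 < brj_x x n" "brj_x x n < 1" by auto
qed

lemma mob_step:
  assumes "of_int m + s \<noteq> 0"
  shows "mob (mat_step g m) s = mob g (1 / (of_int m + s))"
    and "den (mat_step g m) s = den g (1 / (of_int m + s)) * (of_int m + s)"
proof -
  obtain a b c d where g: "g = (a, b, c, d)" by (cases g)
  show D: "den (mat_step g m) s = den g (1 / (of_int m + s)) * (of_int m + s)"
    using assms by (simp add: g field_simps)
  have N: "of_int b * s + of_int (a + m * b) = (of_int a * (1 / (of_int m + s)) + of_int b) * (of_int m + s)"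
    using assms by (simp add: g field_simps)
  have "mob (mat_step g m) s = (of_int b * s + of_int (a + m * b)) / den (mat_step g m) s"
    by (simp add: g)
  then show "mob (mat_step g m) s = mob g (1 / (of_int m + s))"
    unfolding D N using assms by (simp add: g)
qed

section \<open>Convergents and denominators of an irrational number\<close>

locale irrational_unit =
  fixes x :: real
  assumes irr: "x \<notin> \<rat>" and x01: "0 < x" "x < 1"
begin

lemma xn: "brj_x x n \<notin> \<rat>" "0 < brj_x x n" "brj_x x n < 1"
  using brj_x_irrational[OF irr] by auto

lemma x_0 [simp]: "brj_x x 0 = x"
  using x01 by (simp add: frac_eq)

lemma x_Suc: "1 / (of_int \<lfloor>1 / brj_x x n\<rfloor> + brj_x x (Suc n)) = brj_x x n"
  by (simp add: frac_def)

lemma floor_ge1: "\<lfloor>1 / brj_x x n\<rfloor> \<ge> 1"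
  using xn[of n] by (simp add: le_floor_iff)

lemma cf_monoid: "cf_mat x n \<in> brjuno_monoid"
proof (induction n)
  case (Suc n)
  then show ?case using mat_step_monoid floor_ge1 by simp
qed (simp add: brjuno_monoid_def)

text \<open>Denominators multiply along compositions, and the step from \<open>n\<close> to
  \<open>n + 1\<close> contributes the factor \<open>1 / x_n\<close>. This turns the density at
  \<open>x\<close> into the summand of the Brjuno series.\<close>

lemma cf_mob_den:
  "mob (cf_mat x n) (brj_x x n) = x \<and> den (cf_mat x n) (brj_x x n) = 1 / brj_beta_prev x n"
proof (induction n)
  case 0
  then show ?case unfolding x_0 by (simp add: brj_beta_prev_def)
next
  case (Suc n)
  let ?m = "\<lfloor>1 / brj_x x n\<rfloor>"
  have ne: "of_int ?m + brj_x x (Suc n) \<noteq> 0" using floor_ge1[of n] xn[of "Suc n"]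
    by (smt (verit) of_int_1_le_iff)
  have mx: "of_int ?m + brj_x x (Suc n) = 1 / brj_x x n" by (simp add: frac_def)
  have "mob (cf_mat x (Suc n)) (brj_x x (Suc n)) = mob (cf_mat x n) (brj_x x n)"
    unfolding cf_mat.simps mob_step(1)[OF ne] x_Suc ..
  moreover have "den (cf_mat x (Suc n)) (brj_x x (Suc n)) = den (cf_mat x n) (brj_x x n) * (1 / brj_x x n)"
    unfolding cf_mat.simps mob_step(2)[OF ne] x_Suc unfolding mx ..
  ultimately show ?case using Suc by (simp add: brj_beta_prev_def)
qed

lemmas cf_mob = cf_mob_den[THEN conjunct1] and cf_den = cf_mob_den[THEN conjunct2]

text \<open>Descent on \<open>c + d\<close>: stripping the last step replaces \<open>s\<close> by
  \<open>t = 1 / (m + s)\<close>, a preimage of the same \<open>x\<close>. As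
  \<open>0 < s < 1\<close>, the integer \<open>m\<close> is the floor of \<open>1 / t\<close> and
  \<open>s\<close> its fractional part, so the expansion is the continued fraction of
  \<open>x\<close>.\<close>

lemma cf_surj:
  assumes "g \<in> brjuno_monoid" "0 < s" "s < 1" "mob g s = x"
  shows "\<exists>n. g = cf_mat x n \<and> s = brj_x x n"
  using assms
proof (induction "nat (fst (snd (snd g)) + mat_d g)" arbitrary: g s rule: less_induct)
  case less
  show ?case
  proof (cases "g = (1, 0, 0, 1)")
    case True
    then show ?thesis using less x_0 by (intro exI[of _ 0]) simp
  next
    case False
    then obtain g' m where g': "g' \<in> brjuno_monoid" "m \<ge> 1" "g = mat_step g' m"
      using mat_step_surj less by metis
    obtain a b c d where gd: "g' = (a, b, c, d)" by (cases g')
    have "d \<ge> 1" "c \<ge> 0" using monoid_bounds g' gd by auto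
    moreover from this have "m * d \<ge> 1 * d" using g'(2) by (intro mult_right_mono) auto
    ultimately have "c + d < d + (c + m * d)" "0 < d + (c + m * d)" by linarith+
    then have lt: "nat (fst (snd (snd g')) + mat_d g') < nat (fst (snd (snd g)) + mat_d g)"
      using g' gd by simp
    have m: "real_of_int m \<ge> 1" using g' by simp
    define t where "t = 1 / (of_int m + s)"
    have t: "0 < t" "t < 1" using m less by (auto simp: t_def)
    have "mob g' t = x" using mob_step(1)[of m s g'] g' less m by (simp add: t_def)
    from less(1)[OF lt g'(1) t this] obtain n where n: "g' = cf_mat x n" "t = brj_x x n" by blast
    have inv: "1 / brj_x x n = of_int m + s" using n m less by (simp add: t_def flip: n(2))
    have "\<lfloor>1 / brj_x x n\<rfloor> = m" unfolding inv using less by (simp add: floor_eq_iff)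
    moreover have "brj_x x (Suc n) = s" unfolding brj_x.simps inv using less by (simp add: frac_eq)
    ultimately show ?thesis using n g' by (intro exI[of _ "Suc n"]) simp
  qed
qed

lemma q_ge1: "cf_q x n \<ge> 1"
  using mat_d_ge1[OF cf_monoid] by (simp add: cf_q_def)

lemma cf_c_Suc: "fst (snd (snd (cf_mat x (Suc n)))) = mat_d (cf_mat x n)"
  by (cases "cf_mat x n") simp

lemma q_Suc_Suc: "cf_q x (Suc (Suc n)) \<ge> cf_q x (Suc n) + cf_q x n"
proof -
  obtain a b c d where g: "cf_mat x (Suc n) = (a, b, c, d)" by (cases "cf_mat x (Suc n)")
  have c: "c = mat_d (cf_mat x n)" using cf_c_Suc[of n] g by simp
  have "d \<ge> 1" using monoid_bounds cf_monoid[of "Suc n"] g by auto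
  then have "\<lfloor>1 / brj_x x (Suc n)\<rfloor> * d \<ge> 1 * d"
    using floor_ge1[of "Suc n"] by (intro mult_right_mono) auto
  moreover have "mat_d (cf_mat x (Suc (Suc n))) = c + \<lfloor>1 / brj_x x (Suc n)\<rfloor> * d"
    using g by (subst cf_mat.simps) (simp del: cf_mat.simps brj_x.simps)
  ultimately have "mat_d (cf_mat x (Suc (Suc n))) \<ge> mat_d (cf_mat x (Suc n)) + mat_d (cf_mat x n)"
    using c g by simp
  then show ?thesis unfolding cf_q_def by linarith
qed

lemma q_Suc: "cf_q x n \<le> cf_q x (Suc n)"
proof -
  have "mat_d (cf_mat x n) \<le> mat_d (cf_mat x (Suc n))"
    using cf_c_Suc[of n] cf_monoid[of "Suc n"] monoid_bounds(3)
    by (cases "cf_mat x (Suc n)") auto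
  then show ?thesis by (simp add: cf_q_def)
qed

lemma q_mono: "m \<le> n \<Longrightarrow> cf_q x m \<le> cf_q x n"
  by (rule lift_Suc_mono_le[of "cf_q x"]) (use q_Suc in auto)

lemma q_double: "cf_q x (Suc (Suc n)) \<ge> 2 * cf_q x n"
  using q_Suc_Suc[of n] q_Suc[of n] by linarith

text \<open>The factor \<open>2\<close> covers \<open>n = 1\<close>, where the denominator may still
  be \<open>1\<close>, less than \<open>sqrt 2\<close>.\<close>

lemma q_growth: "2 * cf_q x n \<ge> sqrt 2 ^ n"
proof (induction n rule: induct_nat_012)
  case 0
  then show ?case using q_ge1[of 0] by simp
next
  case 1
  have "sqrt 2 \<le> 2" by (rule real_le_lsqrt) auto
  then show ?case using q_ge1[of "Suc 0"] by simp
next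
  case (ge2 n)
  have "sqrt 2 ^ Suc (Suc n) = 2 * sqrt 2 ^ n" by simp
  then show ?case using ge2 q_double[of n] by linarith
qed

text \<open>Denominators may repeat at the start (\<open>q_0 = q_1 = 1\<close> when
  \<open>x > 1 / 2\<close>), but \<open>c + d\<close> increases strictly.\<close>

lemma cf_inj: "inj (cf_mat x)"
proof -
  define f where "f n = fst (snd (snd (cf_mat x n))) + mat_d (cf_mat x n)" for n
  have "f n < f (Suc n)" for n
  proof -
    obtain a b c d where g: "cf_mat x n = (a, b, c, d)" by (cases "cf_mat x n")
    have "d \<ge> 1" using monoid_bounds cf_monoid[of n] g by auto
    moreover from this have "\<lfloor>1 / brj_x x n\<rfloor> * d \<ge> 1 * d"
      using floor_ge1[of n] by (intro mult_right_mono) auto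
    ultimately show ?thesis by (simp add: f_def g)
  qed
  then have "strict_mono f" by (simp add: strict_mono_Suc_iff)
  then show ?thesis by (intro injI) (metis f_def strict_mono_eq)
qed

lemma sum_inverse_q: "(\<Sum>k=n..<n+m. 1 / cf_q x k) \<le> 4 / cf_q x n"
proof -
  \<comment> \<open>A telescoping majorant: \<open>S k - S (k + 1) = 2 / q_k - 2 / q_(k+2)\<close>,
    which is at least \<open>1 / q_k\<close> because denominators double every two steps.\<close>
  define S where "S k = 2 / cf_q x k + 2 / cf_q x (Suc k)" for k
  have "1 / cf_q x k \<le> S k - S (Suc k)" for k
  proof -
    have "2 / cf_q x (Suc (Suc k)) \<le> 2 / (2 * cf_q x k)"
      using q_double[of k] q_ge1[of k] by (intro divide_left_mono) auto
    then show ?thesis by (simp add: S_def)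
  qed
  then have "(\<Sum>k=n..<n+m. 1 / cf_q x k) \<le> (\<Sum>k=n..<n+m. S k - S (Suc k))" by (intro sum_mono)
  also have "\<dots> = S n - S (n + m)" by (induction m) simp_all
  finally have "(\<Sum>k=n..<n+m. 1 / cf_q x k) \<le> S n - S (n + m)" .
  moreover have "S (n + m) \<ge> 0" using q_ge1[of "n+m"] q_ge1[of "Suc (n+m)"] by (simp add: S_def)
  moreover have "2 / cf_q x (Suc n) \<le> 2 / cf_q x n"
    using q_Suc[of n] q_ge1[of n] by (intro divide_left_mono) auto
  then have "S n \<le> 4 / cf_q x n" by (simp add: S_def)
  ultimately show ?thesis by linarith
qed

text \<open>Matrices whose open image interval contains an irrational \<open>x\<close> are continued
  fraction matrices of \<open>x\<close>, so the sum is bounded by a tail starting at the smallest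
  index that occurs. This controls the weighted overlap of the image intervals although infinitely
  many of them contain \<open>x\<close>.\<close>

lemma sum_inverse_d:
  assumes "finite G" "G \<subseteq> {g \<in> brjuno_monoid. x \<in> mob g ` {0<..<1}}" "D > 0" "\<And>g. g \<in> G \<Longrightarrow> real_of_int (mat_d g) \<ge> D"
  shows "(\<Sum>g\<in>G. 1 / real_of_int (mat_d g)) \<le> 4 / D"
proof (cases "G = {}")
  case False
  define K where "K = cf_mat x -` G"
  have fK: "finite K" using finite_vimageI[OF assms(1) cf_inj] by (simp add: K_def)
  have G: "G \<subseteq> cf_mat x ` K" unfolding K_def
  proof
    fix g assume g: "g \<in> G"
    then have "x \<in> mob g ` {0<..<1}" "g \<in> brjuno_monoid" using assms(2) by blast+
    then obtain s where "0 < s" "s < 1" "mob g s = x" by auto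
    then obtain n where "g = cf_mat x n" using cf_surj \<open>g \<in> brjuno_monoid\<close> by blast
    then show "g \<in> cf_mat x ` (cf_mat x -` G)" using g by auto
  qed
  then have "K \<noteq> {}" using False by auto
  define n where "n = Min K"
  have n: "n \<in> K" using fK \<open>K \<noteq> {}\<close> by (simp add: n_def)
  have sub: "K \<subseteq> {n..<n + Suc (Max K)}"
    using fK by (auto simp: n_def less_Suc_eq_le le_add2 trans_le_add2)
  have "(\<Sum>g\<in>G. 1 / real_of_int (mat_d g)) \<le> (\<Sum>g\<in>cf_mat x ` K. 1 / real_of_int (mat_d g))"
    using fK G q_ge1 by (intro sum_mono2) (auto simp: cf_q_def intro: order.trans[OF zero_le_one])
  also have "\<dots> = (\<Sum>k\<in>K. 1 / cf_q x k)"
    unfolding cf_q_def by (subst sum.reindex) (use cf_inj in \<open>auto intro: inj_on_subset\<close>)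
  also have "\<dots> \<le> (\<Sum>k=n..<n + Suc (Max K). 1 / cf_q x k)"
    using sub q_ge1 by (intro sum_mono2) (auto intro: order.trans[OF zero_le_one])
  also have "\<dots> \<le> 4 / cf_q x n" by (rule sum_inverse_q)
  also have "\<dots> \<le> 4 / D"
    using assms(3) assms(4)[of "cf_mat x n"] n by (intro divide_left_mono) (auto simp: K_def cf_q_def)
  finally show ?thesis .
qed (use assms in simp)

lemma beta_pos: "brj_beta_prev x n > 0"
  unfolding brj_beta_prev_def using xn by (intro prod_pos) auto

lemma beta_bounds: "brj_beta_prev x n \<le> 1 / cf_q x n" "1 / cf_q x n \<le> 2 * brj_beta_prev x n"
proof -
  have "cf_q x n \<le> 1 / brj_beta_prev x n" "1 / brj_beta_prev x n \<le> 2 * cf_q x n"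
    using den_bounds[OF cf_monoid, of "brj_x x n" n] xn[of n] cf_den[of n] by (auto simp: cf_q_def)
  then show "brj_beta_prev x n \<le> 1 / cf_q x n" "1 / cf_q x n \<le> 2 * brj_beta_prev x n"
    using beta_pos[of n] q_ge1[of n] by (auto simp: field_simps)
qed

lemma cf_dist_eq: "cf_dist x n = brj_beta_prev x (Suc n) / cf_q x n"
proof -
  have d: "den (cf_mat x n) (brj_x x n) \<noteq> 0" using cf_den[of n] beta_pos[of n] by simp
  have d0: "den (cf_mat x n) 0 \<noteq> 0" using q_ge1[of n] by (simp add: cf_q_def)
  have det: "\<bar>real_of_int (mat_det (cf_mat x n))\<bar> = 1"
    using mat_det_cases[OF cf_monoid[of n]] by (metis abs_1 abs_minus of_int_1 of_int_minus)
  have "cf_dist x n = \<bar>mob (cf_mat x n) (brj_x x n) - mob (cf_mat x n) 0\<bar>"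
    by (simp add: cf_dist_def cf_mob)
  also have "\<dots> = brj_x x n / (den (cf_mat x n) (brj_x x n) * cf_q x n)"
    unfolding mob_diff[OF d d0] abs_divide abs_mult det using xn[of n] beta_pos[of n] q_ge1[of n]
    by (simp add: cf_den cf_q_def)
  finally show ?thesis unfolding cf_den by (simp add: brj_beta_prev_def)
qed

lemma cf_dist_pos: "cf_dist x n > 0"
  unfolding cf_dist_eq using beta_pos[of "Suc n"] q_ge1[of n] by simp

lemma cf_dist_le: "cf_dist x n \<le> 1 / (cf_q x n * cf_q x (Suc n))"
  using beta_bounds(1)[of "Suc n"] q_ge1[of n] by (simp add: cf_dist_eq divide_right_mono field_simps)

lemma cf_dist_tendsto_0: "cf_dist x \<longlonglongrightarrow> 0"
proof (rule tendsto_sandwich[OF _ _ tendsto_const])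
  show "\<forall>\<^sub>F n in sequentially. 0 \<le> cf_dist x n" using cf_dist_pos by (simp add: less_imp_le)
  show "\<forall>\<^sub>F n in sequentially. cf_dist x n \<le> 2 * (1 / sqrt 2) ^ n"
  proof (rule always_eventually, rule allI)
    fix n
    have "cf_dist x n \<le> 1 / (cf_q x n * cf_q x (Suc n))" by (rule cf_dist_le)
    also have "\<dots> \<le> 1 / cf_q x n" using q_ge1[of n] q_ge1[of "Suc n"] by (simp add: field_simps)
    also have "\<dots> \<le> 1 / (sqrt 2 ^ n / 2)" using q_growth[of n] q_ge1[of n] by (intro divide_left_mono) auto
    finally show "cf_dist x n \<le> 2 * (1 / sqrt 2) ^ n" by (simp add: power_divide)
  qed
  show "(\<lambda>n. 2 * (1 / sqrt 2) ^ n) \<longlonglongrightarrow> (0::real)"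
    by (intro tendsto_mult_right_zero LIMSEQ_power_zero) simp
qed

end

section \<open>Integration over the unit interval and its images\<close>

definition U01 :: "real measure" where
  "U01 = restrict_space lborel {0<..<1}"

lemma space_U01 [simp]: "space U01 = {0<..<1}"
  by (simp add: U01_def space_restrict_space)

lemma measurable_U01: "f \<in> borel_measurable borel \<Longrightarrow> f \<in> borel_measurable U01"
  unfolding U01_def by (intro measurable_restrict_space1) simp

lemma integrable_U01_iff:
  fixes f :: "real \<Rightarrow> 'b::{banach, second_countable_topology}"
  shows "integrable U01 f \<longleftrightarrow> set_integrable lborel {0<..<1} f"
  unfolding U01_def set_integrable_def by (intro integrable_restrict_space) simp

lemma integral_U01_eq:
  fixes f :: "real \<Rightarrow> 'b::{banach, second_countable_topology}"
  shows "integral\<^sup>L U01 f = (LINT s:{0<..<1}|lborel. f s)"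
  unfolding U01_def set_lebesgue_integral_def by (intro integral_restrict_space) simp

lemma AE_U01_irrational: "AE t in U01. t \<notin> \<rat>"
proof -
  have "AE t::real in lborel. t \<notin> \<rat>"
    by (intro AE_not_in countable_imp_null_set_lborel countable_rat)
  then show ?thesis unfolding U01_def by (subst AE_restrict_space_iff) auto
qed

text \<open>Boundary values enter as one-sided limits, since an integrand may blow up at an
  endpoint; nonnegativity then yields integrability as well.\<close>

lemma set_integral_FTC_nonneg:
  fixes f F :: "real \<Rightarrow> real"
  assumes "l < r" "\<And>s. l < s \<Longrightarrow> s < r \<Longrightarrow> (F has_real_derivative f s) (at s)"
    "\<And>s. l < s \<Longrightarrow> s < r \<Longrightarrow> isCont f s" "\<And>s. l < s \<Longrightarrow> s < r \<Longrightarrow> 0 \<le> f s"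
    "(F \<longlongrightarrow> A) (at_right l)" "(F \<longlongrightarrow> B) (at_left r)"
  shows "set_integrable lborel {l<..<r} f" "(LINT s:{l<..<r}|lborel. f s) = B - A"
proof -
  have *: "ereal l < ereal r" using assms by simp
  have A: "((F \<circ> real_of_ereal) \<longlongrightarrow> A) (at_right (ereal l))"
    using assms(5) by (simp add: ereal_tendsto_simps)
  have B: "((F \<circ> real_of_ereal) \<longlongrightarrow> B) (at_left (ereal r))"
    using assms(6) by (simp add: ereal_tendsto_simps)
  have "AE x in lborel. ereal l < ereal x \<longrightarrow> ereal x < ereal r \<longrightarrow> 0 \<le> f x"
    using assms(4) by auto
  note FTC = interval_integral_FTC_nonneg[OF * _ _ this A B]
  show "set_integrable lborel {l<..<r} f"
    using FTC(1) assms(2,3) by simp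
  show "(LINT s:{l<..<r}|lborel. f s) = B - A"
    using FTC(2) assms(1-3) by (simp add: interval_lebesgue_integral_def)
qed

lemma U01_FTC_nonneg:
  fixes f F :: "real \<Rightarrow> real"
  assumes "\<And>s. 0 < s \<Longrightarrow> s < 1 \<Longrightarrow> (F has_real_derivative f s) (at s)"
    "\<And>s. 0 < s \<Longrightarrow> s < 1 \<Longrightarrow> isCont f s" "\<And>s. 0 < s \<Longrightarrow> s < 1 \<Longrightarrow> 0 \<le> f s"
    "(F \<longlongrightarrow> A) (at_right 0)" "(F \<longlongrightarrow> B) (at_left 1)"
  shows "integrable U01 f" "integral\<^sup>L U01 f = B - A"
  unfolding integrable_U01_iff integral_U01_eq
  using set_integral_FTC_nonneg[of 0 1 F f A B] assms by auto

lemma integral_ln: "integrable U01 (\<lambda>s. ln (1 / s))" "integral\<^sup>L U01 (\<lambda>s. ln (1 / s)) = 1"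
proof -
  have D: "((\<lambda>s. s - s * ln s) has_real_derivative ln (1 / s)) (at s)" if "0 < s" for s :: real
    using that by (auto intro!: derivative_eq_intros simp: ln_div)
  have C: "isCont (\<lambda>s. ln (1 / s)) s" if "0 < s" for s :: real
    using that by (intro continuous_intros) auto
  have A: "((\<lambda>s. s - s * ln s) \<longlongrightarrow> 0) (at_right (0::real))" by real_asymp
  have B: "((\<lambda>s. s - s * ln s) \<longlongrightarrow> 1) (at_left (1::real))"
    by (rule tendsto_eq_intros | simp)+
  show "integrable U01 (\<lambda>s. ln (1 / s))" "integral\<^sup>L U01 (\<lambda>s. ln (1 / s)) = 1"
    using U01_FTC_nonneg[OF D C _ A B] by auto
qed

lemma integral_inverse_sqrt: "integrable U01 (\<lambda>s. 1 / sqrt s)" "integral\<^sup>L U01 (\<lambda>s. 1 / sqrt s) = 2"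
proof -
  have D: "((\<lambda>s. 2 * sqrt s) has_real_derivative 1 / sqrt s) (at s)" if "0 < s" for s :: real
    using that by (auto intro!: derivative_eq_intros simp: field_simps)
  have C: "isCont (\<lambda>s. 1 / sqrt s) s" if "0 < s" for s :: real
    using that by (intro continuous_intros) auto
  have A: "((\<lambda>s. 2 * sqrt s) \<longlongrightarrow> 0) (at_right (0::real))"
    by (rule tendsto_eq_intros | simp)+
  have B: "((\<lambda>s. 2 * sqrt s) \<longlongrightarrow> 2) (at_left (1::real))"
    by (rule tendsto_eq_intros | simp)+
  show "integrable U01 (\<lambda>s. 1 / sqrt s)" "integral\<^sup>L U01 (\<lambda>s. 1 / sqrt s) = 2"
    using U01_FTC_nonneg[OF D C _ A B] by auto
qed

text \<open>The weight \<open>ln (1 / s)\<close> is a probability density on the unit interval, so a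
  uniform bound for the kernel passes to the integral without loss.\<close>

lemma integral_ln_bounded:
  fixes k :: "real \<Rightarrow> 'b::{banach, second_countable_topology}"
  assumes "k \<in> borel_measurable borel" "\<And>s. 0 < s \<Longrightarrow> s < 1 \<Longrightarrow> norm (k s) \<le> C"
  shows "integrable U01 (\<lambda>s. ln (1 / s) *\<^sub>R k s)" "norm (integral\<^sup>L U01 (\<lambda>s. ln (1 / s) *\<^sub>R k s)) \<le> C"
proof -
  note [measurable] = assms(1)
  have b: "norm (ln (1 / s) *\<^sub>R k s) \<le> C * ln (1 / s)" if "0 < s" "s < 1" for s
    using assms(2)[of s] that by (simp add: mult.commute mult_left_mono)
  have I: "integrable U01 (\<lambda>s. C * ln (1 / s))" using integral_ln(1) by simp
  show i: "integrable U01 (\<lambda>s. ln (1 / s) *\<^sub>R k s)"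
  proof (rule Bochner_Integration.integrable_bound[OF I])
    show "AE s in U01. norm (ln (1 / s) *\<^sub>R k s) \<le> norm (C * ln (1 / s))"
      by (rule AE_I2, rule order.trans[OF b]) auto
  qed (rule measurable_U01, measurable)
  have "norm (integral\<^sup>L U01 (\<lambda>s. ln (1 / s) *\<^sub>R k s)) \<le> integral\<^sup>L U01 (\<lambda>s. C * ln (1 / s))"
    by (rule Bochner_Integration.integral_norm_bound_integral[OF i I]) (rule b; simp)
  then show "norm (integral\<^sup>L U01 (\<lambda>s. ln (1 / s) *\<^sub>R k s)) \<le> C" using integral_ln(2) by simp
qed

section \<open>Moebius substitution and overlap of the image intervals\<close>

lemma mob_measurable [measurable]: "mob g \<in> borel_measurable borel" "den g \<in> borel_measurable borel"
proof -
  obtain a b c d where g: "g = (a, b, c, d)" by (cases g)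
  have m: "mob g = (\<lambda>s. (of_int a * s + of_int b) / (of_int c * s + of_int d))"
    "den g = (\<lambda>s. of_int c * s + of_int d)" by (auto simp: g)
  show "mob g \<in> borel_measurable borel" "den g \<in> borel_measurable borel" unfolding m by measurable
qed

lemma mob_deriv:
  assumes "g \<in> brjuno_monoid" "0 \<le> s" "s \<le> 1"
  shows "(mob g has_real_derivative of_int (mat_det g) / den g s ^ 2) (at s)"
proof -
  obtain a b c d where g: "g = (a, b, c, d)" by (cases g)
  have m: "mob g = (\<lambda>s. (of_int a * s + of_int b) / (of_int c * s + of_int d))" by (auto simp: g)
  have "of_int c * s + of_int d \<noteq> 0" using den_bounds(3)[OF assms] g by simp
  then show ?thesis unfolding m
    by (auto intro!: derivative_eq_intros simp: g power2_eq_square) (simp add: algebra_simps)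
qed

lemma den_cont: "isCont (den g) s"
proof -
  obtain a b c d where g: "g = (a, b, c, d)" by (cases g)
  have "den g = (\<lambda>s. of_int c * s + of_int d)" by (auto simp: g)
  then show ?thesis by simp
qed

lemma mob_less:
  assumes g: "g \<in> brjuno_monoid" and st: "0 \<le> t" "t < s" "s \<le> 1"
  shows "mat_det g = 1 \<and> mob g t < mob g s \<or> mat_det g = -1 \<and> mob g s < mob g t"
proof -
  have den: "den g s > 0" "den g t > 0" using den_bounds(3)[OF g, of s] den_bounds(3)[OF g, of t] st by auto
  define q where "q = (s - t) / (den g s * den g t)"
  have "q > 0" using den st by (simp add: q_def)
  moreover have "mob g s - mob g t = of_int (mat_det g) * q"
    using den by (subst mob_diff) (auto simp: q_def)
  ultimately show ?thesis by (cases rule: mat_det_cases[OF g]) simp_all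
qed

lemma mob_image:
  assumes g: "g \<in> brjuno_monoid"
  shows "mob g ` {0<..<1} = {min (mob g 0) (mob g 1)<..<max (mob g 0) (mob g 1)}" (is "_ = ?I")
proof (intro set_eqI iffI)
  have cont: "continuous_on {0..1} (mob g)"
    using mob_deriv[OF g] by (intro DERIV_continuous_on[where D = "\<lambda>s. of_int (mat_det g) / den g s ^ 2"])
      (auto intro: has_field_derivative_at_within)
  fix t
  {
    assume "t \<in> mob g ` {0<..<1}"
    then obtain s where s: "0 < s" "s < 1" "t = mob g s" by auto
    show "t \<in> ?I"
      using mob_less[OF g, of 0 s] mob_less[OF g, of s 1] s by (auto simp: min_def max_def)
  }
  assume t: "t \<in> ?I"
  have "\<exists>s. 0 \<le> s \<and> s \<le> 1 \<and> mob g s = t"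
  proof (cases "mob g 0 \<le> mob g 1")
    case True
    then show ?thesis using t cont by (intro IVT') auto
  next
    case False
    then show ?thesis using t cont by (intro IVT2') auto
  qed
  then obtain s where s: "0 \<le> s" "s \<le> 1" "mob g s = t" by blast
  then have "s \<noteq> 0" "s \<noteq> 1" using t by (auto simp: min_def max_def split: if_splits)
  then show "t \<in> mob g ` {0<..<1}" using s by auto
qed

lemma mob_antiderivative:
  assumes g: "g \<in> brjuno_monoid" and F: "\<And>t. (F has_real_derivative f t) (at t)" and s: "0 \<le> s" "s \<le> 1"
  shows "((\<lambda>s. of_int (mat_det g) * F (mob g s)) has_real_derivative f (mob g s) / den g s ^ 2) (at s)"
proof -
  let ?\<sigma> = "of_int (mat_det g) :: real"
  have \<sigma>: "?\<sigma> * ?\<sigma> = 1" by (cases rule: mat_det_cases[OF g]) simp_all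
  have "((\<lambda>s. ?\<sigma> * F (mob g s)) has_real_derivative ?\<sigma> * (f (mob g s) * (?\<sigma> / den g s ^ 2))) (at s)"
    by (intro DERIV_cmult DERIV_chain2[OF F] mob_deriv[OF g s])
  moreover have "?\<sigma> * (f (mob g s) * (?\<sigma> / den g s ^ 2)) = (?\<sigma> * ?\<sigma>) * (f (mob g s) / den g s ^ 2)" by simp
  ultimately show ?thesis unfolding \<sigma> by (simp only: mult_1)
qed

text \<open>Both integrals are evaluated by the antiderivative \<open>F\<close> at the ends of the
  image interval, the determinant supplying the orientation sign. The form with an indicator puts
  all matrices on one common variable, where their overlap can be counted.\<close>

lemma integral_mob:
  fixes f F :: "real \<Rightarrow> real"
  assumes g: "g \<in> brjuno_monoid" and F: "\<And>t. (F has_real_derivative f t) (at t)"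
    and cont: "\<And>t. isCont f t" and f0: "\<And>t. f t \<ge> 0"
  shows "integrable U01 (\<lambda>s. f (mob g s) / den g s ^ 2)"
    and "integral\<^sup>L U01 (\<lambda>s. f (mob g s) / den g s ^ 2) = \<bar>F (mob g 1) - F (mob g 0)\<bar>"
    and "integral\<^sup>L U01 (\<lambda>s. f (mob g s) / den g s ^ 2) = integral\<^sup>L U01 (\<lambda>t. f t * indicator (mob g ` {0<..<1}) t)"
    and "integrable U01 (\<lambda>t. f t * indicator (mob g ` {0<..<1}) t)"
proof -
  let ?\<sigma> = "of_int (mat_det g) :: real"
  have mob_cont: "isCont (mob g) s" if "0 \<le> s" "s \<le> 1" for s
    using DERIV_isCont[OF mob_deriv[OF g that]] .
  have F_cont: "isCont F t" for t using DERIV_isCont[OF F] .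
  have D: "((\<lambda>s. ?\<sigma> * F (mob g s)) has_real_derivative f (mob g s) / den g s ^ 2) (at s)" if "0 \<le> s" "s \<le> 1" for s
    by (rule mob_antiderivative[OF g F that])
  have C: "isCont (\<lambda>s. f (mob g s) / den g s ^ 2) s" if "0 < s" "s < 1" for s
    using that den_bounds(3)[OF g, of s]
    by (intro continuous_intros isCont_o2[OF mob_cont cont] den_cont) auto
  have FC: "isCont (\<lambda>s. ?\<sigma> * F (mob g s)) s" if "0 \<le> s" "s \<le> 1" for s
    using DERIV_isCont[OF D[OF that]] .
  have lims: "((\<lambda>s. ?\<sigma> * F (mob g s)) \<longlongrightarrow> ?\<sigma> * F (mob g 0)) (at_right 0)"
    "((\<lambda>s. ?\<sigma> * F (mob g s)) \<longlongrightarrow> ?\<sigma> * F (mob g 1)) (at_left 1)"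
    using FC[of 0] FC[of 1] unfolding isCont_def by (auto simp: filterlim_at_split)
  note FTC = U01_FTC_nonneg[OF D C _ lims]
  show "integrable U01 (\<lambda>s. f (mob g s) / den g s ^ 2)" using FTC(1) f0 by simp
  let ?l = "min (mob g 0) (mob g 1)" and ?r = "max (mob g 0) (mob g 1)"
  have "integral\<^sup>L U01 (\<lambda>s. f (mob g s) / den g s ^ 2) = ?\<sigma> * (F (mob g 1) - F (mob g 0))"
    using FTC(2) f0 by (simp add: algebra_simps)
  moreover have \<sigma>F: "?\<sigma> * (F (mob g 1) - F (mob g 0)) = F ?r - F ?l \<and> ?l < ?r"
    using mob_less[OF g, of 0 1] by (auto simp: min_def max_def)
  ultimately have 1: "integral\<^sup>L U01 (\<lambda>s. f (mob g s) / den g s ^ 2) = F ?r - F ?l" by simp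
  have lr: "?l < ?r" using \<sigma>F by blast
  have limF: "(F \<longlongrightarrow> F ?l) (at_right ?l)" "(F \<longlongrightarrow> F ?r) (at_left ?r)"
    using F_cont[of ?l] F_cont[of ?r] unfolding isCont_def by (simp_all add: filterlim_at_split)
  note FTC2 = set_integral_FTC_nonneg[OF lr F cont f0 limF]
  have sub: "{?l<..<?r} \<subseteq> {0<..<1}"
    using mob_range[OF g, of 0] mob_range[OF g, of 1] by auto
  have ind: "(\<lambda>t. indicator {0<..<1} t *\<^sub>R (f t * indicator (mob g ` {0<..<1}) t)) = (\<lambda>t. indicator {?l<..<?r} t *\<^sub>R f t)"
    unfolding mob_image[OF g] using sub by (auto simp: indicator_def fun_eq_iff)
  show "integrable U01 (\<lambda>t. f t * indicator (mob g ` {0<..<1}) t)"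
    using FTC2(1) unfolding integrable_U01_iff set_integrable_def ind .
  have 2: "integral\<^sup>L U01 (\<lambda>t. f t * indicator (mob g ` {0<..<1}) t) = F ?r - F ?l"
    using FTC2(2) unfolding integral_U01_eq set_lebesgue_integral_def ind .
  show "integral\<^sup>L U01 (\<lambda>s. f (mob g s) / den g s ^ 2) = integral\<^sup>L U01 (\<lambda>t. f t * indicator (mob g ` {0<..<1}) t)"
    using 1 2 by simp
  have "F ?l \<le> F ?r"
    by (rule DERIV_nonneg_imp_nondecreasing[OF less_imp_le[OF lr]]) (use F f0 in blast)
  then show "integral\<^sup>L U01 (\<lambda>s. f (mob g s) / den g s ^ 2) = \<bar>F (mob g 1) - F (mob g 0)\<bar>"
    unfolding 1 by (cases "mob g 0 \<le> mob g 1") simp_all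
qed

text \<open>After substitution the sum is the integral of \<open>f t\<close> times the sum of
  \<open>1 / d\<close> over the image intervals that contain \<open>t\<close>; at irrational
  \<open>t\<close>, hence almost everywhere, this weight is at most \<open>4 / D\<close>.\<close>

lemma sum_integral_mob_le:
  fixes f F :: "real \<Rightarrow> real"
  assumes G: "finite G" "G \<subseteq> brjuno_monoid" and D: "D > 0" "\<And>g. g \<in> G \<Longrightarrow> real_of_int (mat_d g) \<ge> D"
    and F: "\<And>t. (F has_real_derivative f t) (at t)"
    and cont: "\<And>t. isCont f t" and f0: "\<And>t. f t \<ge> 0"
  shows "(\<Sum>g\<in>G. 1 / real_of_int (mat_d g) * integral\<^sup>L U01 (\<lambda>s. f (mob g s) / den g s ^ 2)) \<le> 4 / D * (F 1 - F 0)"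
proof -
  have F_cont: "isCont F t" for t using DERIV_isCont[OF F] .
  have "(F \<longlongrightarrow> F 0) (at_right 0)" "(F \<longlongrightarrow> F 1) (at_left 1)"
    using F_cont[of 0] F_cont[of 1] unfolding isCont_def by (simp_all add: filterlim_at_split)
  note FTC = U01_FTC_nonneg[OF F cont f0 this]
  note ii = integral_mob[OF _ F cont f0]
  have "(\<Sum>g\<in>G. 1 / real_of_int (mat_d g) * integral\<^sup>L U01 (\<lambda>s. f (mob g s) / den g s ^ 2))
      = (\<Sum>g\<in>G. integral\<^sup>L U01 (\<lambda>t. 1 / real_of_int (mat_d g) * (f t * indicator (mob g ` {0<..<1}) t)))"
  proof (intro sum.cong refl)
    fix g assume "g \<in> G"
    then have "g \<in> brjuno_monoid" using G(2) by blast
    then show "1 / real_of_int (mat_d g) * integral\<^sup>L U01 (\<lambda>s. f (mob g s) / den g s ^ 2)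
      = integral\<^sup>L U01 (\<lambda>t. 1 / real_of_int (mat_d g) * (f t * indicator (mob g ` {0<..<1}) t))"
      unfolding integral_mult_right_zero by (simp only: ii(3))
  qed
  also have "\<dots> = integral\<^sup>L U01 (\<lambda>t. \<Sum>g\<in>G. 1 / real_of_int (mat_d g) * (f t * indicator (mob g ` {0<..<1}) t))"
    using G(2) by (intro Bochner_Integration.integral_sum[symmetric] integrable_mult_right ii(4)) auto
  also have "\<dots> \<le> integral\<^sup>L U01 (\<lambda>t. 4 / D * f t)"
  proof (rule integral_mono_AE)
    show "integrable U01 (\<lambda>t. \<Sum>g\<in>G. 1 / real_of_int (mat_d g) * (f t * indicator (mob g ` {0<..<1}) t))"
      using G(2) by (intro Bochner_Integration.integrable_sum integrable_mult_right ii(4)) auto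
    show "integrable U01 (\<lambda>t. 4 / D * f t)" using FTC(1) by simp
    show "AE t in U01. (\<Sum>g\<in>G. 1 / real_of_int (mat_d g) * (f t * indicator (mob g ` {0<..<1}) t)) \<le> 4 / D * f t"
      using AE_U01_irrational AE_space
    proof eventually_elim
      case (elim t)
      then interpret irrational_unit t by unfold_locales auto
      let ?G = "{g \<in> G. t \<in> mob g ` {0<..<1}}"
      have "(\<Sum>g\<in>G. 1 / real_of_int (mat_d g) * (f t * indicator (mob g ` {0<..<1}) t))
          = (\<Sum>g\<in>?G. 1 / real_of_int (mat_d g)) * f t"
        using G(1) unfolding sum_distrib_right
        by (intro sum.mono_neutral_cong_right) (auto simp: indicator_def)
      also have "\<dots> \<le> 4 / D * f t"
        using G D f0 by (intro mult_right_mono sum_inverse_d) auto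
      finally show ?case .
    qed
  qed
  also have "\<dots> = 4 / D * (F 1 - F 0)" using FTC(2) by simp
  finally show ?thesis .
qed

text \<open>The image of the unit interval has length
  \<open>1 / (d (c + d)) \<ge> 1 / (2 d ^ 2)\<close>, so \<open>1 / d ^ 3\<close> is dominated by
  this length times \<open>1 / d\<close>. The overlap bound with density \<open>1\<close> and
  \<open>D = 1\<close> applies. All convergence over the monoid rests on this.\<close>

lemma sum_inverse_cube:
  assumes G: "finite G" "G \<subseteq> brjuno_monoid"
  shows "(\<Sum>g\<in>G. 1 / real_of_int (mat_d g) ^ 3) \<le> 16"
proof -
  have "1 / real_of_int (mat_d g) ^ 3 \<le> 4 * (1 / real_of_int (mat_d g) * integral\<^sup>L U01 (\<lambda>s. 1 / den g s ^ 2))"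
    if "g \<in> G" for g
  proof -
    have g: "g \<in> brjuno_monoid" using that G by auto
    have d: "real_of_int (mat_d g) \<ge> 1" using mat_d_ge1[OF g] by simp
    have "integral\<^sup>L U01 (\<lambda>s. 1 / den g s ^ 2) = \<bar>mob g 1 - mob g 0\<bar>"
      using integral_mob(2)[OF g, of "\<lambda>t. t" "\<lambda>_. 1"] by simp
    also have "\<dots> = 1 / (den g 1 * real_of_int (mat_d g))"
    proof -
      have "\<bar>real_of_int (mat_det g)\<bar> = 1" by (cases rule: mat_det_cases[OF g]) simp_all
      moreover have "mob g 1 - mob g 0 = of_int (mat_det g) * (1 - 0) / (den g 1 * den g 0)"
        using den_bounds(3)[OF g, of 1] d by (intro mob_diff) simp_all
      ultimately show ?thesis using den_bounds(3)[OF g, of 1] d by (simp add: abs_mult)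
    qed
    also have "\<dots> \<ge> 1 / (2 * real_of_int (mat_d g) * real_of_int (mat_d g))"
      using den_bounds[OF g, of 1] d by (intro divide_left_mono mult_right_mono) auto
    finally have "1 / (2 * real_of_int (mat_d g) * real_of_int (mat_d g)) \<le> integral\<^sup>L U01 (\<lambda>s. 1 / den g s ^ 2)" .
    then have "4 * (1 / real_of_int (mat_d g) * (1 / (2 * real_of_int (mat_d g) * real_of_int (mat_d g))))
      \<le> 4 * (1 / real_of_int (mat_d g) * integral\<^sup>L U01 (\<lambda>s. 1 / den g s ^ 2))"
      using d by (intro mult_left_mono) auto
    moreover have "1 / real_of_int (mat_d g) ^ 3 \<le> 4 * (1 / real_of_int (mat_d g) * (1 / (2 * real_of_int (mat_d g) * real_of_int (mat_d g))))"
      using d by (simp add: power3_eq_cube field_simps)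
    ultimately show ?thesis by linarith
  qed
  then have "(\<Sum>g\<in>G. 1 / real_of_int (mat_d g) ^ 3) \<le> (\<Sum>g\<in>G. 4 * (1 / real_of_int (mat_d g) * integral\<^sup>L U01 (\<lambda>s. 1 / den g s ^ 2)))"
    by (rule sum_mono)
  also have "\<dots> \<le> 4 * (4 / 1 * (1 - 0))"
  proof -
    have "real_of_int (mat_d g) \<ge> 1" if "g \<in> G" for g
      using mat_d_ge1[of g] that G(2) by auto
    then have "(\<Sum>g\<in>G. 1 / real_of_int (mat_d g) * integral\<^sup>L U01 (\<lambda>s. 1 / den g s ^ 2)) \<le> 4 / 1 * (1 - 0)"
      by (intro sum_integral_mob_le[OF G]) auto
    then show ?thesis by (subst sum_distrib_left[symmetric]) linarith
  qed
  finally show ?thesis by simp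
qed

section \<open>Poisson integrals of the transported densities\<close>

definition poisson :: "real \<Rightarrow> real \<Rightarrow> real \<Rightarrow> real" where
  "poisson x y t = y / ((t - x) ^ 2 + y ^ 2) / pi"

definition pterm :: "int \<times> int \<times> int \<times> int \<Rightarrow> real \<Rightarrow> real \<Rightarrow> real" where
  "pterm g x y = integral\<^sup>L U01 (\<lambda>s. ln (1 / s) *\<^sub>R (poisson x y (mob g s) / den g s ^ 3))"

lemma poisson_measurable [measurable]: "poisson x y \<in> borel_measurable borel"
  unfolding poisson_def by measurable

lemma poisson_nonneg: "y > 0 \<Longrightarrow> poisson x y t \<ge> 0"
  by (simp add: poisson_def)

lemma poisson_le: "y > 0 \<Longrightarrow> poisson x y t \<le> 1 / (pi * y)"
proof -
  assume y: "y > 0"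
  have "y / ((t - x) ^ 2 + y ^ 2) \<le> y / y ^ 2" using y by (intro divide_left_mono) (auto simp: add_nonneg_pos)
  also have "\<dots> = 1 / y" using y by (simp add: power2_eq_square)
  finally have "y / ((t - x) ^ 2 + y ^ 2) / pi \<le> 1 / y / pi" by (rule divide_right_mono) simp
  then show ?thesis by (simp add: poisson_def mult.commute)
qed

lemma poisson_le_dist: "y > 0 \<Longrightarrow> \<delta> > 0 \<Longrightarrow> \<bar>t - x\<bar> \<ge> \<delta> \<Longrightarrow> poisson x y t \<le> y / \<delta> ^ 2"
proof -
  assume *: "y > 0" "\<delta> > 0" "\<bar>t - x\<bar> \<ge> \<delta>"
  have "\<delta> ^ 2 \<le> \<bar>t - x\<bar> ^ 2" using * by (intro power_mono) auto
  then have "y / ((t - x) ^ 2 + y ^ 2) \<le> y / \<delta> ^ 2"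
    using * by (intro divide_left_mono mult_pos_pos) (auto simp: add_nonneg_pos intro: add_increasing2)
  moreover have "y / ((t - x) ^ 2 + y ^ 2) / pi \<le> y / ((t - x) ^ 2 + y ^ 2) / 1"
    using pi_ge_two * by (intro divide_left_mono) auto
  ultimately show ?thesis by (simp add: poisson_def)
qed

lemma poisson_antiderivative:
  assumes "y > 0"
  shows "((\<lambda>t. arctan ((t - x) / y) / pi) has_real_derivative poisson x y t) (at t)"
proof -
  have "1 + ((t - x) / y) ^ 2 = ((t - x) ^ 2 + y ^ 2) / y ^ 2" using assms by (simp add: field_simps power2_eq_square)
  then show ?thesis using assms
    by (auto intro!: derivative_eq_intros simp: poisson_def) (simp add: power2_eq_square)
qed

lemma poisson_cont: "y > 0 \<Longrightarrow> isCont (poisson x y) t"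
  unfolding poisson_def by (intro continuous_intros) (auto simp: add_nonneg_pos sum_power2_eq_zero_iff)

lemmas integral_mob_poisson =
  integral_mob[OF _ poisson_antiderivative poisson_cont poisson_nonneg]

lemma integral_mob_poisson_le:
  assumes "g \<in> brjuno_monoid" "y > 0"
  shows "integral\<^sup>L U01 (\<lambda>s. poisson x y (mob g s) / den g s ^ 2) \<le> 1"
proof -
  have "\<bar>arctan a - arctan b\<bar> < pi" for a b
    using arctan_bounded[of a] arctan_bounded[of b] by linarith
  then have "\<bar>arctan a / pi - arctan b / pi\<bar> \<le> 1" for a b
    by (simp flip: diff_divide_distrib add: less_imp_le)
  then show ?thesis using integral_mob_poisson(2)[OF assms(1) assms(2) assms(2) assms(2)] by simp
qed

lemma pterm_integrable:
  assumes "g \<in> brjuno_monoid" "y > 0"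
  shows "integrable U01 (\<lambda>s. ln (1 / s) *\<^sub>R (poisson x y (mob g s) / den g s ^ 3))"
proof (rule integral_ln_bounded(1))
  fix s :: real assume s: "0 < s" "s < 1"
  have dn: "1 \<le> den g s" using den_bounds(3)[OF assms(1), of s] s by simp
  then have "1 \<le> den g s ^ 3" by simp
  then have "poisson x y (mob g s) / den g s ^ 3 \<le> poisson x y (mob g s) / 1"
    using poisson_nonneg[OF assms(2)] dn by (intro divide_left_mono) auto
  then show "norm (poisson x y (mob g s) / den g s ^ 3) \<le> 1 / (pi * y)"
    using poisson_nonneg[OF assms(2), of x "mob g s"] poisson_le[OF assms(2), of x "mob g s"] dn
    by simp
qed measurable

lemma pterm_nonneg: "g \<in> brjuno_monoid \<Longrightarrow> y > 0 \<Longrightarrow> pterm g x y \<ge> 0"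
  unfolding pterm_def
  by (intro integral_nonneg_AE AE_I2)
    (auto intro!: mult_nonneg_nonneg divide_nonneg_nonneg poisson_nonneg zero_le_power order.trans[OF zero_le_one den_bounds(3)])

lemma pterm_le_far:
  assumes g: "g \<in> brjuno_monoid" and "y > 0" "\<delta> > 0" "\<And>t. 0 \<le> t \<Longrightarrow> t \<le> 1 \<Longrightarrow> \<bar>t - x\<bar> \<ge> \<delta>"
  shows "pterm g x y \<le> y / \<delta> ^ 2 * (1 / real_of_int (mat_d g) ^ 3)"
proof -
  have d: "real_of_int (mat_d g) \<ge> 1" using mat_d_ge1[OF g] by simp
  have "norm (pterm g x y) \<le> y / \<delta> ^ 2 * (1 / real_of_int (mat_d g) ^ 3)"
    unfolding pterm_def
  proof (rule integral_ln_bounded(2))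
    fix s :: real assume s: "0 < s" "s < 1"
    have p: "poisson x y (mob g s) \<le> y / \<delta> ^ 2"
      using assms mob_range[OF g, of s] s by (intro poisson_le_dist) auto
    have "1 / den g s ^ 3 \<le> 1 / real_of_int (mat_d g) ^ 3"
      using den_bounds(1)[OF g, of s] s d by (intro divide_left_mono power_mono mult_pos_pos zero_less_power) auto
    then have "poisson x y (mob g s) * (1 / den g s ^ 3) \<le> y / \<delta> ^ 2 * (1 / real_of_int (mat_d g) ^ 3)"
      using p assms(2) den_bounds(3)[OF g, of s] s by (intro mult_mono) auto
    moreover have "poisson x y (mob g s) / den g s ^ 3 \<ge> 0"
      using poisson_nonneg[OF assms(2)] den_bounds(3)[OF g, of s] s by simp
    ultimately show "norm (poisson x y (mob g s) / den g s ^ 3) \<le> y / \<delta> ^ 2 * (1 / real_of_int (mat_d g) ^ 3)"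
      by simp
  qed measurable
  then show ?thesis by simp
qed

text \<open>This is \<open>ln v \<le> v\<close> at \<open>v = y ^ 2 / sqrt s\<close>. The square
  root keeps the remainder integrable at \<open>0\<close>, and \<open>y ^ 2\<close> outweighs the
  bound \<open>1 / (pi y)\<close> for the Poisson kernel.\<close>

lemma ln_inverse_le:
  fixes s y :: real
  assumes "0 < s" "0 < y"
  shows "ln (1 / s) \<le> 4 * ln (1 / y) + 2 * y ^ 2 / sqrt s"
proof -
  have "ln (y ^ 2 / sqrt s) \<le> y ^ 2 / sqrt s" using assms by (intro ln_bound) auto
  moreover have "ln (y ^ 2 / sqrt s) = 2 * ln y - ln s / 2"
    using assms by (simp add: ln_div ln_realpow ln_sqrt)
  ultimately show ?thesis using assms by (simp add: ln_div)
qed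

text \<open>The logarithm is cut off at the order of \<open>ln (1 / y)\<close>. The main part
  retains a Poisson mass and gains \<open>1 / d\<close> from
  \<open>den ^ 3 \<ge> d * den ^ 2\<close>; the remainder is \<open>2 * y / d ^ 3\<close> times the
  integral \<open>2\<close> of \<open>1 / sqrt s\<close>.\<close>

lemma pterm_le:
  assumes g: "g \<in> brjuno_monoid" and y: "0 < y" "y < 1"
  shows "pterm g x y \<le> 4 * ln (1 / y) * (1 / real_of_int (mat_d g) * integral\<^sup>L U01 (\<lambda>s. poisson x y (mob g s) / den g s ^ 2))
      + 4 * y * (1 / real_of_int (mat_d g) ^ 3)"
proof -
  let ?d = "real_of_int (mat_d g)"
  have d: "?d \<ge> 1" using mat_d_ge1[OF g] by simp
  note ip = integral_mob_poisson(1)[OF g y(1) y(1) y(1)]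
  have "pterm g x y \<le> integral\<^sup>L U01 (\<lambda>s. 4 * ln (1 / y) / ?d * (poisson x y (mob g s) / den g s ^ 2) + 2 * y / ?d ^ 3 * (1 / sqrt s))"
    unfolding pterm_def
  proof (rule integral_mono)
    show "integrable U01 (\<lambda>s. ln (1 / s) *\<^sub>R (poisson x y (mob g s) / den g s ^ 3))" by (rule pterm_integrable[OF g y(1)])
    show "integrable U01 (\<lambda>s. 4 * ln (1 / y) / ?d * (poisson x y (mob g s) / den g s ^ 2) + 2 * y / ?d ^ 3 * (1 / sqrt s))"
      using ip integral_inverse_sqrt(1) by (intro Bochner_Integration.integrable_add integrable_mult_right)
    fix s assume "s \<in> space U01"
    then have s: "0 < s" "s < 1" by auto
    let ?P = "poisson x y (mob g s)"
    have P: "0 \<le> ?P" "?P \<le> 1 / (pi * y)" using poisson_nonneg poisson_le y by auto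
    have dn: "?d \<le> den g s" "1 \<le> den g s" using den_bounds[OF g, of s] s by auto
    have "?P / den g s ^ 3 \<le> ?P / (?d * den g s ^ 2)"
      using dn d P by (intro divide_left_mono) (auto simp: power3_eq_cube power2_eq_square intro!: mult_right_mono)
    moreover have ly: "ln (1 / y) \<ge> 0" using y by simp
    ultimately have 1: "4 * ln (1 / y) * (?P / den g s ^ 3) \<le> 4 * ln (1 / y) * (?P / (?d * den g s ^ 2))"
      by (intro mult_left_mono) auto
    have "?P / den g s ^ 3 \<le> (1 / (pi * y)) / ?d ^ 3"
      using dn d P y by (intro frac_le power_mono) auto
    also have "\<dots> \<le> (1 / y) / ?d ^ 3"
      using d y pi_ge_two by (intro divide_right_mono divide_left_mono) auto
    finally have "2 * y ^ 2 / sqrt s * (?P / den g s ^ 3) \<le> 2 * y ^ 2 / sqrt s * ((1 / y) / ?d ^ 3)"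
      using s y by (intro mult_left_mono) auto
    also have "\<dots> = 2 * y / ?d ^ 3 * (1 / sqrt s)" using y by (simp add: power2_eq_square)
    finally have 2: "2 * y ^ 2 / sqrt s * (?P / den g s ^ 3) \<le> 2 * y / ?d ^ 3 * (1 / sqrt s)" .
    have "ln (1 / s) * (?P / den g s ^ 3) \<le> (4 * ln (1 / y) + 2 * y ^ 2 / sqrt s) * (?P / den g s ^ 3)"
      using ln_inverse_le[OF s(1) y(1)] P dn by (intro mult_right_mono) auto
    also have "\<dots> = 4 * ln (1 / y) * (?P / den g s ^ 3) + 2 * y ^ 2 / sqrt s * (?P / den g s ^ 3)"
      by (rule distrib_right)
    also have "\<dots> \<le> 4 * ln (1 / y) * (?P / (?d * den g s ^ 2)) + 2 * y / ?d ^ 3 * (1 / sqrt s)"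
      using 1 2 by linarith
    finally show "ln (1 / s) *\<^sub>R (?P / den g s ^ 3) \<le> 4 * ln (1 / y) / ?d * (?P / den g s ^ 2) + 2 * y / ?d ^ 3 * (1 / sqrt s)"
      by simp
  qed
  also have "\<dots> = 4 * ln (1 / y) / ?d * integral\<^sup>L U01 (\<lambda>s. poisson x y (mob g s) / den g s ^ 2) + 2 * y / ?d ^ 3 * 2"
    unfolding Bochner_Integration.integral_add[OF integrable_mult_right[OF ip] integrable_mult_right[OF integral_inverse_sqrt(1)]]
      integral_mult_right_zero integral_inverse_sqrt(2) ..
  finally show ?thesis by simp
qed

text \<open>The overlap bound applies to the Poisson kernel itself, whose mass is at most
  \<open>1\<close>, and turns \<open>4 * ln (1 / y)\<close> into \<open>16 * ln (1 / y) / D\<close>.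
  The remainders contribute \<open>4 * y\<close> times the bound \<open>16\<close> for the inverse
  cubes.\<close>

lemma sum_pterm_le:
  assumes G: "finite G" "G \<subseteq> brjuno_monoid" and D: "D > 0" "\<And>g. g \<in> G \<Longrightarrow> real_of_int (mat_d g) \<ge> D"
    and y: "0 < y" "y < 1"
  shows "(\<Sum>g\<in>G. pterm g x y) \<le> 16 * ln (1 / y) / D + 64 * y"
proof -
  let ?J = "\<lambda>g. integral\<^sup>L U01 (\<lambda>s. poisson x y (mob g s) / den g s ^ 2)"
  have "(\<Sum>g\<in>G. pterm g x y) \<le> (\<Sum>g\<in>G. 4 * ln (1 / y) * (1 / real_of_int (mat_d g) * ?J g) + 4 * y * (1 / real_of_int (mat_d g) ^ 3))"
    using pterm_le y G(2) by (intro sum_mono) blast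
  also have "\<dots> = 4 * ln (1 / y) * (\<Sum>g\<in>G. 1 / real_of_int (mat_d g) * ?J g) + 4 * y * (\<Sum>g\<in>G. 1 / real_of_int (mat_d g) ^ 3)"
    by (simp add: sum.distrib sum_distrib_left)
  also have "\<dots> \<le> 4 * ln (1 / y) * (4 / D * 1) + 4 * y * 16"
  proof (intro add_mono mult_left_mono)
    have "(\<Sum>g\<in>G. 1 / real_of_int (mat_d g) * ?J g) \<le> 4 / D * (arctan ((1 - x) / y) / pi - arctan ((0 - x) / y) / pi)"
      by (rule sum_integral_mob_le[OF G D poisson_antiderivative poisson_cont poisson_nonneg]) (use y in auto)
    also have "\<dots> \<le> 4 / D * 1"
      using arctan_bounded[of "(1 - x) / y"] arctan_bounded[of "(0 - x) / y"] D
      by (intro mult_left_mono) (auto simp: field_simps)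
    finally show "(\<Sum>g\<in>G. 1 / real_of_int (mat_d g) * ?J g) \<le> 4 / D * 1" .
    show "(\<Sum>g\<in>G. 1 / real_of_int (mat_d g) ^ 3) \<le> 16" by (rule sum_inverse_cube[OF G])
  qed (use y in auto)
  finally show ?thesis by simp
qed

text \<open>Only the nearby supremum of the density is controlled. At distance at least
  \<open>R / 2\<close> one has \<open>R ^ 2 \<le> 4 * (t - x) ^ 2\<close>, so the kernel of height
  \<open>y\<close> is at most \<open>5 * y / R\<close> times that of height \<open>R\<close>. The
  far part thus becomes a Poisson term at height \<open>R\<close>, to which the summed bound applies
  again.\<close>

lemma pterm_local_le:
  assumes g: "g \<in> brjuno_monoid" and y: "0 < y" and R: "0 < R" and m: "0 \<le> m"
    and loc: "\<And>s. 0 < s \<Longrightarrow> s < 1 \<Longrightarrow> \<bar>mob g s - x\<bar> < R / 2 \<Longrightarrow> ln (1 / s) / den g s \<le> m"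
  shows "pterm g x y \<le> m + 5 * y / R * pterm g x R"
proof -
  note ip = integral_mob_poisson(1)[OF g y y y]
  have "pterm g x y \<le> integral\<^sup>L U01 (\<lambda>s. m * (poisson x y (mob g s) / den g s ^ 2)
      + 5 * y / R * (ln (1 / s) *\<^sub>R (poisson x R (mob g s) / den g s ^ 3)))"
    unfolding pterm_def
  proof (rule integral_mono)
    show "integrable U01 (\<lambda>s. ln (1 / s) *\<^sub>R (poisson x y (mob g s) / den g s ^ 3))" by (rule pterm_integrable[OF g y])
    show "integrable U01 (\<lambda>s. m * (poisson x y (mob g s) / den g s ^ 2)
      + 5 * y / R * (ln (1 / s) *\<^sub>R (poisson x R (mob g s) / den g s ^ 3)))"
      using ip pterm_integrable[OF g R] by (intro Bochner_Integration.integrable_add integrable_mult_right)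
    fix s assume "s \<in> space U01"
    then have s: "0 < s" "s < 1" by auto
    let ?t = "mob g s"
    have dn: "1 \<le> den g s" using den_bounds[OF g, of s] s by auto
    have ls: "ln (1 / s) \<ge> 0" using s by simp
    have n1: "0 \<le> m * (poisson x y ?t / den g s ^ 2)" using m poisson_nonneg[OF y] dn by simp
    have n2: "0 \<le> 5 * y / R * (ln (1 / s) * (poisson x R ?t / den g s ^ 3))"
      using y R poisson_nonneg[OF R] dn ls by simp
    show "ln (1 / s) *\<^sub>R (poisson x y ?t / den g s ^ 3) \<le> m * (poisson x y ?t / den g s ^ 2)
      + 5 * y / R * (ln (1 / s) *\<^sub>R (poisson x R ?t / den g s ^ 3))"
    proof (cases "\<bar>?t - x\<bar> < R / 2")
      case True
      have "ln (1 / s) / den g s * (poisson x y ?t / den g s ^ 2) \<le> m * (poisson x y ?t / den g s ^ 2)"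
        using loc[OF s True] poisson_nonneg[OF y] dn by (intro mult_right_mono) auto
      then show ?thesis using n2 by (simp add: power3_eq_cube power2_eq_square)
    next
      case False
      then have "(R / 2) ^ 2 \<le> \<bar>?t - x\<bar> ^ 2" using R by (intro power_mono) auto
      then have "(?t - x) ^ 2 + R ^ 2 \<le> 5 * (?t - x) ^ 2" by (simp add: power_divide)
      also have "\<dots> \<le> 5 * ((?t - x) ^ 2 + y ^ 2)" by simp
      finally have "y / (5 * ((?t - x) ^ 2 + y ^ 2)) \<le> y / ((?t - x) ^ 2 + R ^ 2)"
        using y R by (intro divide_left_mono mult_pos_pos) (auto intro!: add_nonneg_pos)
      then have "y / ((?t - x) ^ 2 + y ^ 2) \<le> 5 * y / R * (R / ((?t - x) ^ 2 + R ^ 2))"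
      proof -
        have "y / ((?t - x) ^ 2 + y ^ 2) = 5 * (y / (5 * ((?t - x) ^ 2 + y ^ 2)))"
          by (simp only: times_divide_eq_right mult_divide_mult_cancel_left_if) simp
        also have "\<dots> \<le> 5 * (y / ((?t - x) ^ 2 + R ^ 2))"
          using \<open>y / (5 * _) \<le> _\<close> by (rule mult_left_mono) simp
        finally show ?thesis using R by simp
      qed
      then have "y / ((?t - x) ^ 2 + y ^ 2) / pi \<le> 5 * y / R * (R / ((?t - x) ^ 2 + R ^ 2)) / pi"
        by (rule divide_right_mono) simp
      then have "poisson x y ?t \<le> 5 * y / R * poisson x R ?t" by (simp add: poisson_def)
      then have "ln (1 / s) / den g s ^ 3 * poisson x y ?t \<le> ln (1 / s) / den g s ^ 3 * (5 * y / R * poisson x R ?t)"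
        using ls dn by (intro mult_left_mono) auto
      then show ?thesis using n1 by (simp add: mult_ac)
    qed
  qed
  also have "\<dots> = m * integral\<^sup>L U01 (\<lambda>s. poisson x y (mob g s) / den g s ^ 2) + 5 * y / R * pterm g x R"
    unfolding Bochner_Integration.integral_add[OF integrable_mult_right[OF ip] integrable_mult_right[OF pterm_integrable[OF g R]]]
      integral_mult_right_zero pterm_def ..
  also have "m * integral\<^sup>L U01 (\<lambda>s. poisson x y (mob g s) / den g s ^ 2) \<le> m * 1"
    using m integral_mob_poisson_le[OF g y] by (intro mult_left_mono)
  finally show ?thesis by simp
qed

section \<open>The Cauchy transform of the logarithm\<close>

lemma has_integral_U01:
  fixes f :: "real \<Rightarrow> complex"
  assumes "integrable U01 f"
  shows "(f has_integral (integral\<^sup>L U01 f)) {0..1}"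
proof -
  have "set_integrable lborel {0<..<1} f" using assms by (simp add: integrable_U01_iff)
  from set_borel_integral_eq_integral[OF this]
  have "(f has_integral (integral\<^sup>L U01 f)) {0<..<1}"
    by (simp add: has_integral_iff integral_U01_eq)
  then show ?thesis by (simp add: has_integral_Icc_iff_Ioo)
qed

lemma cauchy_kernel_measurable [measurable]:
  "(\<lambda>s. 1 / (complex_of_real s - z)) \<in> borel_measurable borel"
  by measurable

lemma cauchy_kernel_bounded:
  assumes "z \<notin> complex_of_real ` {0..1}"
  obtains C where "\<And>s. 0 < s \<Longrightarrow> s < 1 \<Longrightarrow> norm (1 / (complex_of_real s - z)) \<le> C"
proof -
  have "continuous_on {0..1} (\<lambda>s. 1 / (complex_of_real s - z))"
    using assms by (intro continuous_intros) force
  then have "bounded ((\<lambda>s. 1 / (complex_of_real s - z)) ` {0..1})"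
    by (intro compact_imp_bounded compact_continuous_image) auto
  then obtain C where "\<And>v. v \<in> (\<lambda>s. 1 / (complex_of_real s - z)) ` {0..1} \<Longrightarrow> norm v \<le> C"
    unfolding bounded_iff by blast
  then show ?thesis by (intro that[of C]) force
qed

lemma integrable_cauchy_kernel:
  assumes "z \<notin> complex_of_real ` {0..1}"
  shows "integrable U01 (\<lambda>s. ln (1 / s) *\<^sub>R (1 / (complex_of_real s - z)))"
proof -
  obtain C where "\<And>s. 0 < s \<Longrightarrow> s < 1 \<Longrightarrow> norm (1 / (complex_of_real s - z)) \<le> C"
    using cauchy_kernel_bounded[OF assms] by blast
  then show ?thesis by (intro integral_ln_bounded(1)[OF cauchy_kernel_measurable])
qed

text \<open>Integration by parts turns the logarithmic integral defining the dilogarithm into a Cauchy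
  integral against \<open>ln (1 / s)\<close>. Since \<open>ln 0 = 0\<close>, the boundary term at \<open>0\<close> is
  literally \<open>0\<close>.\<close>
lemma phi0_eq_integral:
  assumes z: "z \<notin> complex_of_real ` {0..1}"
  shows "phi0 z = 1 / of_real pi * integral\<^sup>L U01 (\<lambda>s. ln (1 / s) *\<^sub>R (1 / (complex_of_real s - z)))"
proof -
  define w where "w = 1 / z"
  define G where "G s = ln s *\<^sub>R Ln (1 - complex_of_real s * w)" for s
  define A where "A s = Ln (1 - linepath 0 w s) / linepath 0 w s * (w - 0)" for s
  define I where "I = integral\<^sup>L U01 (\<lambda>s. ln (1 / s) *\<^sub>R (1 / (complex_of_real s - z)))"
  have z0: "z \<noteq> 0" using z by force
  then have w0: "w \<noteq> 0" by (simp add: w_def)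
  \<comment> \<open>The segment from \<open>0\<close> to \<open>w = 1 / z\<close> avoids the cut of
    \<open>Ln (1 - t)\<close> because \<open>z\<close> is off the unit interval.\<close>
  have nR: "1 - complex_of_real s * w \<notin> \<real>\<^sub>\<le>\<^sub>0" if "0 \<le> s" "s \<le> 1" for s
  proof
    assume "1 - complex_of_real s * w \<in> \<real>\<^sub>\<le>\<^sub>0"
    then obtain r where r: "r \<le> 0" "1 - complex_of_real s * w = of_real r" by (auto elim: nonpos_Reals_cases)
    then have "complex_of_real s = of_real (1 - r) * z"
      using z0 by (simp add: w_def field_simps)
    then have "z = of_real (s / (1 - r))" using r(1) by (simp add: field_simps)
    moreover have "s / (1 - r) \<in> {0..1}" using r(1) that by (auto simp: field_simps)
    ultimately show False using z by blast
  qed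
  have A_eq: "A s = (1 / s) *\<^sub>R Ln (1 - complex_of_real s * w)" for s
    using w0 by (auto simp: A_def linepath_def scaleR_conv_of_real)
  have "((\<lambda>s. A s - ln (1 / s) *\<^sub>R (1 / (complex_of_real s - z))) has_integral (G 1 - G 0)) {0..1}"
  proof (rule fundamental_theorem_of_calculus_interior)
    have "isCont G s" if "0 < s" "s \<le> 1" for s
      unfolding G_def using nR[of s] that by (intro continuous_intros) auto
    moreover have "(G \<longlongrightarrow> G 0) (at 0 within {0..1})"
    proof (rule tendsto_norm_zero_cancel[THEN tendsto_eq_rhs])
      show "((\<lambda>s. norm (G s)) \<longlongrightarrow> 0) (at 0 within {0..1})"
      proof (rule tendsto_sandwich[OF _ _ tendsto_const])
        show "\<forall>\<^sub>F s in at 0 within {0..1}. 0 \<le> norm (G s)" by simp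
        have "((\<lambda>s. norm (complex_of_real s * w)) \<longlongrightarrow> 0) (at 0 within {0..1})"
          by (rule tendsto_eq_intros refl | simp)+
        then have "\<forall>\<^sub>F s in at 0 within {0..1}. norm (complex_of_real s * w) < 1/2"
          by (rule order_tendstoD) simp
        moreover have "\<forall>\<^sub>F s in at (0::real) within {0..1}. s \<in> {0..1} \<and> s \<noteq> 0"
          by (simp add: eventually_at_topological) blast
        ultimately show "\<forall>\<^sub>F s in at 0 within {0..1}. norm (G s) \<le> - (s * ln s) * (2 * norm w)"
        proof eventually_elim
          case (elim s)
          then have "norm (Ln (1 + - (complex_of_real s * w))) \<le> 2 * norm (- (complex_of_real s * w))"
            by (intro norm_Ln_le) simp
          then have "norm (Ln (1 - complex_of_real s * w)) \<le> 2 * (s * norm w)"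
            using elim by (simp add: norm_mult)
          then have "\<bar>ln s\<bar> * norm (Ln (1 - complex_of_real s * w)) \<le> \<bar>ln s\<bar> * (2 * (s * norm w))"
            by (intro mult_left_mono) auto
          moreover have "\<bar>ln s\<bar> = - ln s" using elim by simp
          ultimately show ?case by (simp add: G_def mult_ac)
        qed
        have "((\<lambda>s. s * ln s) \<longlongrightarrow> 0) (at_right (0::real))" by real_asymp
        then have "((\<lambda>s. s * ln s) \<longlongrightarrow> 0) (at (0::real) within {0..1})"
          by (simp add: at_within_Icc_at_right)
        from tendsto_mult[OF tendsto_minus[OF this] tendsto_const]
        show "((\<lambda>s. - (s * ln s) * (2 * norm w)) \<longlongrightarrow> 0) (at 0 within {0..1})" by simp
      qed
    qed (simp add: G_def)
    ultimately show "continuous_on {0..1} G"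
      unfolding continuous_on_eq_continuous_within
      by (metis atLeastAtMost_iff continuous_at_imp_continuous_at_within continuous_within linorder_not_less order.order_iff_strict)
  next
    fix s :: real assume "s \<in> {0<..<1}"
    then have s: "0 < s" "s < 1" by auto
    have 1: "(ln has_field_derivative 1 / s) (at s)" using s by (intro DERIV_ln_divide)
    have "((\<lambda>t. Ln (1 - t * w)) has_field_derivative - w / (1 - complex_of_real s * w)) (at (complex_of_real s))"
      using nR[of s] s by (auto intro!: derivative_eq_intros simp: divide_inverse)
    then have 2: "((\<lambda>s. Ln (1 - complex_of_real s * w)) has_vector_derivative - w / (1 - complex_of_real s * w)) (at s)"
      by (rule has_vector_derivative_real_field)
    have sz: "complex_of_real s - z \<noteq> 0" using z s by force
    have "- w / (1 - complex_of_real s * w) = 1 / (complex_of_real s - z)"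
      using sz z0 by (simp add: w_def field_simps)
    then show "(G has_vector_derivative A s - ln (1 / s) *\<^sub>R (1 / (complex_of_real s - z))) (at s)"
      unfolding G_def A_eq using has_vector_derivative_scaleR[OF 1 2] s
      by (simp add: ln_div add.commute)
  qed simp
  moreover have "G 1 - G 0 = 0" by (simp add: G_def)
  ultimately have "((\<lambda>s. A s - ln (1 / s) *\<^sub>R (1 / (complex_of_real s - z))) has_integral 0) {0..1}" by simp
  from has_integral_add[OF this has_integral_U01[OF integrable_cauchy_kernel[OF z]]]
  have "(A has_integral I) {0..1}" by (simp add: I_def)
  then have "((\<lambda>t. Ln (1 - t) / t) has_contour_integral I) (linepath 0 w)"
    unfolding has_contour_integral_linepath A_def by simp
  then have "Li2 w = - I" unfolding Li2_def by (simp add: contour_integral_unique)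
  then show ?thesis by (simp add: phi0_def w_def I_def)
qed

lemma integrable_cauchy_kernel_square:
  assumes "v \<le> -1"
  shows "integrable U01 (\<lambda>s. ln (1 / s) *\<^sub>R (1 / (complex_of_real s - of_real v) ^ 2))"
proof (rule integral_ln_bounded(1)[of _ 1])
  fix s :: real assume "0 < s" "s < 1"
  then have "1 \<le> \<bar>s - v\<bar> ^ 2" using assms by (intro one_le_power) auto
  then have "1 \<le> (s - v) ^ 2" by simp
  then have "1 / (s - v) ^ 2 \<le> 1 / 1" by (intro divide_left_mono) auto
  then show "norm (1 / (complex_of_real s - of_real v) ^ 2) \<le> 1"
    by (simp add: norm_divide norm_power flip: of_real_diff)
qed measurable

text \<open>The relevant points \<open>- d / c\<close> satisfy \<open>v \<le> -1\<close>, hence keep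
  distance at least \<open>1\<close> from the unit interval. The difference quotient of the kernel
  then differs from its derivative by at most \<open>2 * norm h\<close>, uniformly in
  \<open>s\<close>, which allows differentiation under the integral.\<close>

lemma deriv_phi0:
  assumes v: "v \<le> -1"
  shows "deriv phi0 (of_real v)
    = 1 / of_real pi * integral\<^sup>L U01 (\<lambda>s. ln (1 / s) *\<^sub>R (1 / (complex_of_real s - of_real v) ^ 2))"
    (is "_ = ?c * ?D")
proof (rule DERIV_imp_deriv, unfold DERIV_def, rule LIM_zero_cancel, rule tendsto_norm_zero_cancel)
  let ?v = "complex_of_real v"
  have out: "?v + h \<notin> complex_of_real ` {0..1}" if "norm h < 1/2" for h
  proof
    assume "?v + h \<in> complex_of_real ` {0..1}"
    then obtain t where t: "0 \<le> t" "?v + h = complex_of_real t" by auto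
    from arg_cong[OF t(2), of Re] have "v + Re h = t" by simp
    then show False using abs_Re_le_cmod[of h] that v t(1) by linarith
  qed
  have "\<forall>\<^sub>F h in at 0. norm (h::complex) < 1/2 \<and> h \<noteq> 0"
    by (auto simp: eventually_at intro!: exI[of _ "1/2"])
  then have bound: "\<forall>\<^sub>F h in at 0. norm ((phi0 (?v + h) - phi0 ?v) / h - ?c * ?D) \<le> 2 * norm h"
  proof eventually_elim
    case (elim h)
    let ?k = "\<lambda>w s. ln (1 / s) *\<^sub>R (1 / (complex_of_real s - w))"
    have i1: "integrable U01 (?k (?v + h))" using out[of h] elim by (intro integrable_cauchy_kernel) auto
    have i2: "integrable U01 (?k ?v)" using out[of 0] by (intro integrable_cauchy_kernel) auto
    note i3 = integrable_cauchy_kernel_square[OF v]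
    let ?q = "\<lambda>s. (1 / (complex_of_real s - (?v + h)) - 1 / (complex_of_real s - ?v)) / h - 1 / (complex_of_real s - ?v) ^ 2"
    have eq: "(phi0 (?v + h) - phi0 ?v) / h - ?c * ?D = ?c * integral\<^sup>L U01 (\<lambda>s. (?k (?v + h) s - ?k ?v s) / h
        - ln (1 / s) *\<^sub>R (1 / (complex_of_real s - of_real v) ^ 2))"
      using out[of h] out[of 0] elim i1 i2 i3
      by (simp add: phi0_eq_integral algebra_simps diff_divide_distrib)
    have eq2: "(\<lambda>s. (?k (?v + h) s - ?k ?v s) / h - ln (1 / s) *\<^sub>R (1 / (complex_of_real s - of_real v) ^ 2))
        = (\<lambda>s. ln (1 / s) *\<^sub>R ?q s)"
      by (intro ext) (simp add: scaleR_conv_of_real algebra_simps diff_divide_distrib)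
    have "norm (?c * integral\<^sup>L U01 (\<lambda>s. ln (1 / s) *\<^sub>R ?q s)) \<le> 1 * (2 * norm h)"
      unfolding norm_mult
    proof (intro mult_mono)
      show "norm (integral\<^sup>L U01 (\<lambda>s. ln (1 / s) *\<^sub>R ?q s)) \<le> 2 * norm h"
      proof (rule integral_ln_bounded(2))
        fix s :: real assume s: "0 < s" "s < 1"
        let ?a = "complex_of_real s - ?v" and ?b = "complex_of_real s - (?v + h)"
        have na: "norm ?a \<ge> 1" using s v by (simp flip: of_real_diff)
        have "norm ?a \<le> norm ?b + norm h" using norm_triangle_ineq[of ?b h] by simp
        then have nb: "norm ?b \<ge> 1/2" using na elim by linarith
        have ne: "?a \<noteq> 0" "?b \<noteq> 0" using na nb by auto
        have "1 / b - 1 / a = (a - b) / (b * a)" "1 / (b * a) - 1 / a ^ 2 = (a - b) / (b * a ^ 2)"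
          if "a \<noteq> 0" "b \<noteq> 0" for a b :: complex
          using that by (simp_all add: field_simps power2_eq_square)
        note frac = this[OF ne]
        have "(1 / ?b - 1 / ?a) / h = 1 / (?b * ?a)" unfolding frac(1) using elim by simp
        moreover note frac(2)
        ultimately have "?q s = h / (?b * ?a ^ 2)" by simp
        then have "norm (?q s) = norm h / (norm ?b * norm ?a ^ 2)" by (simp only: norm_divide norm_mult norm_power)
        also have "\<dots> \<le> norm h / (1/2 * 1 ^ 2)"
          using na nb by (intro divide_left_mono mult_mono power_mono mult_pos_pos) (auto intro: less_le_trans[of 0 "1/2"])
        finally show "norm (?q s) \<le> 2 * norm h" by simp
      qed measurable
    qed (use pi_ge_two in \<open>auto simp: norm_divide\<close>)
    then show ?case unfolding eq eq2 by simp
  qed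
  have lim: "((\<lambda>h::complex. 2 * norm h) \<longlongrightarrow> 0) (at 0)"
    by (rule tendsto_eq_intros refl | simp)+
  show "((\<lambda>h. norm ((phi0 (?v + h) - phi0 ?v) / h - ?c * ?D)) \<longlongrightarrow> 0) (at 0)"
    by (rule tendsto_sandwich[OF _ bound tendsto_const lim]) simp
qed

lemma mob_kernel_bounded:
  assumes g: "g \<in> brjuno_monoid" and \<delta>: "\<delta> > 0" "\<And>t. 0 \<le> t \<Longrightarrow> t \<le> 1 \<Longrightarrow> norm (complex_of_real t - z) \<ge> \<delta>"
    and s: "0 < s" "s < 1"
  shows "norm (1 / (of_real (den g s ^ 3) * (complex_of_real (mob g s) - z))) \<le> 1 / \<delta> * (1 / real_of_int (mat_d g) ^ 3)"
proof -
  have d: "real_of_int (mat_d g) \<ge> 1" using mat_d_ge1[OF g] by simp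
  have dn: "real_of_int (mat_d g) \<le> den g s" "1 \<le> den g s" using den_bounds[OF g, of s] s by auto
  have "\<delta> \<le> norm (complex_of_real (mob g s) - z)" using \<delta>(2) mob_range[OF g, of s] s by auto
  then have "1 / (den g s ^ 3 * norm (complex_of_real (mob g s) - z)) \<le> 1 / (real_of_int (mat_d g) ^ 3 * \<delta>)"
    using dn d \<delta>(1) by (intro divide_left_mono mult_mono power_mono mult_pos_pos zero_less_power) auto
  then show ?thesis using dn by (simp add: norm_divide norm_mult norm_power mult.commute)
qed

lemma mob_kernel_measurable [measurable]:
  "(\<lambda>s. 1 / (of_real (den g s ^ 3) * (complex_of_real (mob g s) - z))) \<in> borel_measurable borel"
  by measurable

lemma dist_unit_interval:
  assumes "Im z \<noteq> 0"
  shows "norm (complex_of_real t - z) \<ge> \<bar>Im z\<bar>"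
  using abs_Im_le_cmod[of "complex_of_real t - z"] by simp

text \<open>With \<open>w = (d z - b) / (a - c z)\<close> and \<open>v = - d / c\<close>, the correction terms in
  \<^const>\<open>L_op\<close> remove the first two Taylor coefficients at \<open>v\<close>, so the Cauchy kernel at \<open>w\<close> becomes
  the Cauchy kernel at \<open>z\<close> of the transported density.\<close>
lemma mobius_kernel_identity:
  fixes a b c d s z :: complex
  assumes "c \<noteq> 0" "a - c * z \<noteq> 0" "c * s + d \<noteq> 0" "(a * s + b) - z * (c * s + d) \<noteq> 0" "(a * d - b * c) ^ 2 = 1"
  shows "(a - c * z) * (1 / (s - (d * z - b) / (a - c * z)) - 1 / (s - (- d / c)))
      - (a * d - b * c) / c * (1 / (s - (- d / c)) ^ 2)
    = 1 / ((c * s + d) ^ 3 * ((a * s + b) / (c * s + d) - z))"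
proof -
  define D where "D = c * s + d"
  define N where "N = (a * s + b) - z * D"
  define e where "e = a * d - b * c"
  define k where "k = a - c * z"
  have nz: "c \<noteq> 0" "k \<noteq> 0" "D \<noteq> 0" "N \<noteq> 0" using assms by (auto simp: D_def N_def k_def)
  have e2: "e * e = 1" using assms(5) by (simp add: e_def power2_eq_square)
  have e: "k * D - c * N = e" by (simp add: k_def D_def N_def e_def algebra_simps)
  have 1: "s - (- d / c) = D / c" using nz by (simp add: D_def field_simps)
  have 2: "s - (d * z - b) / k = N / k" using nz by (simp add: N_def D_def k_def field_simps)
  have 3: "(a * s + b) / D - z = N / D" using nz by (simp add: N_def field_simps)
  have "k * (1 / (N / k) - 1 / (D / c)) - e / c * (1 / (D / c) ^ 2) = k * (k / N - c / D) - e * c / D ^ 2"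
    using nz by (simp add: power2_eq_square)
  also have "k / N - c / D = (k * D - c * N) / (N * D)" using nz by (simp add: diff_frac_eq)
  also have "\<dots> = e / (N * D)" by (simp only: e)
  also have "k * (e / (N * D)) - e * c / D ^ 2 = e * (k * D - c * N) / (N * D ^ 2)"
    using nz by (simp add: power2_eq_square field_simps)
  also have "\<dots> = 1 / (N * D ^ 2)" by (simp only: e e2)
  also have "\<dots> = 1 / (D ^ 3 * (N / D))" using nz by (simp add: power2_eq_square power3_eq_cube)
  finally show ?thesis unfolding 1 2[unfolded k_def] 3 e_def[symmetric] D_def[symmetric]
    unfolding 1 2 3 k_def[symmetric] e_def[symmetric] using 3 by (simp add: 1 2 3)
qed

lemma L_op_eq_integral:
  assumes g: "g \<in> brjuno_monoid" and z: "Im z \<noteq> 0"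
  shows "L_op g phi0 z = 1 / of_real pi *
    integral\<^sup>L U01 (\<lambda>s. ln (1 / s) *\<^sub>R (1 / (of_real (den g s ^ 3) * (complex_of_real (mob g s) - z))))"
  using g
proof (cases rule: monoid_cases)
  case 1
  have "z \<notin> complex_of_real ` {0..1}" using z by auto
  then show ?thesis using 1 by (simp add: L_op_def phi0_eq_integral)
next
  case (2 a b c d)
  let ?k = "complex_of_int a - of_int c * z"
  define w where "w = (of_int d * z - of_int b) / ?k"
  define v where "v = - real_of_int d / real_of_int c"
  define e where "e = complex_of_int (a * d - b * c)"
  have c: "real_of_int c \<ge> 1" "real_of_int d \<ge> real_of_int c" using 2 by auto
  then have v: "v \<le> -1" by (simp add: v_def)
  have k: "?k \<noteq> 0"
  proof
    assume "?k = 0"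
    then have "Im ?k = 0" by simp
    then show False using z c by simp
  qed
  have N: "(of_int a * complex_of_real s + of_int b) - z * (of_int c * complex_of_real s + of_int d) \<noteq> 0"
    if "0 \<le> s" for s
  proof
    assume "(of_int a * complex_of_real s + of_int b) - z * (of_int c * complex_of_real s + of_int d) = 0"
    then have "Im ((of_int a * complex_of_real s + of_int b) - z * (of_int c * complex_of_real s + of_int d)) = 0" by simp
    then have "Im z * (real_of_int c * s + real_of_int d) = 0" by simp
    moreover have "real_of_int c * s + real_of_int d > 0" using c that by (intro add_nonneg_pos mult_nonneg_nonneg) auto
    ultimately show False using z by simp
  qed
  \<comment> \<open>If \<open>w\<close> were a point \<open>s\<close> of the interval, then
    \<open>z = (a s + b) / (c s + d)\<close> would be real.\<close>
  have w: "w \<notin> complex_of_real ` {0..1}"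
  proof
    assume "w \<in> complex_of_real ` {0..1}"
    then obtain s where s: "0 \<le> s" "w = complex_of_real s" by auto
    then have "complex_of_real s * ?k = of_int d * z - of_int b" using k by (simp add: w_def field_simps)
    then show False using N[OF s(1)] by (simp add: algebra_simps)
  qed
  have vn: "complex_of_real v \<notin> complex_of_real ` {0..1}" using v by auto
  have e2: "(complex_of_int a * of_int d - of_int b * of_int c) ^ 2 = 1"
  proof -
    have "\<bar>a * d - b * c\<bar> ^ 2 = 1" using 2(2) by simp
    then have "(a * d - b * c) ^ 2 = 1" by simp
    then have "complex_of_int ((a * d - b * c) ^ 2) = 1" by simp
    then show ?thesis by simp
  qed
  let ?K = "\<lambda>u s. ln (1 / s) *\<^sub>R (1 / (complex_of_real s - u))"
  let ?K2 = "\<lambda>s. ln (1 / s) *\<^sub>R (1 / (complex_of_real s - of_real v) ^ 2)"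
  note i1 = integrable_cauchy_kernel[OF w] and i2 = integrable_cauchy_kernel[OF vn]
    and i3 = integrable_cauchy_kernel_square[OF v]
  have vv: "- complex_of_int d / complex_of_int c = of_real v" by (simp add: v_def)
  have "g \<noteq> (1, 0, 0, 1)" using 2 by auto
  then have "L_op g phi0 z = ?k * (phi0 w - phi0 (of_real v)) - e / of_int c * deriv phi0 (of_real v)"
    unfolding L_op_def if_not_P[OF \<open>g \<noteq> _\<close>] unfolding 2(1) prod.case w_def e_def vv by (intro refl)
  also have "\<dots> = 1 / of_real pi * (?k * (integral\<^sup>L U01 (?K w) - integral\<^sup>L U01 (?K (of_real v))) - e / of_int c * integral\<^sup>L U01 ?K2)"
    unfolding phi0_eq_integral[OF w] phi0_eq_integral[OF vn] deriv_phi0[OF v]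
  proof -
    have "k * (p * I1 - p * I2) - q * (p * I3) = p * (k * (I1 - I2) - q * I3)" for k p q I1 I2 I3 :: complex
      by (simp add: algebra_simps)
    then show "?k * (1 / of_real pi * integral\<^sup>L U01 (?K w) - 1 / of_real pi * integral\<^sup>L U01 (?K (of_real v)))
        - e / of_int c * (1 / of_real pi * integral\<^sup>L U01 ?K2)
      = 1 / of_real pi * (?k * (integral\<^sup>L U01 (?K w) - integral\<^sup>L U01 (?K (of_real v))) - e / of_int c * integral\<^sup>L U01 ?K2)" .
  qed
  also have "?k * (integral\<^sup>L U01 (?K w) - integral\<^sup>L U01 (?K (of_real v))) - e / of_int c * integral\<^sup>L U01 ?K2
      = integral\<^sup>L U01 (\<lambda>s. ?k * (?K w s - ?K (of_real v) s) - e / of_int c * ?K2 s)"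
    unfolding Bochner_Integration.integral_diff[OF i1 i2, symmetric]
      integral_mult_right_zero[symmetric]
    by (rule Bochner_Integration.integral_diff[symmetric])
      (intro integrable_mult_right Bochner_Integration.integrable_diff i1 i2 i3)+
  also have "\<dots> = integral\<^sup>L U01 (\<lambda>s. ln (1 / s) *\<^sub>R (1 / (of_real (den g s ^ 3) * (complex_of_real (mob g s) - z))))"
  proof (rule Bochner_Integration.integral_cong[OF refl])
    fix s assume "s \<in> space U01"
    then have s: "0 < s" "s < 1" by auto
    have "real_of_int c * s + real_of_int d > 0" using c s by (intro add_nonneg_pos mult_nonneg_nonneg) auto
    then have "complex_of_real (real_of_int c * s + real_of_int d) \<noteq> 0" unfolding of_real_eq_0_iff by simp
    then have D: "of_int c * complex_of_real s + of_int d \<noteq> 0" by simp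
    have "?k * (1 / (complex_of_real s - w) - 1 / (complex_of_real s - of_real v))
        - e / of_int c * (1 / (complex_of_real s - of_real v) ^ 2)
      = 1 / (of_real (den g s ^ 3) * (complex_of_real (mob g s) - z))"
    proof -
      have c0: "complex_of_int c \<noteq> 0" using c by auto
      have E: "complex_of_int a * of_int d - of_int b * of_int c = e" by (simp add: e_def)
      have "complex_of_real (den g s ^ 3) = (of_int c * of_real s + of_int d) ^ 3"
        "complex_of_real (mob g s) = (of_int a * of_real s + of_int b) / (of_int c * of_real s + of_int d)"
        using 2(1) by simp_all
      then show ?thesis
        using mobius_kernel_identity[OF c0 k D N[OF less_imp_le[OF s(1)]] e2, unfolded vv E, folded w_def]
        by (simp only:)
    qed
    then have sc: "ln (1 / s) *\<^sub>R (?k * (1 / (complex_of_real s - w) - 1 / (complex_of_real s - of_real v))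
        - e / of_int c * (1 / (complex_of_real s - of_real v) ^ 2))
      = ln (1 / s) *\<^sub>R (1 / (of_real (den g s ^ 3) * (complex_of_real (mob g s) - z)))" by (simp only:)
    then show "?k * (?K w s - ?K (of_real v) s) - e / of_int c * ?K2 s
      = ln (1 / s) *\<^sub>R (1 / (of_real (den g s ^ 3) * (complex_of_real (mob g s) - z)))"
    proof -
      have "k * (r *\<^sub>R p - r *\<^sub>R q) - x * (r *\<^sub>R u) = r *\<^sub>R (k * (p - q) - x * u)" for k p q x u :: complex and r :: real
        by (simp add: scaleR_conv_of_real algebra_simps)
      then show ?thesis by (rule trans) (rule sc)
    qed
  qed
  finally show ?thesis .
qed

lemma norm_L_op_le:
  assumes g: "g \<in> brjuno_monoid" and z: "Im z \<noteq> 0"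
  shows "norm (L_op g phi0 z) \<le> 1 / \<bar>Im z\<bar> * (1 / real_of_int (mat_d g) ^ 3)"
proof -
  have "norm (L_op g phi0 z) \<le> 1 * (1 / \<bar>Im z\<bar> * (1 / real_of_int (mat_d g) ^ 3))"
    unfolding L_op_eq_integral[OF g z] norm_mult
    using pi_ge_two z dist_unit_interval[OF z] mat_d_ge1[OF g]
    by (intro mult_mono integral_ln_bounded(2)[OF mob_kernel_measurable] mob_kernel_bounded[OF g]) (auto simp: norm_divide)
  then show ?thesis by simp
qed

lemma integrable_mob_kernel:
  assumes g: "g \<in> brjuno_monoid" and z: "Im z \<noteq> 0"
  shows "integrable U01 (\<lambda>s. ln (1 / s) *\<^sub>R (1 / (of_real (den g s ^ 3) * (complex_of_real (mob g s) - z))))"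
proof (rule integral_ln_bounded(1)[OF mob_kernel_measurable])
  fix s :: real assume "0 < s" "s < 1"
  then show "norm (1 / (of_real (den g s ^ 3) * (complex_of_real (mob g s) - z)))
    \<le> 1 / \<bar>Im z\<bar> * (1 / real_of_int (mat_d g) ^ 3)"
    using z dist_unit_interval[OF z] by (intro mob_kernel_bounded[OF g]) auto
qed

text \<open>The imaginary part of the Cauchy kernel \<open>1 / (t - z)\<close> is \<open>pi\<close>
  times the Poisson kernel; from here on only nonnegative real integrals have to be estimated near
  the boundary.\<close>

lemma Im_L_op:
  assumes g: "g \<in> brjuno_monoid" and z: "Im z > 0"
  shows "Im (L_op g phi0 z) = pterm g (Re z) (Im z)"
proof -
  let ?K = "\<lambda>s. ln (1 / s) *\<^sub>R (1 / (of_real (den g s ^ 3) * (complex_of_real (mob g s) - z)))"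
  have z': "Im z \<noteq> 0" using z by simp
  have bl: "bounded_linear (\<lambda>u. Im (1 / complex_of_real pi * u))"
    by (intro bounded_linear_compose[OF bounded_linear_Im] bounded_linear_mult_right)
  have "Im (L_op g phi0 z) = integral\<^sup>L U01 (\<lambda>s. Im (1 / complex_of_real pi * ?K s))"
    unfolding L_op_eq_integral[OF g z'] integral_bounded_linear[OF bl integrable_mob_kernel[OF g z']] ..
  also have "\<dots> = pterm g (Re z) (Im z)"
    unfolding pterm_def
  proof (rule Bochner_Integration.integral_cong[OF refl])
    fix s
    let ?T = "mob g s" and ?D = "den g s ^ 3"
    have "Im (1 / (complex_of_real ?T - z)) = Im z / ((?T - Re z) ^ 2 + Im z ^ 2)"
      by (simp add: Im_divide)
    moreover have "1 / complex_of_real pi * ?K s = (ln (1 / s) / pi / ?D) *\<^sub>R (1 / (complex_of_real ?T - z))"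
      by (simp add: scaleR_conv_of_real)
    ultimately show "Im (1 / complex_of_real pi * ?K s) = ln (1 / s) *\<^sub>R (poisson (Re z) (Im z) ?T / ?D)"
      by (simp only: scaleR_complex.sel poisson_def) simp
  qed
  finally show ?thesis .
qed

section \<open>Summation over the monoid and over translates\<close>

lemma summable_inverse_cube: "(\<lambda>g. 1 / real_of_int (mat_d g) ^ 3) summable_on brjuno_monoid"
proof (rule nonneg_bdd_above_summable_on)
  fix g assume "g \<in> brjuno_monoid"
  then show "0 \<le> 1 / real_of_int (mat_d g) ^ 3" using mat_d_ge1[of g] by simp
next
  show "bdd_above (sum (\<lambda>g. 1 / real_of_int (mat_d g) ^ 3) ` {F. F \<subseteq> brjuno_monoid \<and> finite F})"
    using sum_inverse_cube by (intro bdd_aboveI2[of _ _ 16]) auto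
qed

lemma infsum_inverse_cube_le: "(\<Sum>\<^sub>\<infinity>g\<in>brjuno_monoid. 1 / real_of_int (mat_d g) ^ 3) \<le> 16"
  by (intro infsum_le_finite_sums summable_inverse_cube sum_inverse_cube)

lemma infsum_le_inverse_cube:
  fixes f :: "int \<times> int \<times> int \<times> int \<Rightarrow> complex"
  assumes "\<And>g. g \<in> brjuno_monoid \<Longrightarrow> norm (f g) \<le> C * (1 / real_of_int (mat_d g) ^ 3)" "C \<ge> 0"
  shows "f summable_on brjuno_monoid" "norm (infsum f brjuno_monoid) \<le> 16 * C"
proof -
  have s: "(\<lambda>g. C * (1 / real_of_int (mat_d g) ^ 3)) summable_on brjuno_monoid"
    by (intro summable_on_cmult_right summable_inverse_cube)
  show f: "f summable_on brjuno_monoid"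
    using Infinite_Sum.abs_summable_on_comparison_test'[OF s assms(1)] by (rule abs_summable_summable)
  have "norm (infsum f brjuno_monoid) \<le> (\<Sum>\<^sub>\<infinity>g\<in>brjuno_monoid. C * (1 / real_of_int (mat_d g) ^ 3))"
    by (rule norm_infsum_le[OF has_sum_infsum[OF f] has_sum_infsum[OF s] assms(1)])
  also have "\<dots> = C * (\<Sum>\<^sub>\<infinity>g\<in>brjuno_monoid. 1 / real_of_int (mat_d g) ^ 3)"
    by (intro infsum_cmult_right summable_inverse_cube)
  also have "\<dots> \<le> C * 16" using assms(2) infsum_inverse_cube_le by (intro mult_left_mono)
  finally show "norm (infsum f brjuno_monoid) \<le> 16 * C" by simp
qed

lemma L_op_summable: "Im z \<noteq> 0 \<Longrightarrow> (\<lambda>g. L_op g phi0 z) summable_on brjuno_monoid"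
  by (rule infsum_le_inverse_cube(1)[OF norm_L_op_le]) auto

definition psum :: "real \<Rightarrow> real \<Rightarrow> real" where
  "psum x y = (\<Sum>\<^sub>\<infinity>g\<in>brjuno_monoid. pterm g x y)"

lemma pterm_summable: "y > 0 \<Longrightarrow> (\<lambda>g. pterm g x y) summable_on brjuno_monoid"
  using summable_on_Im[OF L_op_summable[of "Complex x y"]] Im_L_op[of _ "Complex x y"]
  by (simp cong: summable_on_cong)

lemma Im_brjuno_F: "Im z > 0 \<Longrightarrow> Im (brjuno_F z) = psum (Re z) (Im z)"
  unfolding brjuno_F_def psum_def
  by (subst infsum_Im[symmetric]) (auto intro!: L_op_summable infsum_cong Im_L_op)

lemma psum_nonneg: "y > 0 \<Longrightarrow> psum x y \<ge> 0"
  unfolding psum_def by (intro infsum_nonneg pterm_nonneg)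

lemma psum_le_far:
  assumes "y > 0" "\<delta> > 0" "\<And>t. 0 \<le> t \<Longrightarrow> t \<le> 1 \<Longrightarrow> \<bar>t - x\<bar> \<ge> \<delta>"
  shows "psum x y \<le> 16 * (y / \<delta> ^ 2)"
  unfolding psum_def
proof (rule infsum_le_finite_sums[OF pterm_summable[OF assms(1)]])
  fix G :: "(int \<times> int \<times> int \<times> int) set" assume G: "finite G" "G \<subseteq> brjuno_monoid"
  have "(\<Sum>g\<in>G. pterm g x y) \<le> (\<Sum>g\<in>G. y / \<delta> ^ 2 * (1 / real_of_int (mat_d g) ^ 3))"
    using G pterm_le_far assms by (intro sum_mono) blast
  also have "\<dots> = y / \<delta> ^ 2 * (\<Sum>g\<in>G. 1 / real_of_int (mat_d g) ^ 3)" by (simp add: sum_distrib_left)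
  also have "\<dots> \<le> y / \<delta> ^ 2 * 16" using assms sum_inverse_cube[OF G] by (intro mult_left_mono) auto
  finally show "(\<Sum>g\<in>G. pterm g x y) \<le> 16 * (y / \<delta> ^ 2)" by (simp add: mult.commute)
qed

text \<open>A single translate decays only like \<open>1 / n\<close>. Adding those by
  \<open>n\<close> and \<open>- n\<close> produces \<open>2 t / (t ^ 2 - n ^ 2)\<close>, of order
  \<open>1 / n ^ 2\<close>, which is the reason for symmetric summation. The bound on
  \<open>n\<close> gives \<open>n \<ge> 2 * norm t\<close>, hence a denominator of norm at least
  \<open>3 / 4 * n ^ 2\<close>.\<close>

lemma norm_L_op_pair_le:
  assumes g: "g \<in> brjuno_monoid" and z: "Im z \<noteq> 0" and n: "real n \<ge> 2 * (norm z + 1)"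
  shows "norm (L_op g phi0 (z - of_nat n) + L_op g phi0 (z + of_nat n))
    \<le> 3 * (norm z + 1) / real n ^ 2 * (1 / real_of_int (mat_d g) ^ 3)"
proof -
  define r where "r = norm z + 1"
  let ?K = "\<lambda>u s. 1 / (of_real (den g s ^ 3) * (complex_of_real (mob g s) - u))"
  let ?C = "3 * r / real n ^ 2 * (1 / real_of_int (mat_d g) ^ 3)"
  have r: "r \<ge> 1" "real n \<ge> 2 * r" using n by (auto simp: r_def)
  have zn: "Im (z - of_nat n) \<noteq> 0" "Im (z + of_nat n) \<noteq> 0" using z by auto
  have d: "real_of_int (mat_d g) \<ge> 1" using mat_d_ge1[OF g] by simp
  have "L_op g phi0 (z - of_nat n) + L_op g phi0 (z + of_nat n)
      = 1 / of_real pi * integral\<^sup>L U01 (\<lambda>s. ln (1 / s) *\<^sub>R (?K (z - of_nat n) s + ?K (z + of_nat n) s))"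
    unfolding L_op_eq_integral[OF g zn(1)] L_op_eq_integral[OF g zn(2)] scaleR_add_right
      Bochner_Integration.integral_add[OF integrable_mob_kernel[OF g zn(1)] integrable_mob_kernel[OF g zn(2)]]
    by (rule distrib_left[symmetric])
  also have "norm \<dots> \<le> 1 * ?C"
    unfolding norm_mult
  proof (intro mult_mono)
    show "norm (integral\<^sup>L U01 (\<lambda>s. ln (1 / s) *\<^sub>R (?K (z - of_nat n) s + ?K (z + of_nat n) s))) \<le> ?C"
    proof (rule integral_ln_bounded(2))
      fix s :: real assume s: "0 < s" "s < 1"
      define t where "t = complex_of_real (mob g s) - z"
      define D where "D = den g s ^ 3"
      have dn: "real_of_int (mat_d g) \<le> den g s" using den_bounds[OF g, of s] s by auto
      then have D: "real_of_int (mat_d g) ^ 3 \<le> D" unfolding D_def using d by (intro power_mono) auto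
      have D0: "0 < real_of_int (mat_d g) ^ 3" using d by simp
      have "norm t \<le> norm (complex_of_real (mob g s)) + norm z" unfolding t_def by (rule norm_triangle_ineq4)
      also have "norm (complex_of_real (mob g s)) \<le> 1" using mob_range[OF g, of s] s by simp
      finally have t: "norm t \<le> r" by (simp add: r_def)
      have nt: "norm (t ^ 2) \<le> r ^ 2" unfolding norm_power using t by (intro power_mono) auto
      have "(2 * r) ^ 2 \<le> real n ^ 2" using r by (intro power_mono) auto
      then have "r ^ 2 \<le> real n ^ 2 / 4" by (simp add: power_mult_distrib)
      moreover have "norm (complex_of_nat n ^ 2) - norm (t ^ 2) \<le> norm (t ^ 2 - of_nat n ^ 2)"
        by (metis norm_minus_commute norm_triangle_ineq2)
      ultimately have nn: "norm (t ^ 2 - of_nat n ^ 2) \<ge> 3/4 * real n ^ 2" using nt by (simp add: norm_power)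
      have n0: "real n ^ 2 > 0" using r by simp
      have tn: "t + of_nat n \<noteq> 0" "t - of_nat n \<noteq> 0"
      proof -
        have "(t + of_nat n) * (t - of_nat n) = t ^ 2 - of_nat n ^ 2" by (simp add: power2_eq_square algebra_simps)
        moreover have "t ^ 2 - of_nat n ^ 2 \<noteq> 0" using nn n0 by auto
        ultimately show "t + of_nat n \<noteq> 0" "t - of_nat n \<noteq> 0" by auto
      qed
      have "1 / (t + of_nat n) + 1 / (t - of_nat n) = 2 * t / (t ^ 2 - of_nat n ^ 2)"
        using tn by (simp add: add_frac_eq power2_eq_square algebra_simps)
      moreover have "?K (z - of_nat n) s + ?K (z + of_nat n) s = of_real (1 / D) * (1 / (t + of_nat n) + 1 / (t - of_nat n))"
        by (simp add: t_def D_def algebra_simps)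
      ultimately have "norm (?K (z - of_nat n) s + ?K (z + of_nat n) s) = 1 / D * (2 * norm t / norm (t ^ 2 - of_nat n ^ 2))"
      proof -
        have "D > 0" using D D0 by linarith
        then have "norm (complex_of_real (1 / D)) = 1 / D" unfolding norm_of_real by simp
        then show ?thesis using \<open>1 / (t + _) + _ = _\<close> \<open>?K _ s + ?K _ s = _\<close>
          by (simp only: norm_mult norm_divide[of "2 * t"] norm_numeral)
      qed
      also have "\<dots> \<le> 1 / real_of_int (mat_d g) ^ 3 * (2 * r / (3/4 * real n ^ 2))"
        using D D0 t nn n0 r by (intro mult_mono frac_le) auto
      also have "\<dots> = 1 / real_of_int (mat_d g) ^ 3 * (8 / 3 * r / real n ^ 2)" by simp
      also have "\<dots> \<le> 1 / real_of_int (mat_d g) ^ 3 * (3 * r / real n ^ 2)"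
        using D0 r n0 by (intro mult_left_mono divide_right_mono) auto
      finally show "norm (?K (z - of_nat n) s + ?K (z + of_nat n) s) \<le> ?C" by (simp add: mult.commute)
    qed measurable
  qed (use pi_ge_two in \<open>auto simp: norm_divide\<close>)
  finally show ?thesis by (simp add: r_def)
qed

lemma norm_brjuno_F_pair_le:
  assumes z: "Im z \<noteq> 0" and n: "real n \<ge> 2 * (norm z + 1)"
  shows "norm (brjuno_F (z - of_nat n) + brjuno_F (z + of_nat n)) \<le> 48 * (norm z + 1) * (1 / real n ^ 2)"
proof -
  have zn: "Im (z - of_nat n) \<noteq> 0" "Im (z + of_nat n) \<noteq> 0" using z by auto
  have "brjuno_F (z - of_nat n) + brjuno_F (z + of_nat n)
      = (\<Sum>\<^sub>\<infinity>g\<in>brjuno_monoid. L_op g phi0 (z - of_nat n) + L_op g phi0 (z + of_nat n))"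
    unfolding brjuno_F_def by (intro infsum_add[symmetric] L_op_summable zn)
  also have "norm \<dots> \<le> 16 * (3 * (norm z + 1) / real n ^ 2)"
    by (rule infsum_le_inverse_cube(2)[OF norm_L_op_pair_le[OF _ z n]]) auto
  finally show ?thesis by simp
qed

text \<open>\<open>lim\<close> is informative only if a limit exists, so convergence has to precede
  any use of \<open>complex_brjuno\<close>. The symmetric partial sums are \<open>brjuno_F z\<close>
  plus partial sums of an absolutely convergent series of pairs.\<close>

lemma complex_brjuno_LIMSEQ:
  assumes z: "Im z \<noteq> 0"
  shows "(\<lambda>N::nat. \<Sum>n\<in>{- int N..int N}. brjuno_F (z - of_int n)) \<longlonglongrightarrow> complex_brjuno z"
proof -
  define a where "a k = brjuno_F (z - of_nat (Suc k)) + brjuno_F (z + of_nat (Suc k))" for k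
  have S: "(\<Sum>n\<in>{- int N..int N}. brjuno_F (z - of_int n)) = brjuno_F z + (\<Sum>k<N. a k)" for N
  proof (induction N)
    case (Suc N)
    have "{- int (Suc N)..int (Suc N)} = insert (int (Suc N)) (insert (- int (Suc N)) {- int N..int N})" by auto
    then have "(\<Sum>n\<in>{- int (Suc N)..int (Suc N)}. brjuno_F (z - of_int n))
      = brjuno_F (z - of_int (int (Suc N))) + (brjuno_F (z - of_int (- int (Suc N))) + (\<Sum>n\<in>{- int N..int N}. brjuno_F (z - of_int n)))"
      by simp
    then show ?case using Suc by (simp add: a_def algebra_simps)
  qed simp
  have "summable a"
  proof (rule summable_comparison_test_ev)
    have "summable (\<lambda>k. 1 / real (Suc k) ^ 2)" using inverse_squares_sums by (simp add: sums_iff)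
    then show "summable (\<lambda>k. 48 * (norm z + 1) * (1 / real (Suc k) ^ 2))" by (rule summable_mult)
    have "\<forall>\<^sub>F k in sequentially. real (Suc k) \<ge> 2 * (norm z + 1)" by real_asymp
    then show "\<forall>\<^sub>F k in sequentially. norm (a k) \<le> 48 * (norm z + 1) * (1 / real (Suc k) ^ 2)"
      by eventually_elim (unfold a_def, rule norm_brjuno_F_pair_le[OF z])
  qed
  then have "convergent (\<lambda>N. brjuno_F z + (\<Sum>k<N. a k))"
    by (intro convergent_add convergent_const) (simp add: summable_iff_convergent)
  then show ?thesis unfolding complex_brjuno_def S by (simp add: convergent_LIMSEQ_iff)
qed

lemma sum_inverse_squares_int_bounded:
  obtains K :: real where "\<And>J. finite J \<Longrightarrow> 0 \<notin> J \<Longrightarrow> (\<Sum>j\<in>J. 1 / real_of_int j ^ 2) \<le> K"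
proof -
  have sm: "summable (\<lambda>k. 1 / real k ^ 2)" by (rule inverse_power_summable[of 2, unfolded inverse_eq_divide]) simp
  let ?K = "suminf (\<lambda>k. 1 / real k ^ 2)"
  have pos: "(\<Sum>j\<in>J. 1 / real_of_int j ^ 2) \<le> ?K" if "finite J" "\<And>j. j \<in> J \<Longrightarrow> j > 0" for J
  proof -
    have inj: "inj_on nat J" using that(2) by (intro inj_onI) (metis eq_nat_nat_iff less_imp_le)
    have "real (nat j) = real_of_int j" if "j \<in> J" for j using \<open>\<And>j. j \<in> J \<Longrightarrow> j > 0\<close>[OF that] by simp
    then have "(\<Sum>j\<in>J. 1 / real_of_int j ^ 2) = (\<Sum>j\<in>J. 1 / real (nat j) ^ 2)"
      by (intro sum.cong) auto
    also have "\<dots> = (\<Sum>k\<in>nat ` J. 1 / real k ^ 2)" using inj by (simp add: sum.reindex)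
    also have "\<dots> \<le> ?K" using that(1) sm by (intro sum_le_suminf) auto
    finally show ?thesis .
  qed
  have "(\<Sum>j\<in>J. 1 / real_of_int j ^ 2) \<le> 2 * ?K" if J: "finite J" "0 \<notin> J" for J
  proof -
    let ?P = "{j \<in> J. j > 0}" and ?N = "{j \<in> J. j < 0}"
    have "j > 0 \<or> j < 0" if "j \<in> J" for j using J(2) that by (metis linorder_cases)
    then have "J = ?P \<union> ?N" by blast
    then have "(\<Sum>j\<in>J. 1 / real_of_int j ^ 2) = (\<Sum>j\<in>?P \<union> ?N. 1 / real_of_int j ^ 2)" by simp
    also have "\<dots> = (\<Sum>j\<in>?P. 1 / real_of_int j ^ 2) + (\<Sum>j\<in>?N. 1 / real_of_int j ^ 2)"
      using J(1) by (intro sum.union_disjoint) auto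
    also have "(\<Sum>j\<in>?N. 1 / real_of_int j ^ 2) = (\<Sum>j\<in>uminus ` ?N. 1 / real_of_int j ^ 2)"
      by (subst sum.reindex) (auto simp: inj_on_def)
    also have "(\<Sum>j\<in>?P. 1 / real_of_int j ^ 2) + \<dots> \<le> ?K + ?K"
      using J(1) by (intro add_mono pos) auto
    finally show ?thesis by simp
  qed
  then show ?thesis using that by blast
qed

text \<open>The translates \<open>n \<noteq> m\<close> have their singularities at distance at least \<open>\<delta> \<bar>n - m\<bar>\<close> from \<open>z - m\<close>.\<close>
lemma Im_complex_brjuno_bounds:
  obtains K where "K \<ge> 0" "\<And>z m \<delta>. Im z > 0 \<Longrightarrow> \<delta> > 0 \<Longrightarrow> \<delta> \<le> Re z - of_int m \<Longrightarrow> Re z - of_int m \<le> 1 - \<delta> \<Longrightarrow>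
    psum (Re z - of_int m) (Im z) \<le> Im (complex_brjuno z) \<and>
    Im (complex_brjuno z) \<le> psum (Re z - of_int m) (Im z) + K * Im z / \<delta> ^ 2"
proof -
  obtain K where K: "\<And>J. finite J \<Longrightarrow> 0 \<notin> J \<Longrightarrow> (\<Sum>j\<in>J. 1 / real_of_int j ^ 2) \<le> K"
    using sum_inverse_squares_int_bounded by blast
  have K0: "K \<ge> 0" using K[of "{}"] by simp
  show ?thesis
  proof (rule that[of "16 * K"])
    fix z m and \<delta> :: real
    assume z: "Im z > 0" and \<delta>: "\<delta> > 0" "\<delta> \<le> Re z - of_int m" "Re z - of_int m \<le> 1 - \<delta>"
    let ?p = "\<lambda>n. psum (Re z - of_int n) (Im z)"
    have far: "?p n \<le> 16 * Im z / \<delta> ^ 2 * (1 / real_of_int (n - m) ^ 2)" if "n \<noteq> m" for n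
    proof -
      have nm: "real_of_int \<bar>n - m\<bar> \<ge> 1" using that by simp
      have "?p n \<le> 16 * (Im z / (\<delta> * real_of_int \<bar>n - m\<bar>) ^ 2)"
      proof (rule psum_le_far[OF z])
        show "\<delta> * real_of_int \<bar>n - m\<bar> > 0" using \<delta> nm by simp
        fix t :: real assume t: "0 \<le> t" "t \<le> 1"
        have "(1 - \<delta>) * (real_of_int \<bar>n - m\<bar> - 1) \<ge> 0" using \<delta> nm by (intro mult_nonneg_nonneg) auto
        then have "real_of_int \<bar>n - m\<bar> - (1 - \<delta>) \<ge> \<delta> * real_of_int \<bar>n - m\<bar>" by (simp add: algebra_simps)
        moreover have "\<bar>t - (Re z - of_int m)\<bar> \<le> 1 - \<delta>" using \<delta> t by linarith
        moreover have "t - (Re z - of_int n) = (t - (Re z - of_int m)) + real_of_int (n - m)" by simp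
        ultimately show "\<delta> * real_of_int \<bar>n - m\<bar> \<le> \<bar>t - (Re z - of_int n)\<bar>" unfolding of_int_abs by linarith
      qed
      also have "(\<delta> * real_of_int \<bar>n - m\<bar>) ^ 2 = \<delta> ^ 2 * real_of_int (n - m) ^ 2"
        by (simp add: power_mult_distrib)
      finally show ?thesis by simp
    qed
    have lim: "(\<lambda>N::nat. \<Sum>n\<in>{- int N..int N}. ?p n) \<longlonglongrightarrow> Im (complex_brjuno z)"
    proof -
      have "(\<lambda>N::nat. Im (\<Sum>n\<in>{- int N..int N}. brjuno_F (z - of_int n))) \<longlonglongrightarrow> Im (complex_brjuno z)"
        using z by (intro tendsto_Im complex_brjuno_LIMSEQ) simp
      then show ?thesis using z by (simp add: Im_brjuno_F)
    qed
    have ev: "\<forall>\<^sub>F N in sequentially. m \<in> {- int N..int N}"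
      by (rule eventually_sequentiallyI[of "nat \<bar>m\<bar>"]) auto
    have "\<forall>\<^sub>F N in sequentially. ?p m \<le> (\<Sum>n\<in>{- int N..int N}. ?p n)"
      using ev by eventually_elim (rule member_le_sum, use psum_nonneg z in auto)
    then have 1: "?p m \<le> Im (complex_brjuno z)" by (rule tendsto_lowerbound[OF lim]) simp
    have "\<forall>\<^sub>F N in sequentially. (\<Sum>n\<in>{- int N..int N}. ?p n) \<le> ?p m + 16 * K * Im z / \<delta> ^ 2"
      using ev
    proof eventually_elim
      case (elim N)
      let ?A = "{- int N..int N} - {m}"
      have "(\<Sum>n\<in>{- int N..int N}. ?p n) = ?p m + (\<Sum>n\<in>?A. ?p n)" using elim by (simp add: sum.remove)
      also have "(\<Sum>n\<in>?A. ?p n) \<le> (\<Sum>n\<in>?A. 16 * Im z / \<delta> ^ 2 * (1 / real_of_int (n - m) ^ 2))"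
        by (intro sum_mono far) auto
      also have "\<dots> = 16 * Im z / \<delta> ^ 2 * (\<Sum>n\<in>?A. 1 / real_of_int (n - m) ^ 2)" by (rule sum_distrib_left[symmetric])
      also have "(\<Sum>n\<in>?A. 1 / real_of_int (n - m) ^ 2) = (\<Sum>j\<in>(\<lambda>n. n - m) ` ?A. 1 / real_of_int j ^ 2)"
        by (subst sum.reindex) (auto simp: inj_on_def)
      also have "16 * Im z / \<delta> ^ 2 * \<dots> \<le> 16 * Im z / \<delta> ^ 2 * K"
        using z by (intro mult_left_mono K) auto
      finally show ?case by (simp add: mult_ac)
    qed
    then have 2: "Im (complex_brjuno z) \<le> ?p m + 16 * K * Im z / \<delta> ^ 2" by (rule tendsto_upperbound[OF lim]) simp
    show "?p m \<le> Im (complex_brjuno z) \<and> Im (complex_brjuno z) \<le> ?p m + 16 * K * Im z / \<delta> ^ 2"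
      using 1 2 by blast
  qed (use K0 in simp)
qed

section \<open>Boundary behaviour at irrational points\<close>

text \<open>While \<open>p\<close> stays positive, \<open>Re w\<close> and \<open>Im w\<close> tend
  to \<open>0\<close>, so the quotient tends to infinity along any approach inside the half-plane;
  hence the lower bound is not tied to an approach region. The factor \<open>k\<close> will carry
  the orientation sign of the matrix.\<close>

lemma tendsto_arctan_boundary:
  assumes "p > 0"
  shows "((\<lambda>w. arctan ((p - k * Re w) / Im w)) \<longlongrightarrow> pi / 2) (at 0 within {w. Im w > 0})"
proof -
  let ?F = "at 0 within {w. Im w > 0}"
  have Im: "(Im \<longlongrightarrow> 0) ?F" and Re: "(Re \<longlongrightarrow> 0) ?F"
    by (rule tendsto_eq_intros refl | simp)+
  have "\<forall>\<^sub>F w in ?F. Im w > 0" by (auto simp: eventually_at_filter)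
  then have "filterlim (\<lambda>w. inverse (Im w)) at_top ?F" by (rule filterlim_inverse_at_top[OF Im])
  moreover have "((\<lambda>w. p - k * Re w) \<longlongrightarrow> p) ?F"
    by (rule tendsto_eq_intros Re refl | simp)+
  ultimately have "filterlim (\<lambda>w. (p - k * Re w) * inverse (Im w)) at_top ?F"
    using assms by (intro filterlim_tendsto_pos_mult_at_top)
  then have "filterlim (\<lambda>w. (p - k * Re w) / Im w) at_top ?F" by (simp only: divide_inverse)
  then show ?thesis by (rule filterlim_compose[OF tendsto_arctan_at_top])
qed

text \<open>On a small interval around \<open>s0\<close> the density is at least its value at
  \<open>s0\<close> minus \<open>e / 2\<close>, and the Poisson mass of the image of that interval
  tends to \<open>1\<close>. Nonnegativity discards the rest.\<close>

lemma pterm_liminf: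
  assumes g: "g \<in> brjuno_monoid" and s0: "0 < s0" "s0 < 1" and e: "e > 0"
  shows "\<forall>\<^sub>F w in at 0 within {w. Im w > 0}. ln (1 / s0) / den g s0 - e \<le> pterm g (mob g s0 + Re w) (Im w)"
proof -
  let ?F = "at 0 within {w::complex. Im w > 0}"
  let ?\<sigma> = "of_int (mat_det g) :: real"
  define f where "f s = ln (1 / s) / den g s" for s
  have ev: "\<forall>\<^sub>F w in ?F. Im w > 0" by (auto simp: eventually_at_filter)
  show ?thesis
  proof (cases "f s0 \<le> e")
    case True
    show ?thesis using ev
      by eventually_elim (use True pterm_nonneg[OF g] in \<open>auto simp: f_def intro: order.trans[of _ 0]\<close>)
  next
    case False
    have "den g s0 \<ge> 1" using den_bounds(3)[OF g, of s0] s0 by simp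
    then have "isCont f s0" unfolding f_def using s0 by (intro continuous_intros den_cont) auto
    then obtain \<delta> where \<delta>: "\<delta> > 0" "\<And>s. \<bar>s - s0\<bar> < \<delta> \<Longrightarrow> \<bar>f s - f s0\<bar> < e / 2"
      unfolding continuous_at_eps_delta using e by (metis half_gt_zero dist_real_def)
    define \<eta> where "\<eta> = min (\<delta> / 2) (min (s0 / 2) ((1 - s0) / 2))"
    define s1 s2 where "s1 = s0 - \<eta>" and "s2 = s0 + \<eta>"
    have \<eta>0: "\<eta> > 0" using \<delta>(1) s0 by (simp add: \<eta>_def)
    have "\<eta> \<le> \<delta> / 2" unfolding \<eta>_def by linarith
    then have \<eta>\<delta>: "\<eta> < \<delta>" using \<delta>(1) by linarith
    have \<eta>1: "\<eta> \<le> s0 / 2" unfolding \<eta>_def by linarith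
    have \<eta>2: "\<eta> \<le> (1 - s0) / 2" unfolding \<eta>_def by linarith
    note \<eta> = \<eta>0 \<eta>\<delta> \<eta>1 \<eta>2
    have s12: "0 < s1" "s1 < s0" "s0 < s2" "s2 < 1" using s0 \<eta> by (auto simp: s1_def s2_def)
    define m where "m = f s0 - e / 2"
    have m: "m > 0" using False e by (simp add: m_def)
    have fm: "m \<le> f s" if "s1 < s" "s < s2" for s
    proof -
      have "\<bar>s - s0\<bar> < \<delta>" using that \<eta> unfolding s1_def s2_def by linarith
      from \<delta>(2)[OF this] show ?thesis unfolding m_def by linarith
    qed
    have lower: "m * (?\<sigma> * (arctan ((mob g s2 - x) / y) / pi) - ?\<sigma> * (arctan ((mob g s1 - x) / y) / pi)) \<le> pterm g x y"
      if y: "y > 0" for x y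
    proof -
      let ?Q = "\<lambda>s. poisson x y (mob g s) / den g s ^ 2"
      let ?A = "\<lambda>s. ?\<sigma> * (arctan ((mob g s - x) / y) / pi)"
      have D: "(?A has_real_derivative ?Q s) (at s)" if "0 \<le> s" "s \<le> 1" for s
        by (rule mob_antiderivative[OF g poisson_antiderivative[OF y] that])
      have A_cont: "isCont ?A s" if "0 \<le> s" "s \<le> 1" for s using DERIV_isCont[OF D[OF that]] .
      have Q_cont: "isCont ?Q s" if "0 < s" "s < 1" for s
        using that den_bounds(3)[OF g, of s] DERIV_isCont[OF mob_deriv[OF g, of s]]
        by (intro continuous_intros isCont_o2[OF _ poisson_cont[OF y]] den_cont) auto
      have Q0: "0 \<le> ?Q s" for s using poisson_nonneg[OF y] by simp
      have lim: "(?A \<longlongrightarrow> ?A s1) (at_right s1)" "(?A \<longlongrightarrow> ?A s2) (at_left s2)"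
        using A_cont[of s1] A_cont[of s2] s12 unfolding isCont_def by (simp_all add: filterlim_at_split)
      have FTC: "set_integrable lborel {s1<..<s2} ?Q" "(LINT s:{s1<..<s2}|lborel. ?Q s) = ?A s2 - ?A s1"
        by (rule set_integral_FTC_nonneg[OF _ D Q_cont Q0 lim]; use s12 in simp)+
      have sub: "(\<lambda>s. indicator {0<..<1} s *\<^sub>R (indicator {s1<..<s2} s *\<^sub>R ?Q s)) = (\<lambda>s. indicator {s1<..<s2} s *\<^sub>R ?Q s)"
        using s12 by (auto simp: indicator_def)
      have I: "integrable U01 (\<lambda>s. indicator {s1<..<s2} s *\<^sub>R ?Q s)"
        unfolding integrable_U01_iff set_integrable_def sub using FTC(1) by (simp only: set_integrable_def)
      have "m * (?A s2 - ?A s1) = integral\<^sup>L U01 (\<lambda>s. m * (indicator {s1<..<s2} s *\<^sub>R ?Q s))"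
        unfolding integral_mult_right_zero integral_U01_eq FTC(2)[symmetric] set_lebesgue_integral_def sub ..
      also have "\<dots> \<le> pterm g x y"
        unfolding pterm_def
      proof (rule integral_mono[OF integrable_mult_right[OF I] pterm_integrable[OF g y]])
        fix s assume "s \<in> space U01"
        then have s: "0 < s" "s < 1" by auto
        have dn: "1 \<le> den g s" using den_bounds(3)[OF g, of s] s by simp
        have eq: "ln (1 / s) *\<^sub>R (poisson x y (mob g s) / den g s ^ 3) = f s * ?Q s"
          by (simp add: f_def power3_eq_cube power2_eq_square)
        show "m * (indicator {s1<..<s2} s *\<^sub>R ?Q s) \<le> ln (1 / s) *\<^sub>R (poisson x y (mob g s) / den g s ^ 3)"
        proof (cases "s \<in> {s1<..<s2}")
          case True
          then have "m * ?Q s \<le> f s * ?Q s" using fm Q0 by (intro mult_right_mono) auto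
          then show ?thesis using True unfolding eq by simp
        next
          case False
          have "0 \<le> f s" using s dn by (simp add: f_def)
          then have "0 \<le> f s * ?Q s" by (rule mult_nonneg_nonneg[OF _ Q0])
          then show ?thesis using False unfolding eq by simp
        qed
      qed
      finally show ?thesis .
    qed
    have p: "?\<sigma> * (mob g s2 - mob g s0) > 0" "?\<sigma> * (mob g s0 - mob g s1) > 0"
      using mob_less[OF g, of s0 s2] mob_less[OF g, of s1 s0] s12 by auto
    have \<sigma>_arctan: "?\<sigma> * arctan v = arctan (?\<sigma> * v)" for v
      by (cases rule: mat_det_cases[OF g]) (simp_all add: arctan_minus)
    have lim: "((\<lambda>w. m * (?\<sigma> * (arctan ((mob g s2 - (mob g s0 + Re w)) / Im w) / pi)
        - ?\<sigma> * (arctan ((mob g s1 - (mob g s0 + Re w)) / Im w) / pi))) \<longlongrightarrow> m) ?F"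
    proof -
      have \<sigma>a: "?\<sigma> * (arctan v / pi) = arctan (?\<sigma> * v) / pi" for v using \<sigma>_arctan[of v] by simp
      have al: "k * ((b - (a + u)) / y) = (k * (b - a) - k * u) / y"
        "k * ((b - (a + u)) / y) = - ((k * (a - b) - (- k) * u) / y)" for k a b u y :: real
        by (simp_all add: algebra_simps diff_divide_distrib add_divide_distrib)
      have 2: "?\<sigma> * (arctan ((mob g s2 - (mob g s0 + Re w)) / Im w) / pi)
        = arctan ((?\<sigma> * (mob g s2 - mob g s0) - ?\<sigma> * Re w) / Im w) / pi" for w
        unfolding \<sigma>a al(1) ..
      have 1: "?\<sigma> * (arctan ((mob g s1 - (mob g s0 + Re w)) / Im w) / pi)
        = - (arctan ((?\<sigma> * (mob g s0 - mob g s1) - (- ?\<sigma>) * Re w) / Im w) / pi)" for w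
        unfolding \<sigma>a al(2) arctan_minus by (rule minus_divide_left[symmetric])
      have "((\<lambda>w. m * (arctan ((?\<sigma> * (mob g s2 - mob g s0) - ?\<sigma> * Re w) / Im w) / pi
          - - (arctan ((?\<sigma> * (mob g s0 - mob g s1) - (- ?\<sigma>) * Re w) / Im w) / pi))) \<longlongrightarrow> m * (pi / 2 / pi - - (pi / 2 / pi))) ?F"
        by (intro tendsto_intros tendsto_arctan_boundary p) auto
      then show ?thesis unfolding 1 2 by simp
    qed
    have "\<forall>\<^sub>F w in ?F. f s0 - e < m * (?\<sigma> * (arctan ((mob g s2 - (mob g s0 + Re w)) / Im w) / pi)
        - ?\<sigma> * (arctan ((mob g s1 - (mob g s0 + Re w)) / Im w) / pi))"
      using order_tendstoD(1)[OF lim] e by (simp add: m_def)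
    then show ?thesis using ev
    proof eventually_elim
      case (elim w)
      from order.strict_trans2[OF elim(1) lower[OF elim(2)]] show ?case unfolding f_def by (rule less_imp_le)
    qed
  qed
qed

text \<open>The density is continuous in \<open>s\<close>, but closeness is measured in
  \<open>t = mob g s\<close>. As
  \<open>\<bar>s - s0\<bar> = \<bar>t - t0\<bar> * den g s * den g s0\<close> and each denominator
  is at most \<open>2 * d\<close>, the radius \<open>\<delta> / (4 * d ^ 2)\<close>
  suffices.\<close>

lemma mob_local_sup:
  assumes g: "g \<in> brjuno_monoid" and s0: "0 < s0" "s0 < 1" and e: "e > 0"
  obtains \<rho> where "\<rho> > 0" "\<And>s. 0 < s \<Longrightarrow> s < 1 \<Longrightarrow> \<bar>mob g s - mob g s0\<bar> < \<rho> \<Longrightarrow> ln (1 / s) / den g s \<le> ln (1 / s0) / den g s0 + e"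
proof -
  define f where "f s = ln (1 / s) / den g s" for s
  let ?d = "real_of_int (mat_d g)"
  have d: "?d \<ge> 1" using mat_d_ge1[OF g] by simp
  have "den g s0 \<ge> 1" using den_bounds(3)[OF g, of s0] s0 by simp
  then have "isCont f s0" unfolding f_def using s0 by (intro continuous_intros den_cont) auto
  then obtain \<delta> where \<delta>: "\<delta> > 0" "\<And>s. \<bar>s - s0\<bar> < \<delta> \<Longrightarrow> \<bar>f s - f s0\<bar> < e"
    unfolding continuous_at_eps_delta using e by (metis dist_real_def)
  show ?thesis
  proof (rule that[of "\<delta> / (4 * ?d ^ 2)"])
    show "\<delta> / (4 * ?d ^ 2) > 0" using \<delta>(1) d by simp
    fix s assume s: "0 < s" "s < 1" "\<bar>mob g s - mob g s0\<bar> < \<delta> / (4 * ?d ^ 2)"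
    have dn: "0 < den g s" "0 < den g s0" "den g s \<le> 2 * ?d" "den g s0 \<le> 2 * ?d"
      using den_bounds[OF g, of s] den_bounds[OF g, of s0] s s0 by auto
    have "\<bar>real_of_int (mat_det g)\<bar> = 1" by (cases rule: mat_det_cases[OF g]) simp_all
    then have "\<bar>mob g s - mob g s0\<bar> = \<bar>s - s0\<bar> / (den g s * den g s0)"
      using dn by (subst mob_diff) (auto simp: abs_mult)
    moreover have "den g s * den g s0 \<le> (2 * ?d) * (2 * ?d)" using dn by (intro mult_mono) auto
    then have "\<bar>s - s0\<bar> / (4 * ?d ^ 2) \<le> \<bar>s - s0\<bar> / (den g s * den g s0)"
      using dn d by (intro divide_left_mono mult_pos_pos) (auto simp: power2_eq_square)
    ultimately have "\<bar>s - s0\<bar> / (4 * ?d ^ 2) < \<delta> / (4 * ?d ^ 2)" using s(3) by linarith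
    then have "\<bar>s - s0\<bar> < \<delta>" using d by (simp add: divide_less_cancel)
    from \<delta>(2)[OF this] show "ln (1 / s) / den g s \<le> ln (1 / s0) / den g s0 + e"
      unfolding f_def by linarith
  qed
qed

definition brjuno_term :: "real \<Rightarrow> nat \<Rightarrow> real" where
  "brjuno_term x n = brj_beta_prev x n * ln (1 / brj_x x n)"

text \<open>The scale around \<open>\<alpha>\<close> outside of which the Poisson kernel at \<open>\<alpha> + w\<close> carries mass
  \<open>O(sqrt (Im w))\<close>.\<close>
definition poisson_scale :: "complex \<Rightarrow> real" where
  "poisson_scale w = max (2 * \<bar>Re w\<bar>) (sqrt (Im w))"

context irrational_unit
begin

lemma brjuno_term_nonneg: "brjuno_term x n \<ge> 0"
  using beta_pos[of n] xn[of n] by (simp add: brjuno_term_def)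

lemma brjuno_term_eq: "ln (1 / brj_x x n) / den (cf_mat x n) (brj_x x n) = brjuno_term x n"
  by (simp add: cf_den brjuno_term_def)

text \<open>Finitely many continued fraction matrices exhaust the series up to \<open>e / 2\<close>;
  all other terms are nonnegative.\<close>

lemma psum_lower:
  assumes sm: "summable (brjuno_term x)" and e: "e > 0"
  shows "\<forall>\<^sub>F w in at 0 within {w. Im w > 0}. suminf (brjuno_term x) - e \<le> psum (x + Re w) (Im w)"
proof -
  let ?F = "at 0 within {w::complex. Im w > 0}"
  have "(\<lambda>N. \<Sum>n<N. brjuno_term x n) \<longlonglongrightarrow> suminf (brjuno_term x)" using summable_LIMSEQ[OF sm] .
  then have "\<forall>\<^sub>F N in sequentially. suminf (brjuno_term x) - e / 2 < (\<Sum>n<N. brjuno_term x n)"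
    by (rule order_tendstoD) (use e in simp)
  then obtain N where N: "suminf (brjuno_term x) - e / 2 < (\<Sum>n<N. brjuno_term x n)"
    by (meson eventually_sequentially order_refl)
  \<comment> \<open>\<open>N + 1\<close> rather than \<open>N\<close>, so that the divisor is
    nonzero for an empty partial sum.\<close>
  define e' where "e' = e / (2 * real (N + 1))"
  have e': "e' > 0" using e by (simp add: e'_def)
  have "\<forall>\<^sub>F w in ?F. \<forall>n\<in>{..<N}. brjuno_term x n - e' \<le> pterm (cf_mat x n) (x + Re w) (Im w)"
  proof (intro eventually_ball_finite ballI)
    fix n
    show "\<forall>\<^sub>F w in ?F. brjuno_term x n - e' \<le> pterm (cf_mat x n) (x + Re w) (Im w)"
      using pterm_liminf[OF cf_monoid[of n] xn(2) xn(3) e', of n] unfolding cf_mob brjuno_term_eq .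
  qed simp
  moreover have "\<forall>\<^sub>F w in ?F. Im w > 0" by (auto simp: eventually_at_filter)
  ultimately show ?thesis
  proof eventually_elim
    case (elim w)
    have "real N * e' \<le> e / 2" using e by (simp add: e'_def field_simps)
    then have "suminf (brjuno_term x) - e \<le> (\<Sum>n<N. brjuno_term x n) - real N * e'" using N by linarith
    also have "\<dots> = (\<Sum>n<N. brjuno_term x n - e')" by (simp add: sum_subtractf)
    also have "\<dots> \<le> (\<Sum>n<N. pterm (cf_mat x n) (x + Re w) (Im w))" using elim by (intro sum_mono) auto
    also have "\<dots> = (\<Sum>g\<in>cf_mat x ` {..<N}. pterm g (x + Re w) (Im w))"
      using cf_inj by (subst sum.reindex) (auto intro: inj_on_subset)
    also have "\<dots> \<le> psum (x + Re w) (Im w)"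
      unfolding psum_def using elim cf_monoid by (intro finite_sum_le_infsum pterm_summable) (auto intro: pterm_nonneg)
    finally show ?case .
  qed
qed

section \<open>Denominators of rationals and intervals near an irrational point\<close>

text \<open>The \<open>N\<close>-th convergent is at distance at least \<open>2 R\<close> from
  \<open>x\<close>, so \<open>p / q\<close> is a different rational and differs from it by at least
  \<open>1 / (q q_N)\<close>. Conversely the two differ by at most \<open>3 / 2\<close> times the
  distance from \<open>x\<close> to the convergent, which is at most
  \<open>1 / (q_N q_(N+1))\<close>.\<close>

lemma rational_near_denominator:
  fixes p q :: int
  assumes q: "q \<ge> 1" and R: "2 * R \<le> cf_dist x N" and near: "\<bar>of_int p / of_int q - x\<bar> < R"
  shows "2 * cf_q x (Suc N) \<le> 3 * of_int q"
proof -
  obtain a b c d where g: "cf_mat x N = (a, b, c, d)" by (cases "cf_mat x N")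
  have qd: "cf_q x N = of_int d" by (simp add: cf_q_def g)
  then have d: "d \<ge> 1" using q_ge1[of N] by simp
  have dist: "cf_dist x N = \<bar>x - of_int b / of_int d\<bar>" by (simp add: cf_dist_def g)
  have "R > 0" using near by linarith
  then have "of_int p / of_int q \<noteq> of_int b / (of_int d :: real)" using near R dist by linarith
  then have "p * d - b * q \<noteq> 0" using q d by (auto simp: field_simps simp flip: of_int_mult)
  then have "1 \<le> \<bar>p * d - b * q\<bar>" by linarith
  then have "1 \<le> \<bar>real_of_int (p * d - b * q)\<bar>" by linarith
  then have "1 / (of_int q * of_int d) \<le> \<bar>real_of_int (p * d - b * q)\<bar> / (of_int q * of_int d)"
    using q d by (intro divide_right_mono) auto
  also have "\<dots> = \<bar>of_int p / of_int q - of_int b / of_int d\<bar>"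
    using q d by (simp add: diff_frac_eq abs_mult)
  also have "\<dots> \<le> 3 / 2 * cf_dist x N" using near R dist by linarith
  also have "\<dots> \<le> 3 / 2 * (1 / (of_int d * cf_q x (Suc N)))"
    using cf_dist_le[of N] unfolding qd by (intro mult_left_mono) auto
  finally have "1 / (of_int q * of_int d) * (2 * (of_int q * of_int d * cf_q x (Suc N)))
      \<le> 3 / 2 * (1 / (of_int d * cf_q x (Suc N))) * (2 * (of_int q * of_int d * cf_q x (Suc N)))"
    using q d q_ge1[of "Suc N"] by (intro mult_right_mono) auto
  then show ?thesis using q d q_ge1[of "Suc N"] by simp
qed

text \<open>If the image interval contains \<open>x\<close>, the matrix is a continued fraction
  matrix of index beyond \<open>N\<close>. Otherwise an endpoint lies between \<open>mob g s\<close>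
  and \<open>x\<close>, hence within \<open>R\<close> of \<open>x\<close>. The endpoints are
  rationals with denominators \<open>d\<close> and \<open>c + d \<le> 2 * d\<close>, which leads to
  the factor \<open>3\<close>.\<close>

lemma near_cylinder_denominator:
  assumes g: "g \<in> brjuno_monoid" "g \<notin> cf_mat x ` {..N}" and R: "2 * R \<le> cf_dist x N"
    and s: "0 < s" "s < 1" "\<bar>mob g s - x\<bar> < R"
  shows "cf_q x (Suc N) / 3 \<le> of_int (mat_d g)"
proof (cases "x \<in> mob g ` {0<..<1}")
  case True
  then obtain n where n: "g = cf_mat x n" using cf_surj[OF g(1)] by force
  then have "Suc N \<le> n" using g(2) by (metis atMost_iff image_eqI not_less_eq_eq)
  then have "cf_q x (Suc N) \<le> cf_q x n" by (rule q_mono)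
  also have "\<dots> = of_int (mat_d g)" by (simp only: cf_q_def n)
  finally have "cf_q x (Suc N) \<le> of_int (mat_d g)" .
  then show ?thesis using q_ge1[of "Suc N"] by linarith
next
  case False
  obtain a b c d where gd: "g = (a, b, c, d)" by (cases g)
  note bd = monoid_bounds[OF g(1)[unfolded gd]]
  have "mob g s \<in> mob g ` {0<..<1}" using s by auto
  then have "mob g s \<in> {min (mob g 0) (mob g 1)<..<max (mob g 0) (mob g 1)}" "x \<notin> {min (mob g 0) (mob g 1)<..<max (mob g 0) (mob g 1)}"
    using False mob_image[OF g(1)] by auto
  then have "\<bar>mob g 0 - x\<bar> < R \<or> \<bar>mob g 1 - x\<bar> < R"
    using s(3) by (auto simp: min_def max_def split: if_splits)
  then have "2 * cf_q x (Suc N) \<le> 3 * of_int (c + d) \<or> 2 * cf_q x (Suc N) \<le> 3 * of_int d"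
    using rational_near_denominator[OF _ R, of d b] rational_near_denominator[OF _ R, of "c + d" "a + b"] bd
    by (auto simp: gd)
  moreover have "real_of_int (c + d) \<le> 2 * of_int d" "real_of_int d \<ge> 1" using bd by auto
  ultimately show ?thesis by (auto simp: gd)
qed

text \<open>The pole of the density sits at the convergent \<open>mob g 0\<close>. A point within
  \<open>R\<close> of \<open>x\<close> is at least half as far from it as \<open>x\<close> is, which
  costs a factor \<open>2\<close>; comparing denominators costs another, so
  \<open>s \<ge> x_n / 4\<close>. Hence the \<open>ln 4\<close>; the leading \<open>2\<close> comes
  from \<open>1 / q_n \<le> 2 * \<beta>_(n-1)\<close>.\<close>

lemma convergent_local_bound:
  assumes R: "2 * R \<le> cf_dist x n" and s: "0 < s" "s < 1" "\<bar>mob (cf_mat x n) s - x\<bar> < R"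
  shows "ln (1 / s) / den (cf_mat x n) s \<le> 2 * brj_beta_prev x n * (ln 4 + ln (1 / brj_x x n))"
proof -
  let ?g = "cf_mat x n" and ?r = "brj_x x n"
  let ?d = "real_of_int (mat_d ?g)"
  have d: "?d \<ge> 1" using mat_d_ge1[OF cf_monoid[of n]] by simp
  have dn: "?d \<le> den ?g s" using den_bounds(1)[OF cf_monoid[of n], of s] s by simp
  have dr: "den ?g ?r \<le> 2 * ?d" "0 < den ?g ?r" using den_bounds[OF cf_monoid[of n], of ?r] xn[of n] by auto
  have det: "\<bar>real_of_int (mat_det ?g)\<bar> = 1" by (cases rule: mat_det_cases[OF cf_monoid[of n]]) simp_all
  have df: "\<bar>mob ?g t - mob ?g 0\<bar> = t / (den ?g t * ?d)" if "0 < t" "t < 1" for t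
  proof -
    have "den ?g t > 0" using den_bounds(3)[OF cf_monoid[of n], of t] that by auto
    then show ?thesis using d that det by (subst mob_diff) (auto simp: abs_mult)
  qed
  have dist: "cf_dist x n = ?r / (den ?g ?r * ?d)"
    using df[of ?r] xn[of n] by (simp add: cf_dist_def cf_mob)
  have "cf_dist x n \<le> \<bar>mob ?g s - mob ?g 0\<bar> + \<bar>mob ?g s - x\<bar>" unfolding cf_dist_def by linarith
  moreover have "D \<le> 2 * A" if "D \<le> A + B" "2 * R \<le> D" "B < R" for A B D :: real using that by linarith
  ultimately have "cf_dist x n \<le> 2 * \<bar>mob ?g s - mob ?g 0\<bar>" using R s(3) by blast
  then have "?r / (den ?g ?r * ?d) \<le> 2 * (s / (den ?g s * ?d))" using df[of s] s unfolding dist by simp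
  also have "\<dots> \<le> 2 * (s / (?d * ?d))" using s d dn by (intro mult_left_mono divide_left_mono) auto
  finally have "?r / (den ?g ?r * ?d) \<le> 2 * (s / (?d * ?d))" .
  moreover have "?r / (2 * ?d * ?d) \<le> ?r / (den ?g ?r * ?d)"
    using dr d xn[of n] by (intro divide_left_mono mult_right_mono mult_pos_pos) auto
  ultimately have "?r / (2 * ?d * ?d) \<le> 2 * (s / (?d * ?d))" by linarith
  then have "?r / (2 * ?d * ?d) * (2 * ?d * ?d) \<le> 2 * (s / (?d * ?d)) * (2 * ?d * ?d)"
    using d by (intro mult_right_mono) auto
  then have "?r \<le> 4 * s" using d by simp
  then have "1 / s \<le> 4 * (1 / ?r)" using s xn[of n] by (simp add: field_simps)
  then have "ln (1 / s) \<le> ln (4 * (1 / ?r))" using s xn[of n] by (subst ln_le_cancel_iff) auto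
  also have "\<dots> = ln 4 + ln (1 / ?r)" using xn[of n] by (subst ln_mult) auto
  finally have 1: "ln (1 / s) \<le> ln 4 + ln (1 / ?r)" .
  have "1 / den ?g s \<le> 1 / ?d" using dn d by (intro divide_left_mono) auto
  also have "\<dots> \<le> 2 * brj_beta_prev x n" using beta_bounds(2)[of n] by (simp add: cf_q_def)
  finally have 2: "1 / den ?g s \<le> 2 * brj_beta_prev x n" .
  have "ln (1 / s) * (1 / den ?g s) \<le> (ln 4 + ln (1 / ?r)) * (2 * brj_beta_prev x n)"
    using 1 2 s dn d xn[of n] by (intro mult_mono) (auto intro!: add_nonneg_nonneg)
  then show ?thesis by (simp add: mult.commute)
qed

text \<open>Matrices with \<open>d \<ge> q_(N+1) / 3\<close> are summed at height \<open>y\<close>;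
  the divisor \<open>3\<close> turns the constant \<open>16\<close> into \<open>48\<close>. The
  local estimate serves for all others, with far parts summed at height \<open>R\<close> and
  \<open>D = 1\<close>.\<close>

lemma psum_upper:
  fixes M :: "nat \<Rightarrow> real"
  assumes y: "0 < y" "y < 1" and R: "0 < R" "R < 1" "\<bar>u\<bar> \<le> R / 2"
    and N: "2 * R \<le> cf_dist x N"
    and M: "\<And>n. n \<le> N \<Longrightarrow> 0 \<le> M n"
      "\<And>n s. n \<le> N \<Longrightarrow> 0 < s \<Longrightarrow> s < 1 \<Longrightarrow> \<bar>mob (cf_mat x n) s - x\<bar> < R \<Longrightarrow> ln (1 / s) / den (cf_mat x n) s \<le> M n"
  shows "psum (x + u) y \<le> (\<Sum>n\<le>N. M n) + 48 * (ln (1 / y) / cf_q x (Suc N)) + 64 * y + 5 * y / R * (16 * ln (1 / R) + 64 * R)"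
  unfolding psum_def
proof (rule infsum_le_finite_sums[OF pterm_summable[OF y(1)]])
  fix G :: "(int \<times> int \<times> int \<times> int) set" assume G: "finite G" "G \<subseteq> brjuno_monoid"
  define D where "D = cf_q x (Suc N) / 3"
  have D: "D > 0" using q_ge1[of "Suc N"] by (simp add: D_def)
  define G1 where "G1 = {g \<in> G. of_int (mat_d g) \<ge> D}"
  \<comment> \<open>The value \<open>0\<close> is right for the other matrices outside
    \<open>G1\<close>: they have no point within \<open>R\<close> of \<open>x\<close>, so the local
    condition on them is vacuous.\<close>
  define m where "m g = (if g \<in> cf_mat x ` {..N} then M (inv (cf_mat x) g) else 0)" for g
  have minv: "m (cf_mat x n) = M n" if "n \<le> N" for n
    using that cf_inj by (auto simp: m_def)
  have m0: "m g \<ge> 0" for g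
    using M(1) minv by (cases "g \<in> cf_mat x ` {..N}") (auto simp: m_def)
  have "(\<Sum>g\<in>G1. pterm g (x + u) y) \<le> 16 * ln (1 / y) / D + 64 * y"
    using G D y by (intro sum_pterm_le) (auto simp: G1_def)
  also have "16 * ln (1 / y) / D = 48 * (ln (1 / y) / cf_q x (Suc N))" by (simp add: D_def)
  finally have 1: "(\<Sum>g\<in>G1. pterm g (x + u) y) \<le> 48 * (ln (1 / y) / cf_q x (Suc N)) + 64 * y" .
  have "(\<Sum>g\<in>G - G1. pterm g (x + u) y) \<le> (\<Sum>g\<in>G - G1. m g + 5 * y / R * pterm g (x + u) R)"
  proof (intro sum_mono pterm_local_le)
    fix g s assume g: "g \<in> G - G1" and s: "0 < s" "s < 1" "\<bar>mob g s - (x + u)\<bar> < R / 2"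
    have near: "\<bar>mob g s - x\<bar> < R" using s(3) R(3) by linarith
    show "ln (1 / s) / den g s \<le> m g"
    proof (cases "g \<in> cf_mat x ` {..N}")
      case True
      then show ?thesis using M(2) s near minv by auto
    next
      case False
      then have "D \<le> of_int (mat_d g)"
        using near_cylinder_denominator[OF _ False N s(1,2) near] g G(2) by (auto simp: D_def)
      then show ?thesis using g by (auto simp: G1_def)
    qed
  qed (use G y R m0 in auto)
  also have "\<dots> = (\<Sum>g\<in>G - G1. m g) + 5 * y / R * (\<Sum>g\<in>G - G1. pterm g (x + u) R)"
    by (simp add: sum.distrib sum_distrib_left)
  also have "(\<Sum>g\<in>G - G1. m g) \<le> (\<Sum>n\<le>N. M n)"
  proof -
    have "(\<Sum>g\<in>G - G1. m g) \<le> (\<Sum>g\<in>(G - G1) \<union> cf_mat x ` {..N}. m g)"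
      using G(1) m0 by (intro sum_mono2) auto
    also have "\<dots> = (\<Sum>g\<in>cf_mat x ` {..N}. m g)"
      using G(1) by (intro sum.mono_neutral_right) (auto simp: m_def)
    also have "\<dots> = (\<Sum>n\<le>N. m (cf_mat x n))"
      using cf_inj by (subst sum.reindex) (auto intro: inj_on_subset)
    also have "\<dots> = (\<Sum>n\<le>N. M n)" using minv by simp
    finally show ?thesis .
  qed
  also have "(\<Sum>g\<in>G - G1. pterm g (x + u) R) \<le> 16 * ln (1 / R) / 1 + 64 * R"
    using G R mat_d_ge1 by (intro sum_pterm_le) force+
  finally have 2: "(\<Sum>g\<in>G - G1. pterm g (x + u) y) \<le> (\<Sum>n\<le>N. M n) + 5 * y / R * (16 * ln (1 / R) + 64 * R)"
    if "\<And>a b. a \<le> b \<Longrightarrow> 5 * y / R * a \<le> 5 * y / R * b" using that by simp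
  have 2: "(\<Sum>g\<in>G - G1. pterm g (x + u) y) \<le> (\<Sum>n\<le>N. M n) + 5 * y / R * (16 * ln (1 / R) + 64 * R)"
    using y R by (intro 2 mult_left_mono) auto
  have "(\<Sum>g\<in>G. pterm g (x + u) y) = (\<Sum>g\<in>G - G1. pterm g (x + u) y) + (\<Sum>g\<in>G1. pterm g (x + u) y)"
    using G(1) by (intro sum.subset_diff) (auto simp: G1_def)
  then show "(\<Sum>g\<in>G. pterm g (x + u) y) \<le> (\<Sum>n\<le>N. M n) + 48 * (ln (1 / y) / cf_q x (Suc N)) + 64 * y + 5 * y / R * (16 * ln (1 / R) + 64 * R)"
    using 1 2 by linarith
qed

lemma q_LIMSEQ: "filterlim (cf_q x) at_top sequentially"
proof (rule filterlim_at_top_mono)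
  show "filterlim (\<lambda>n. sqrt 2 ^ n / 2) at_top sequentially" by real_asymp
  show "\<forall>\<^sub>F n in sequentially. sqrt 2 ^ n / 2 \<le> cf_q x n"
    using q_growth by (intro always_eventually allI) (simp add: field_simps)
qed

lemma summable_beta: "summable (brj_beta_prev x)"
proof (rule summable_comparison_test)
  show "summable (\<lambda>n. 2 * (1 / sqrt 2) ^ n)" by (intro summable_mult summable_geometric) simp
  have "norm (brj_beta_prev x n) \<le> 2 * (1 / sqrt 2) ^ n" for n
  proof -
    have "brj_beta_prev x n \<le> 1 / cf_q x n" by (rule beta_bounds)
    also have "\<dots> \<le> 1 / (sqrt 2 ^ n / 2)" using q_growth[of n] q_ge1[of n] by (intro divide_left_mono) auto
    finally show ?thesis using beta_pos[of n] by (simp add: power_divide)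
  qed
  then show "\<exists>N. \<forall>n\<ge>N. norm (brj_beta_prev x n) \<le> 2 * (1 / sqrt 2) ^ n" by blast
qed

text \<open>The error \<open>e\<close> is spent in four quarters: the excess of the first
  \<open>N0 + 1\<close> densities over their values, the tail of the majorants \<open>T\<close>, the
  large denominators (\<open>48 * e / 192 = e / 4\<close>), and \<open>\<psi> R\<close>. Summability
  of \<open>T\<close> allows \<open>N0\<close> to be fixed before \<open>w\<close>, although
  \<open>N\<close> depends on \<open>w\<close>.\<close>

lemma eventually_psum_upper:
  assumes sm: "summable (brjuno_term x)" and W: "W \<subseteq> {w. Im w > 0}"
    and appr: "\<And>\<epsilon>. \<epsilon> > 0 \<Longrightarrow> \<forall>\<^sub>F w in at 0 within W. \<forall>n. cf_dist x n \<le> 2 * poisson_scale w \<longrightarrow> ln (1 / Im w) \<le> \<epsilon> * cf_q x n"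
    and e: "e > 0"
  shows "\<forall>\<^sub>F w in at 0 within W. psum (x + Re w) (Im w) \<le> suminf (brjuno_term x) + e"
proof -
  let ?F = "at 0 within W"
  define T where "T n = 2 * brj_beta_prev x n * (ln 4 + ln (1 / brj_x x n))" for n
  have T0: "T n \<ge> 0" for n
    using beta_pos[of n] xn[of n] by (auto simp: T_def intro!: mult_nonneg_nonneg add_nonneg_nonneg)
  have "T = (\<lambda>n. 2 * ln 4 * brj_beta_prev x n + 2 * brjuno_term x n)"
    by (simp add: T_def brjuno_term_def fun_eq_iff algebra_simps)
  then have "summable T" by (simp only:) (intro summable_add summable_mult summable_beta sm)
  then obtain N0 where N0: "\<And>m n. m \<ge> N0 \<Longrightarrow> norm (sum T {m..<n}) < e / 4"
    unfolding summable_Cauchy using e by (metis divide_pos_pos zero_less_numeral)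
  define e1 where "e1 = e / (4 * real (N0 + 1))"
  have e1: "e1 > 0" using e by (simp add: e1_def)
  have "\<exists>\<rho>. \<rho> > 0 \<and> (\<forall>s. 0 < s \<longrightarrow> s < 1 \<longrightarrow> \<bar>mob (cf_mat x n) s - x\<bar> < \<rho> \<longrightarrow>
      ln (1 / s) / den (cf_mat x n) s \<le> brjuno_term x n + e1)" for n
    using mob_local_sup[OF cf_monoid[of n] xn(2) xn(3) e1, of n] unfolding cf_mob brjuno_term_eq by metis
  then obtain \<rho> where \<rho>: "\<And>n. \<rho> n > 0" "\<And>n s. 0 < s \<Longrightarrow> s < 1 \<Longrightarrow> \<bar>mob (cf_mat x n) s - x\<bar> < \<rho> n \<Longrightarrow>
      ln (1 / s) / den (cf_mat x n) s \<le> brjuno_term x n + e1"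
    by metis
  \<comment> \<open>Below \<open>R0\<close> the first \<open>N0 + 1\<close> densities exceed their
    values at \<open>x\<close> by at most \<open>e1\<close>, and none of the first
    \<open>N0 + 1\<close> convergents is \<open>2 R\<close>-close, so that
    \<open>N \<ge> N0\<close>.\<close>
  define R0 where "R0 = Min ((\<lambda>n. min (\<rho> n) (cf_dist x n / 2)) ` {..N0})"
  have R0: "R0 > 0" unfolding R0_def using \<rho>(1) cf_dist_pos by (subst Min_gr_iff) auto
  have R0_le: "R0 \<le> \<rho> n" "2 * R0 \<le> cf_dist x n" if "n \<le> N0" for n
  proof -
    have "R0 \<le> min (\<rho> n) (cf_dist x n / 2)" unfolding R0_def using that by (intro Min_le) auto
    then show "R0 \<le> \<rho> n" "2 * R0 \<le> cf_dist x n" by auto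
  qed
  \<comment> \<open>The last two error terms of \<open>psum_upper\<close> after inserting
    \<open>y \<le> R ^ 2\<close>, which holds because the scale is at least
    \<open>sqrt (Im w)\<close>.\<close>
  define \<psi> where "\<psi> R = 64 * R ^ 2 + 5 * R * (16 * ln (1 / R) + 64 * R)" for R :: real
  have "(\<psi> \<longlongrightarrow> 0) (at_right 0)" unfolding \<psi>_def by real_asymp
  then have "\<forall>\<^sub>F R in at_right 0. \<psi> R < e / 4" by (rule order_tendstoD) (use e in simp)
  moreover have evW: "\<forall>\<^sub>F w in ?F. Im w > 0" using W by (auto simp: eventually_at_filter intro!: always_eventually)
  have sc: "filterlim poisson_scale (at_right 0) ?F"
  proof (rule tendsto_imp_filterlim_at_right)
    show "(poisson_scale \<longlongrightarrow> 0) ?F" unfolding poisson_scale_def by (rule tendsto_eq_intros refl | simp)+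
    show "\<forall>\<^sub>F w in ?F. poisson_scale w > 0" using evW by eventually_elim (simp add: poisson_scale_def less_max_iff_disj)
  qed
  ultimately have ev1: "\<forall>\<^sub>F w in ?F. \<psi> (poisson_scale w) < e / 4" using eventually_compose_filterlim by blast
  have "\<forall>\<^sub>F R in at_right (0::real). 0 < R \<and> R < min R0 1"
    by (rule eventually_at_rightI[of 0 "min R0 1"]) (use R0 in auto)
  then have ev2: "\<forall>\<^sub>F w in ?F. 0 < poisson_scale w \<and> poisson_scale w < min R0 1"
    using sc eventually_compose_filterlim by blast
  have "\<forall>\<^sub>F w in ?F. \<forall>n. cf_dist x n \<le> 2 * poisson_scale w \<longrightarrow> ln (1 / Im w) \<le> e / 192 * cf_q x n"
    using e by (intro appr) simp
  then show ?thesis using evW ev1 ev2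
  proof eventually_elim
    case (elim w)
    define R where "R = poisson_scale w"
    define y where "y = Im w"
    have R: "0 < R" "R < R0" "R < 1" using elim by (auto simp: R_def)
    have y: "0 < y" using elim by (simp add: y_def)
    have "sqrt y \<le> R" by (simp add: R_def poisson_scale_def y_def)
    then have "sqrt y ^ 2 \<le> R ^ 2" using y by (intro power_mono) auto
    then have yR: "y \<le> R ^ 2" using y by simp
    also have "R ^ 2 < 1" using R by (simp add: power_less_one_iff)
    finally have y1: "y < 1" .
    have u: "\<bar>Re w\<bar> \<le> R / 2" by (simp add: R_def poisson_scale_def)
    define n1 where "n1 = (LEAST n. cf_dist x n \<le> 2 * R)"
    have "\<forall>\<^sub>F n in sequentially. cf_dist x n < 2 * R" using cf_dist_tendsto_0 by (rule order_tendstoD) (use R in simp)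
    then have "\<exists>n. cf_dist x n \<le> 2 * R" by (meson eventually_sequentially less_imp_le order_refl)
    then have n1: "cf_dist x n1 \<le> 2 * R" unfolding n1_def by (rule LeastI_ex)
    have n1_least: "2 * R \<le> cf_dist x n" if "n < n1" for n
      using not_less_Least[of n "\<lambda>n. cf_dist x n \<le> 2 * R"] that by (simp add: n1_def)
    have "n1 > N0" using R0_le(2)[of n1] n1 R(2) by (cases "n1 \<le> N0") auto
    then obtain N where N: "n1 = Suc N" "N0 \<le> N" by (cases n1) auto
    define M where "M n = (if n \<le> N0 then brjuno_term x n + e1 else T n)" for n
    have "psum (x + Re w) y \<le> (\<Sum>n\<le>N. M n) + 48 * (ln (1 / y) / cf_q x (Suc N)) + 64 * y + 5 * y / R * (16 * ln (1 / R) + 64 * R)"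
    proof (rule psum_upper[OF y y1 R(1,3) u])
      show "2 * R \<le> cf_dist x N" using n1_least N by simp
      fix n assume n: "n \<le> N"
      show "0 \<le> M n" using T0 brjuno_term_nonneg[of n] e1 by (simp add: M_def)
      fix s assume s: "0 < s" "s < 1" "\<bar>mob (cf_mat x n) s - x\<bar> < R"
      show "ln (1 / s) / den (cf_mat x n) s \<le> M n"
      proof (cases "n \<le> N0")
        case True
        then show ?thesis using \<rho>(2)[OF s(1,2), of n] s(3) R(2) R0_le(1)[of n] by (simp add: M_def)
      next
        case False
        have "2 * R \<le> cf_dist x n" using n1_least n N by simp
        then show ?thesis using convergent_local_bound[OF _ s] False by (simp add: M_def T_def)
      qed
    qed
    moreover have "(\<Sum>n\<le>N. M n) \<le> suminf (brjuno_term x) + e / 2"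
    proof -
      have split: "{..N} = {..N0} \<union> {Suc N0..<Suc N}" using N by auto
      have "(\<Sum>n\<le>N. M n) = (\<Sum>n\<le>N0. M n) + (\<Sum>n\<in>{Suc N0..<Suc N}. M n)"
        unfolding split by (intro sum.union_disjoint) auto
      also have "(\<Sum>n\<le>N0. M n) = (\<Sum>n\<le>N0. brjuno_term x n) + real (N0 + 1) * e1"
        by (simp add: M_def sum.distrib)
      finally have "(\<Sum>n\<le>N. M n) = (\<Sum>n\<le>N0. brjuno_term x n) + real (N0 + 1) * e1 + (\<Sum>n\<in>{Suc N0..<Suc N}. M n)" .
      moreover have "real (N0 + 1) * e1 = e / 4" unfolding e1_def by (simp add: field_simps del: of_nat_add of_nat_Suc)
      moreover have "(\<Sum>n\<le>N0. brjuno_term x n) \<le> suminf (brjuno_term x)"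
        using sm brjuno_term_nonneg by (intro sum_le_suminf) auto
      moreover have "(\<Sum>n\<in>{Suc N0..<Suc N}. M n) = (\<Sum>n\<in>{Suc N0..<Suc N}. T n)" by (intro sum.cong) (auto simp: M_def)
      moreover have "norm (\<Sum>n\<in>{Suc N0..<Suc N}. T n) < e / 4" by (rule N0) simp
      ultimately show ?thesis unfolding real_norm_def by linarith
    qed
    moreover have "ln (1 / y) / cf_q x (Suc N) \<le> e / 192"
      using elim(1) n1 q_ge1[of "Suc N"] unfolding y_def R_def N by (simp add: divide_le_eq)
    moreover have "64 * y + 5 * y / R * (16 * ln (1 / R) + 64 * R) \<le> \<psi> R"
    proof -
      have "y / R \<le> R" using yR R by (simp add: divide_le_eq power2_eq_square)
      then have "5 * (y / R) * (16 * ln (1 / R) + 64 * R) \<le> 5 * R * (16 * ln (1 / R) + 64 * R)"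
        using R by (intro mult_right_mono add_nonneg_nonneg) auto
      then show ?thesis using yR by (simp add: \<psi>_def)
    qed
    moreover have "\<psi> R < e / 4" using elim by (simp add: R_def)
    ultimately show ?case unfolding y_def[symmetric] by linarith
  qed
qed

lemma psum_tendsto:
  assumes sm: "summable (brjuno_term x)" and W: "W \<subseteq> {w. Im w > 0}"
    and appr: "\<And>\<epsilon>. \<epsilon> > 0 \<Longrightarrow> \<forall>\<^sub>F w in at 0 within W. \<forall>n. cf_dist x n \<le> 2 * poisson_scale w \<longrightarrow> ln (1 / Im w) \<le> \<epsilon> * cf_q x n"
  shows "((\<lambda>w. psum (x + Re w) (Im w)) \<longlongrightarrow> suminf (brjuno_term x)) (at 0 within W)"
proof (rule tendstoI)
  fix e :: real assume "e > 0"
  then have e: "e / 2 > 0" by simp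
  have "\<forall>\<^sub>F w in at 0 within W. suminf (brjuno_term x) - e / 2 \<le> psum (x + Re w) (Im w)"
    by (rule filter_leD[OF at_le[OF W] psum_lower[OF sm e]])
  moreover have "\<forall>\<^sub>F w in at 0 within W. psum (x + Re w) (Im w) \<le> suminf (brjuno_term x) + e / 2"
    by (rule eventually_psum_upper[OF sm W _ e]) (rule appr)
  ultimately show "\<forall>\<^sub>F w in at 0 within W. dist (psum (x + Re w) (Im w)) (suminf (brjuno_term x)) < e"
    by eventually_elim (use \<open>e > 0\<close> in \<open>auto simp: dist_real_def abs_if\<close>)
qed

section \<open>Approach regions and arithmetic conditions\<close>

text \<open>Separates geometry from arithmetic: the region enters through a decreasing function
  \<open>\<Phi>\<close> of the scale, the number \<open>x\<close> through the growth of
  \<open>\<Phi>\<close> at the convergents. Any finite set of indices drops out, since the scale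
  eventually falls below half of each \<open>cf_dist x n\<close>; for the others monotonicity
  replaces the scale by \<open>cf_dist x n / 2\<close>.\<close>

lemma approach_condition:
  assumes bound: "\<forall>\<^sub>F w in at 0 within W. ln (1 / Im w) \<le> \<Phi> (poisson_scale w) \<and> poisson_scale w > 0"
    and anti: "\<And>R R'. 0 < R \<Longrightarrow> R \<le> R' \<Longrightarrow> \<Phi> R' \<le> \<Phi> R"
    and growth: "\<And>\<epsilon>. \<epsilon> > 0 \<Longrightarrow> \<forall>\<^sub>F n in sequentially. \<Phi> (cf_dist x n / 2) \<le> \<epsilon> * cf_q x n"
    and \<epsilon>: "\<epsilon> > 0"
  shows "\<forall>\<^sub>F w in at 0 within W. \<forall>n. cf_dist x n \<le> 2 * poisson_scale w \<longrightarrow> ln (1 / Im w) \<le> \<epsilon> * cf_q x n"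
proof -
  obtain n0 where n0: "\<And>n. n \<ge> n0 \<Longrightarrow> \<Phi> (cf_dist x n / 2) \<le> \<epsilon> * cf_q x n"
    using growth[OF \<epsilon>] unfolding eventually_sequentially by blast
  have "(poisson_scale \<longlongrightarrow> 0) (at 0 within W)" unfolding poisson_scale_def by (rule tendsto_eq_intros refl | simp)+
  then have "\<forall>\<^sub>F w in at 0 within W. \<forall>n\<in>{..<n0}. poisson_scale w < cf_dist x n / 2"
    using cf_dist_pos by (intro eventually_ball_finite ballI order_tendstoD(2)) auto
  with bound show ?thesis
  proof eventually_elim
    case (elim w)
    show ?case
    proof (intro allI impI)
      fix n assume n: "cf_dist x n \<le> 2 * poisson_scale w"
      have "n \<ge> n0"
      proof (rule ccontr)
        assume "\<not> n \<ge> n0"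
        then have "poisson_scale w < cf_dist x n / 2" using elim(2) by simp
        then show False using n by simp
      qed
      have "ln (1 / Im w) \<le> \<Phi> (poisson_scale w)" using elim by simp
      also have "\<dots> \<le> \<Phi> (cf_dist x n / 2)" using n cf_dist_pos[of n] by (intro anti) auto
      also have "\<dots> \<le> \<epsilon> * cf_q x n" by (rule n0) fact
      finally show "ln (1 / Im w) \<le> \<epsilon> * cf_q x n" .
    qed
  qed
qed

text \<open>The distance is \<open>\<beta>_(n-1) x_n / q_n\<close>, so its inverse is at most
  \<open>2 q_n ^ 2 / x_n\<close>. After division by \<open>q_n\<close> the part with
  \<open>ln q_n\<close> tends to \<open>0\<close>, and \<open>ln (1 / x_n) / q_n\<close> is at most
  twice the Brjuno term.\<close>

lemma ln_cf_dist_over_q: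
  assumes sm: "summable (brjuno_term x)"
  shows "(\<lambda>n. ln (4 / cf_dist x n) / cf_q x n) \<longlonglongrightarrow> 0"
proof (rule tendsto_sandwich[OF _ _ tendsto_const])
  have "cf_dist x n \<le> 1" for n
  proof -
    have "cf_dist x n \<le> 1 / (cf_q x n * cf_q x (Suc n))" by (rule cf_dist_le)
    also have "\<dots> \<le> 1 / (1 * 1)"
      using q_ge1[of n] q_ge1[of "Suc n"] by (intro divide_left_mono mult_mono) auto
    finally show ?thesis by simp
  qed
  then have "ln (4 / cf_dist x n) \<ge> 0" for n using cf_dist_pos[of n] by (smt (verit) ln_ge_zero le_divide_eq_1_pos)
  then show "\<forall>\<^sub>F n in sequentially. 0 \<le> ln (4 / cf_dist x n) / cf_q x n"
    using q_ge1 by (intro always_eventually allI divide_nonneg_nonneg) (auto intro: order.trans[OF zero_le_one])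
  show "\<forall>\<^sub>F n in sequentially. ln (4 / cf_dist x n) / cf_q x n \<le> (ln 8 + 2 * ln (cf_q x n)) / cf_q x n + 2 * brjuno_term x n"
  proof (intro always_eventually allI)
    fix n
    let ?q = "cf_q x n" and ?\<beta> = "brj_beta_prev x n" and ?r = "brj_x x n"
    have pos: "?q \<ge> 1" "?\<beta> > 0" "?r > 0" "?r < 1" using q_ge1[of n] beta_pos[of n] xn[of n] by auto
    have "4 / cf_dist x n = (1 / ?\<beta>) * (4 * ?q * (1 / ?r))"
      using pos by (simp add: cf_dist_eq brj_beta_prev_def)
    also have "\<dots> \<le> (2 * ?q) * (4 * ?q * (1 / ?r))"
      using beta_bounds(2)[of n] pos by (intro mult_right_mono) (auto simp: field_simps)
    finally have "ln (4 / cf_dist x n) \<le> ln ((2 * ?q) * (4 * ?q * (1 / ?r)))"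
      using cf_dist_pos[of n] pos by (subst ln_le_cancel_iff) auto
    also have "(2 * ?q) * (4 * ?q * (1 / ?r)) = 8 * ?q * ?q * (1 / ?r)" by simp
    also have "ln (8 * ?q * ?q * (1 / ?r)) = ln 8 + 2 * ln ?q + ln (1 / ?r)"
      using pos by (simp add: ln_mult ln_div)
    finally have "ln (4 / cf_dist x n) / ?q \<le> (ln 8 + 2 * ln ?q + ln (1 / ?r)) / ?q"
      using pos by (intro divide_right_mono) auto
    also have "\<dots> = (ln 8 + 2 * ln ?q) / ?q + 1 / ?q * ln (1 / ?r)" by (simp add: add_divide_distrib)
    also have "1 / ?q * ln (1 / ?r) \<le> 2 * ?\<beta> * ln (1 / ?r)"
      using beta_bounds(2)[of n] pos by (intro mult_right_mono) auto
    finally show "ln (4 / cf_dist x n) / ?q \<le> (ln 8 + 2 * ln ?q) / ?q + 2 * brjuno_term x n"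
      by (simp add: brjuno_term_def)
  qed
  have "((\<lambda>q::real. (ln 8 + 2 * ln q) / q) \<longlongrightarrow> 0) at_top" by real_asymp
  from filterlim_compose[OF this q_LIMSEQ]
  have "(\<lambda>n. (ln 8 + 2 * ln (cf_q x n)) / cf_q x n) \<longlonglongrightarrow> 0" .
  from tendsto_add[OF this tendsto_mult[OF tendsto_const summable_LIMSEQ_zero[OF sm], of 2]]
  show "(\<lambda>n. (ln 8 + 2 * ln (cf_q x n)) / cf_q x n + 2 * brjuno_term x n) \<longlonglongrightarrow> 0" by simp
qed

lemma ln_scale_growth:
  assumes sm: "summable (brjuno_term x)" and "C > 0" "\<epsilon> > 0"
  shows "\<forall>\<^sub>F n in sequentially. C * ln (2 / (cf_dist x n / 2)) \<le> \<epsilon> * cf_q x n"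
proof -
  have "\<forall>\<^sub>F n in sequentially. ln (4 / cf_dist x n) / cf_q x n < \<epsilon> / C"
    using ln_cf_dist_over_q[OF sm] by (rule order_tendstoD) (use assms in simp)
  then show ?thesis
  proof eventually_elim
    case (elim n)
    then show ?case using assms q_ge1[of n] by (simp add: field_simps)
  qed
qed

lemma ln_scale_bound:
  assumes "Im w > 0" "poisson_scale w = sqrt (Im w)" "poisson_scale w < 1"
  shows "ln (1 / Im w) \<le> 2 * ln (2 / poisson_scale w)"
proof -
  have "ln (1 / Im w) = 2 * ln (1 / poisson_scale w)" using assms by (simp add: ln_div ln_sqrt)
  also have "ln (1 / poisson_scale w) \<le> ln (2 / poisson_scale w)" using assms by (subst ln_le_cancel_iff) (auto simp: divide_right_mono)
  finally show ?thesis by simp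
qed

text \<open>The constant \<open>2 + H\<close> covers both values of the scale: \<open>2\<close> when
  it is \<open>sqrt (Im w)\<close>, and \<open>H\<close> when it is
  \<open>2 * \<bar>Re w\<bar>\<close> and the region bounds \<open>Im w\<close> below by a power.
  For logarithmic \<open>\<Phi>\<close> the Brjuno series supplies the growth.\<close>

lemma approach_power:
  fixes H :: real
  assumes sm: "summable (brjuno_term x)" and H: "H > 0" and \<epsilon>: "\<epsilon> > 0"
  shows "\<forall>\<^sub>F w in at 0 within {w. Im w > 0 \<and> Im w \<ge> \<bar>Re w\<bar> powr H}.
    \<forall>n. cf_dist x n \<le> 2 * poisson_scale w \<longrightarrow> ln (1 / Im w) \<le> \<epsilon> * cf_q x n"
proof (rule approach_condition[where \<Phi> = "\<lambda>R. (2 + H) * ln (2 / R)"])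
  let ?F = "at 0 within {w. Im w > 0 \<and> Im w \<ge> \<bar>Re w\<bar> powr H}"
  have "(poisson_scale \<longlongrightarrow> 0) ?F" unfolding poisson_scale_def by (rule tendsto_eq_intros refl | simp)+
  then have "\<forall>\<^sub>F w in ?F. poisson_scale w < 1" by (rule order_tendstoD) simp
  moreover have "\<forall>\<^sub>F w in ?F. Im w > 0 \<and> Im w \<ge> \<bar>Re w\<bar> powr H" by (auto simp: eventually_at_filter)
  ultimately show "\<forall>\<^sub>F w in ?F. ln (1 / Im w) \<le> (2 + H) * ln (2 / poisson_scale w) \<and> poisson_scale w > 0"
  proof eventually_elim
    case (elim w)
    then have pos: "poisson_scale w > 0" by (simp add: poisson_scale_def less_max_iff_disj)
    have l0: "ln (2 / poisson_scale w) \<ge> 0" using pos elim by simp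
    show ?case
    proof (cases "poisson_scale w = sqrt (Im w)")
      case True
      have "0 \<le> H * ln (2 / poisson_scale w)" using H l0 by simp
      then have "2 * ln (2 / poisson_scale w) \<le> (2 + H) * ln (2 / poisson_scale w)" by (simp add: distrib_right)
      have "ln (1 / Im w) \<le> 2 * ln (2 / poisson_scale w)"
        by (rule ln_scale_bound) (use elim True in auto)
      then show ?thesis using \<open>_ \<le> (2 + H) * _\<close> pos by (blast intro: order.trans)
    next
      case False
      then have sw: "poisson_scale w = 2 * \<bar>Re w\<bar>" by (auto simp: poisson_scale_def max_def split: if_splits)
      then have u: "\<bar>Re w\<bar> > 0" using pos by simp
      have "ln (\<bar>Re w\<bar> powr H) \<le> ln (Im w)" using u elim by (subst ln_le_cancel_iff) auto
      then have "ln (1 / Im w) \<le> H * ln (2 / poisson_scale w)" using u elim by (simp add: sw ln_powr ln_div)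
      also have "\<dots> \<le> (2 + H) * ln (2 / poisson_scale w)" using l0 by (intro mult_right_mono) auto
      finally show ?thesis using pos by simp
    qed
  qed
  show "(2 + H) * ln (2 / R') \<le> (2 + H) * ln (2 / R)" if "0 < R" "R \<le> R'" for R R'
    using that H by (intro mult_left_mono) (auto intro!: divide_left_mono)
  show "\<forall>\<^sub>F n in sequentially. (2 + H) * ln (2 / (cf_dist x n / 2)) \<le> \<epsilon> * cf_q x n" if "\<epsilon> > 0" for \<epsilon>
    using ln_scale_growth[OF sm, of "2 + H" \<epsilon>] that H by simp
qed (fact \<epsilon>)

text \<open>The region allows \<open>ln (1 / Im w)\<close> to reach
  \<open>\<bar>Re w\<bar> powr (- h)\<close>, a negative power of the scale, which the logarithmic
  estimate does not control; the lower bound on the distances does. The alternative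
  \<open>Re w = 0\<close> restores the vertical axis, where \<open>0 powr (- h) = 0\<close> would
  demand \<open>Im w \<ge> 1\<close>.\<close>

lemma approach_exponential:
  fixes h :: real
  assumes sm: "summable (brjuno_term x)" and h: "h > 0" and \<epsilon>: "\<epsilon> > 0"
    and dio: "\<And>A. A > 0 \<Longrightarrow> \<forall>\<^sub>F n in sequentially. cf_dist x n \<ge> A * cf_q x n powr (- 1 / h)"
  shows "\<forall>\<^sub>F w in at 0 within {w. Im w > 0 \<and> (Re w = 0 \<or> Im w \<ge> exp (- (\<bar>Re w\<bar> powr (- h))))}.
    \<forall>n. cf_dist x n \<le> 2 * poisson_scale w \<longrightarrow> ln (1 / Im w) \<le> \<epsilon> * cf_q x n"
proof (rule approach_condition[where \<Phi> = "\<lambda>R. max (2 * ln (2 / R)) ((R / 2) powr (- h))"])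
  let ?F = "at 0 within {w. Im w > 0 \<and> (Re w = 0 \<or> Im w \<ge> exp (- (\<bar>Re w\<bar> powr (- h))))}"
  have "(poisson_scale \<longlongrightarrow> 0) ?F" unfolding poisson_scale_def by (rule tendsto_eq_intros refl | simp)+
  then have "\<forall>\<^sub>F w in ?F. poisson_scale w < 1" by (rule order_tendstoD) simp
  moreover have "\<forall>\<^sub>F w in ?F. Im w > 0 \<and> (Re w = 0 \<or> Im w \<ge> exp (- (\<bar>Re w\<bar> powr (- h))))"
    by (auto simp: eventually_at_filter)
  ultimately show "\<forall>\<^sub>F w in ?F. ln (1 / Im w) \<le> max (2 * ln (2 / poisson_scale w)) ((poisson_scale w / 2) powr (- h)) \<and> poisson_scale w > 0"
  proof eventually_elim
    case (elim w)
    then have pos: "poisson_scale w > 0" by (simp add: poisson_scale_def less_max_iff_disj)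
    show ?case
    proof (cases "poisson_scale w = sqrt (Im w)")
      case True
      then show ?thesis using ln_scale_bound[of w] elim pos by auto
    next
      case False
      then have sw: "poisson_scale w = 2 * \<bar>Re w\<bar>" by (auto simp: poisson_scale_def max_def split: if_splits)
      then have u: "\<bar>Re w\<bar> > 0" using pos by simp
      then have "ln (exp (- (\<bar>Re w\<bar> powr (- h)))) \<le> ln (Im w)" using elim by (subst ln_le_cancel_iff) auto
      then have "ln (1 / Im w) \<le> (poisson_scale w / 2) powr (- h)" using elim by (simp add: sw ln_div)
      then show ?thesis using pos by simp
    qed
  qed
  show "max (2 * ln (2 / R')) ((R' / 2) powr (- h)) \<le> max (2 * ln (2 / R)) ((R / 2) powr (- h))" if "0 < R" "R \<le> R'" for R R'
    using that h by (intro max.mono mult_left_mono powr_mono2') (auto intro!: divide_left_mono)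
  show "\<forall>\<^sub>F n in sequentially. max (2 * ln (2 / (cf_dist x n / 2))) ((cf_dist x n / 2 / 2) powr (- h)) \<le> \<epsilon> * cf_q x n"
    if \<epsilon>: "\<epsilon> > 0" for \<epsilon>
  proof -
    \<comment> \<open>Chosen so that
      \<open>cf_dist x n / 4 \<ge> (\<epsilon> q_n) powr (- 1 / h)\<close>; the power
      \<open>- h\<close> of the right side is exactly \<open>\<epsilon> q_n\<close>.\<close>
    define A where "A = 4 * \<epsilon> powr (- 1 / h)"
    have A: "A > 0" using \<epsilon> by (simp add: A_def)
    show ?thesis using dio[OF A] ln_scale_growth[OF sm _ \<epsilon>, of 2, simplified]
    proof eventually_elim
      case (elim n)
      have q: "cf_q x n > 0" using q_ge1[of n] by simp
      have "\<epsilon> powr (- 1 / h) * cf_q x n powr (- 1 / h) \<le> cf_dist x n / 2 / 2"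
        using elim(1) by (simp add: A_def)
      then have "(cf_dist x n / 2 / 2) powr (- h) \<le> (\<epsilon> powr (- 1 / h) * cf_q x n powr (- 1 / h)) powr (- h)"
        using h \<epsilon> q by (intro powr_mono2') auto
      also have "\<dots> = \<epsilon> * cf_q x n" using h \<epsilon> q by (simp add: powr_mult powr_powr)
      finally show ?case using elim(2) by simp
    qed
  qed
qed (fact \<epsilon>)

text \<open>The lower bound on the distances gives \<open>x_n \<ge> q_n powr (1 - 1 / h)\<close>, so
  \<open>ln (1 / x_n)\<close> is \<open>O(ln q_n)\<close> and the Brjuno terms are
  \<open>O(1 / sqrt q_n)\<close>.\<close>

lemma summable_brjuno_term:
  fixes h :: real
  assumes h: "0 < h" "h < 1"
    and dio: "\<forall>\<^sub>F n in sequentially. cf_dist x n \<ge> 1 * cf_q x n powr (- 1 / h)"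
  shows "summable (brjuno_term x)"
proof (rule summable_comparison_test_ev)
  define C where "C = (1 / h - 1) * 2 * sqrt 2"
  \<comment> \<open>The ratio \<open>2 powr (- 1 / 4)\<close>: denominators grow at least like
    \<open>sqrt 2 ^ n\<close>, and the terms decay like their inverse square roots.\<close>
  define r where "r = 1 / sqrt (sqrt 2)"
  show "summable (\<lambda>n. C * r ^ n)" by (intro summable_mult summable_geometric) (simp add: r_def)
  show "\<forall>\<^sub>F n in sequentially. norm (brjuno_term x n) \<le> C * r ^ n"
    using dio
  proof eventually_elim
    case (elim n)
    let ?q = "cf_q x n" and ?\<beta> = "brj_beta_prev x n" and ?r = "brj_x x n"
    have pos: "?q \<ge> 1" "?\<beta> > 0" "?r > 0" "?r < 1" using q_ge1[of n] beta_pos[of n] xn[of n] by auto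
    have "?q * ?q powr (- 1 / h) \<le> ?q * cf_dist x n" using elim pos by (intro mult_left_mono) auto
    also have "\<dots> = ?\<beta> * ?r" using pos by (simp add: cf_dist_eq brj_beta_prev_def)
    also have "\<dots> \<le> 1 * ?r"
    proof (rule mult_right_mono)
      have "1 / ?q \<le> 1" using pos by simp
      then show "?\<beta> \<le> 1" using beta_bounds(1)[of n] by linarith
    qed (use pos in simp)
    finally have "ln (?q * ?q powr (- 1 / h)) \<le> ln ?r" using pos by (subst ln_le_cancel_iff) auto
    then have "ln (1 / ?r) \<le> (1 / h - 1) * ln ?q" using pos by (simp add: ln_mult ln_powr ln_div algebra_simps)
    also have "ln ?q = 2 * ln (sqrt ?q)" using pos by (simp add: ln_sqrt)
    also have "(1 / h - 1) * (2 * ln (sqrt ?q)) \<le> (1 / h - 1) * (2 * sqrt ?q)"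
      using h pos by (intro mult_left_mono ln_bound) auto
    finally have l: "ln (1 / ?r) \<le> (1 / h - 1) * (2 * sqrt ?q)" .
    have "brjuno_term x n \<le> 1 / ?q * ((1 / h - 1) * (2 * sqrt ?q))"
      unfolding brjuno_term_def using l pos beta_bounds(1)[of n] by (intro mult_mono) auto
    also have "\<dots> = (1 / h - 1) * 2 * (1 / sqrt ?q)" using pos by (simp add: real_div_sqrt field_simps flip: power2_eq_square)
    finally have b: "brjuno_term x n \<le> (1 / h - 1) * 2 * (1 / sqrt ?q)" .
    have "1 / sqrt ?q \<le> sqrt 2 * r ^ n"
    proof -
      have "sqrt (sqrt 2) ^ n = sqrt (sqrt 2 ^ n)" by (simp add: real_sqrt_power)
      also have "\<dots> \<le> sqrt (2 * ?q)" using q_growth[of n] by (rule real_sqrt_le_mono)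
      finally have "sqrt (sqrt 2) ^ n \<le> sqrt 2 * sqrt ?q" by (simp add: real_sqrt_mult)
      then show ?thesis using pos by (simp add: r_def power_divide field_simps)
    qed
    moreover have "0 \<le> (1 / h - 1) * 2" using h by (simp add: field_simps)
    ultimately have "(1 / h - 1) * 2 * (1 / sqrt ?q) \<le> (1 / h - 1) * 2 * (sqrt 2 * r ^ n)"
      by (intro mult_left_mono)
    then have "brjuno_term x n \<le> C * r ^ n" using b unfolding C_def by (simp only: mult.assoc)
    then show ?case using brjuno_term_nonneg[of n] by simp
  qed
qed

end

section \<open>Passage from the fractional part to a general irrational number\<close>

lemma dist_Z_le: "dist_Z t \<le> \<bar>t - of_int k\<bar>"
proof (cases "k \<le> \<lfloor>t\<rfloor>")
  case True
  then have "frac t \<le> t - of_int k" by (simp add: frac_def)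
  then have "frac t \<le> \<bar>t - of_int k\<bar>" by linarith
  then show ?thesis by (simp add: dist_Z_def min_le_iff_disj)
next
  case False
  then have "real_of_int k \<ge> of_int \<lfloor>t\<rfloor> + 1" by linarith
  then have "1 - frac t \<le> of_int k - t" by (simp add: frac_def)
  then have "1 - frac t \<le> \<bar>t - of_int k\<bar>" by linarith
  then show ?thesis by (simp add: dist_Z_def min_le_iff_disj)
qed

lemma brj_frac: "brj_x \<alpha> n = brj_x (frac \<alpha>) n"
  by (induction n) simp_all

lemma brjuno_B_frac: "brjuno_B \<alpha> = (\<Sum>n. ereal (brjuno_term (frac \<alpha>) n))"
  unfolding brjuno_B_def brjuno_term_def brj_beta_prev_def brj_frac[of \<alpha>] ..

lemma irrational_unit_frac:
  assumes "\<alpha> \<notin> \<rat>"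
  shows "irrational_unit (frac \<alpha>)"
proof
  have "frac \<alpha> = brj_x \<alpha> 0" by simp
  then show "frac \<alpha> \<notin> \<rat>" "0 < frac \<alpha>" "frac \<alpha> < 1" using brj_x_irrational[OF assms, of 0] by auto
qed

text \<open>The liminf is read along \<open>q = q_n\<close>, where
  \<open>dist_Z (q \<alpha>)\<close> is at most \<open>q_n\<close> times the distance to the
  convergent; this extra factor turns the exponent \<open>1 / h - 1\<close> into
  \<open>1 / h\<close>.\<close>

lemma diophantine_cf_dist:
  fixes h A :: real
  assumes \<alpha>: "\<alpha> \<notin> \<rat>" and lim: "liminf (\<lambda>q::nat. ereal (dist_Z (real q * \<alpha>) * real q powr (1 / h - 1))) = \<infinity>"
    and h: "h > 0" and A: "A > 0"
  shows "\<forall>\<^sub>F n in sequentially. cf_dist (frac \<alpha>) n \<ge> A * cf_q (frac \<alpha>) n powr (- 1 / h)"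
proof -
  interpret irrational_unit "frac \<alpha>" by (rule irrational_unit_frac[OF \<alpha>])
  let ?q = "cf_q (frac \<alpha>)"
  have "ereal A < liminf (\<lambda>q::nat. ereal (dist_Z (real q * \<alpha>) * real q powr (1 / h - 1)))" by (simp add: lim)
  from less_LiminfD[OF this]
  obtain q0 where q0: "\<And>q. q \<ge> q0 \<Longrightarrow> A < dist_Z (real q * \<alpha>) * real q powr (1 / h - 1)"
    unfolding eventually_sequentially by auto
  have "\<forall>\<^sub>F n in sequentially. ?q n \<ge> real q0" using q_LIMSEQ by (auto simp: filterlim_at_top)
  then show ?thesis
  proof eventually_elim
    case (elim n)
    obtain a b c d where g: "cf_mat (frac \<alpha>) n = (a, b, c, d)" by (cases "cf_mat (frac \<alpha>) n")
    have qd: "?q n = of_int d" by (simp add: cf_q_def g)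
    then have d: "d \<ge> 1" using q_ge1[of n] by simp
    define q where "q = nat d"
    have q: "real q = ?q n" "real q \<ge> 1" using d qd by (auto simp: q_def)
    have "q \<ge> q0" using elim q by simp
    have "dist_Z (real q * \<alpha>) \<le> \<bar>real q * \<alpha> - of_int (b + d * \<lfloor>\<alpha>\<rfloor>)\<bar>" by (rule dist_Z_le)
    also have "real q * \<alpha> - of_int (b + d * \<lfloor>\<alpha>\<rfloor>) = real q * (frac \<alpha> - of_int b / of_int d)"
      using d qd q by (simp add: frac_def algebra_simps)
    also have "\<bar>\<dots>\<bar> = real q * cf_dist (frac \<alpha>) n"
      using q by (simp add: abs_mult cf_dist_def g)
    finally have "A \<le> real q * cf_dist (frac \<alpha>) n * real q powr (1 / h - 1)"
      using q0[OF \<open>q \<ge> q0\<close>] by (meson less_imp_le mult_right_mono order.trans powr_ge_zero)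
    also have "\<dots> = cf_dist (frac \<alpha>) n * real q powr (1 / h)"
      using q by (simp add: powr_diff)
    finally have "A * real q powr (- 1 / h) \<le> cf_dist (frac \<alpha>) n * real q powr (1 / h) * real q powr (- 1 / h)"
      by (rule mult_right_mono) simp
    also have "\<dots> = cf_dist (frac \<alpha>) n" using q by (simp add: mult.assoc flip: powr_add)
    finally show ?case by (simp add: q)
  qed
qed

text \<open>With \<open>m\<close> the floor of \<alpha>, all other translates together contribute
  \<open>O(Im w)\<close>, so the periodized function has the same limit as
  \<open>psum\<close>.\<close>

lemma Im_complex_brjuno_tendsto:
  assumes \<alpha>: "\<alpha> \<notin> \<rat>" and sm: "summable (brjuno_term (frac \<alpha>))" and W: "W \<subseteq> {w. Im w > 0}"
    and appr: "\<And>\<epsilon>. \<epsilon> > 0 \<Longrightarrow> \<forall>\<^sub>F w in at 0 within W. \<forall>n. cf_dist (frac \<alpha>) n \<le> 2 * poisson_scale w \<longrightarrow>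
      ln (1 / Im w) \<le> \<epsilon> * cf_q (frac \<alpha>) n"
  shows "((\<lambda>w. ereal (Im (complex_brjuno (w + of_real \<alpha>)))) \<longlongrightarrow> brjuno_B \<alpha>) (at 0 within W)"
proof -
  interpret irrational_unit "frac \<alpha>" by (rule irrational_unit_frac[OF \<alpha>])
  let ?F = "at 0 within W"
  let ?S = "suminf (brjuno_term (frac \<alpha>))"
  obtain K where K: "K \<ge> 0" "\<And>z m \<delta>. Im z > 0 \<Longrightarrow> \<delta> > 0 \<Longrightarrow> \<delta> \<le> Re z - of_int m \<Longrightarrow> Re z - of_int m \<le> 1 - \<delta> \<Longrightarrow>
    psum (Re z - of_int m) (Im z) \<le> Im (complex_brjuno z) \<and>
    Im (complex_brjuno z) \<le> psum (Re z - of_int m) (Im z) + K * Im z / \<delta> ^ 2"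
    using Im_complex_brjuno_bounds by blast
  \<comment> \<open>Half the distance from the fractional part to the ends of the unit interval; the
    other half absorbs the shift by \<open>Re w\<close>.\<close>
  define \<delta> where "\<delta> = min (frac \<alpha>) (1 - frac \<alpha>) / 2"
  have \<delta>: "\<delta> > 0" "2 * \<delta> \<le> frac \<alpha>" "2 * \<delta> \<le> 1 - frac \<alpha>" using x01 by (auto simp: \<delta>_def)
  have Re: "(Re \<longlongrightarrow> 0) ?F" and Im: "(Im \<longlongrightarrow> 0) ?F" by (rule tendsto_eq_intros refl | simp)+
  have "\<forall>\<^sub>F w in ?F. \<bar>Re w\<bar> < \<delta>" using tendstoD[OF Re \<delta>(1)] by (simp add: dist_real_def)
  moreover have "\<forall>\<^sub>F w in ?F. Im w > 0" using W by (auto simp: eventually_at_filter intro!: always_eventually)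
  ultimately have ev: "\<forall>\<^sub>F w in ?F. psum (frac \<alpha> + Re w) (Im w) \<le> Im (complex_brjuno (w + of_real \<alpha>))
      \<and> Im (complex_brjuno (w + of_real \<alpha>)) \<le> psum (frac \<alpha> + Re w) (Im w) + K * Im w / \<delta> ^ 2"
  proof eventually_elim
    case (elim w)
    have a: "Re (w + of_real \<alpha>) - of_int \<lfloor>\<alpha>\<rfloor> = frac \<alpha> + Re w" "Im (w + of_real \<alpha>) = Im w"
      by (simp_all add: frac_def)
    have "\<delta> \<le> frac \<alpha> + Re w" "frac \<alpha> + Re w \<le> 1 - \<delta>" using elim(1) \<delta> by linarith+
    then show ?case using K(2)[of "w + of_real \<alpha>" \<delta> "\<lfloor>\<alpha>\<rfloor>", unfolded a] elim(2) \<delta>(1) by blast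
  qed
  have lim1: "((\<lambda>w. psum (frac \<alpha> + Re w) (Im w)) \<longlongrightarrow> ?S) ?F"
    by (rule psum_tendsto[OF sm W]) (rule appr)
  have lim2: "((\<lambda>w. psum (frac \<alpha> + Re w) (Im w) + K * Im w / \<delta> ^ 2) \<longlongrightarrow> ?S) ?F"
    using \<delta>(1) by (auto intro!: tendsto_eq_intros lim1 Im)
  have "((\<lambda>w. Im (complex_brjuno (w + of_real \<alpha>))) \<longlongrightarrow> ?S) ?F"
    by (rule tendsto_sandwich[OF _ _ lim1 lim2]) (use ev in \<open>auto elim: eventually_mono\<close>)
  moreover have "brjuno_B \<alpha> = ereal ?S"
    unfolding brjuno_B_frac using summable_sums[OF sm] by (intro sums_unique[symmetric]) (simp add: sums_ereal)
  ultimately show ?thesis by simp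
qed

theorem theorem5p19:
  shows "(\<forall>(\<alpha>::real) (H::real). brjuno_number \<alpha> \<and> H > 0 \<longrightarrow>
            ((\<lambda>w. ereal (Im (complex_brjuno (w + of_real \<alpha>)))) \<longlongrightarrow> brjuno_B \<alpha>)
              (at 0 within {w. Im w > 0 \<and> Im w \<ge> \<bar>Re w\<bar> powr H}))
       \<and> (\<forall>(\<alpha>::real) (h::real). \<alpha> \<notin> \<rat> \<and> 0 < h \<and> h < 1 / 2 \<and>
            liminf (\<lambda>q::nat. ereal (dist_Z (real q * \<alpha>) * real q powr (1 / h - 1))) = \<infinity> \<longrightarrow>
            ((\<lambda>w. ereal (Im (complex_brjuno (w + of_real \<alpha>)))) \<longlongrightarrow> brjuno_B \<alpha>)
              (at 0 within {w. Im w > 0 \<and> (Re w = 0 \<or> Im w \<ge> exp (- (\<bar>Re w\<bar> powr (- h))))}))"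
proof (intro conjI allI impI; elim conjE)
  fix \<alpha> H :: real assume \<alpha>: "brjuno_number \<alpha>" and H: "H > 0"
  then have \<alpha>_irr: "\<alpha> \<notin> \<rat>" and fin: "brjuno_B \<alpha> < \<infinity>" by (auto simp: brjuno_number_def)
  interpret irrational_unit "frac \<alpha>" by (rule irrational_unit_frac[OF \<alpha>_irr])
  have sm: "summable (brjuno_term (frac \<alpha>))"
    using fin brjuno_term_nonneg unfolding brjuno_B_frac by (intro summable_ereal) auto
  show "((\<lambda>w. ereal (Im (complex_brjuno (w + of_real \<alpha>)))) \<longlongrightarrow> brjuno_B \<alpha>)
      (at 0 within {w. Im w > 0 \<and> Im w \<ge> \<bar>Re w\<bar> powr H})"
    by (rule Im_complex_brjuno_tendsto[OF \<alpha>_irr sm _ approach_power[OF sm H]]) auto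
next
  fix \<alpha> h :: real
  assume \<alpha>_irr: "\<alpha> \<notin> \<rat>" and h: "0 < h" "h < 1 / 2"
    and lim: "liminf (\<lambda>q::nat. ereal (dist_Z (real q * \<alpha>) * real q powr (1 / h - 1))) = \<infinity>"
  interpret irrational_unit "frac \<alpha>" by (rule irrational_unit_frac[OF \<alpha>_irr])
  note dio = diophantine_cf_dist[OF \<alpha>_irr lim h(1)]
  \<comment> \<open>The Brjuno property is not assumed here; it follows from the Diophantine bound
    with \<open>A = 1\<close>.\<close>
  have sm: "summable (brjuno_term (frac \<alpha>))"
    using h by (intro summable_brjuno_term[OF _ _ dio]) auto
  show "((\<lambda>w. ereal (Im (complex_brjuno (w + of_real \<alpha>)))) \<longlongrightarrow> brjuno_B \<alpha>)
      (at 0 within {w. Im w > 0 \<and> (Re w = 0 \<or> Im w \<ge> exp (- (\<bar>Re w\<bar> powr (- h))))})"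
    by (rule Im_complex_brjuno_tendsto[OF \<alpha>_irr sm _ approach_exponential[OF sm h(1) _ dio]]) auto
qed

end
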